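(* For any quasi-topological incidence structure $\mathcal{Q}$ with the set of points $\mathcal{P}$ and the set of lines $\mathcal{L}$ there exists an Eulerian map $M=M(\mathcal{Q})$ on a closed surface, with skeleton $G=(V,E)$, such that $\mathcal{P}=V$, and each straight-ahead walk (SAW) is a simple closed curve that corresponds to a line from $\mathcal{L}$.
   Context: The projective plane is the real projective plane, viewed as the extended Euclidean plane. A pseudoline is a simple non-contractible closed curve in the projective plane. A quasiline arrangement is a collection of at least two (finitely many) pseudolines such that any two of them have a finite number of points in common and cross transversally at each common point. Points where pseudolines meet are called crossings (several pseudolines may pass through one crossing). Standing assumptions on all quasiline arrangements: no crossing is a point at infinity, and every pseudoline intersects the line at infinity exactly once. A quasi-topological incidence structure consists of a finite set $\mathcal{L}$ of lines, which are pseudolines forming a quasiline arrangement, and a finite set $\mathcal{P}$ of points of the projective plane, with incidence being containment; each point lies on at least two lines (so the points are crossings of the arrangement) and each line contains at least two points. The map $M(\mathcal{Q})$. Define a graph $G=(V,E)$ as follows: $V$ is the set of points of $\mathcal{Q}$, and two vertices are connected by an edge if the corresponding points of $\mathcal{Q}$ are consecutive on some pseudoline, with one edge for each arc of a pseudoline between consecutive points of $\mathcal{Q}$ (crossings that are not points of $\mathcal{Q}$ are ignored). Every pseudoline through a vertex contributes two edges at that vertex. For each vertex $v$ choose an orientation of the projective plane locally at $v$; it defines a cyclic order $\pi_v$ of the edges around $v$. Define $\lambda:E\to\{1,-1\}$ by $\lambda(e)=1$ if the chosen orientations at the ends $u,v$ of $e$ agree when moving from $u$ to $v$ along $e$, and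 $\lambda(e)=-1$ otherwise. The pair $\Pi=(\pi,\lambda)$, where $\pi=\{\pi_v: v\in V\}$, is an embedding scheme of $G$ and defines a map $M(\mathcal{Q})$ on some surface, uniquely determined up to homeomorphism. The graph $G$ is the skeleton of the map. A map is Eulerian if all vertex degrees of its skeleton are even. A straight-ahead walk (SAW) in an Eulerian map is a walk that always passes from an edge to the opposite edge in the rotation at the same vertex. *)

theory Defs
  imports "HOL-Analysis.Analysis" "HOL-Combinatorics.Orbits"
begin

section \<open>The real projective plane\<close>

text \<open>Points are pairs of antipodal points of the unit sphere, with the quotient topology.\<close>

typedef rp2 = "{{x, - x} | x :: real^3. norm x = 1}"
proof
  show "{axis 1 1, - axis 1 1} \<in> {{x, - x} | x :: real^3. norm x = 1}"
    by (auto intro!: exI[of _ "axis 1 1"] simp: norm_axis_1)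
qed

definition rp2_of :: "real^3 \<Rightarrow> rp2" where
  "rp2_of x = Abs_rp2 {x, - x}"

instantiation rp2 :: topological_space
begin

definition open_rp2 :: "rp2 set \<Rightarrow> bool" where
  "open_rp2 U \<longleftrightarrow> openin (top_of_set (sphere 0 1)) {x \<in> sphere 0 1. rp2_of x \<in> U}"

instance
proof
  have "{x \<in> sphere 0 1. rp2_of x \<in> UNIV} = sphere 0 1"
    by auto
  then show "open (UNIV :: rp2 set)"
    by (simp only: open_rp2_def openin_subtopology_self)
next
  fix S T :: "rp2 set"
  assume "open S" "open T"
  moreover have "{x \<in> sphere 0 1. rp2_of x \<in> S \<inter> T} =
      {x \<in> sphere 0 1. rp2_of x \<in> S} \<inter> {x \<in> sphere 0 1. rp2_of x \<in> T}"
    by auto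
  ultimately show "open (S \<inter> T)"
    by (simp only: open_rp2_def openin_Int)
next
  fix K :: "rp2 set set"
  assume "\<forall>S\<in>K. open S"
  moreover have "{x \<in> sphere 0 1. rp2_of x \<in> \<Union>K} = (\<Union>S\<in>K. {x \<in> sphere 0 1. rp2_of x \<in> S})"
    by auto
  ultimately show "open (\<Union>K)"
    unfolding open_rp2_def by (auto simp only: intro!: openin_Union)
qed

end

text \<open>The Euclidean point \<open>(a, b)\<close> is the point of the projective plane with homogeneous
  coordinates \<open>[a : b : 1]\<close>; the line at infinity consists of the points \<open>[a : b : 0]\<close>.\<close>

definition line_at_infinity :: "rp2 set" where
  "line_at_infinity = rp2_of ` {x \<in> sphere 0 1. x $ 3 = 0}"


section \<open>Quasi-topological incidence structures\<close>

definition pseudoline :: "rp2 set \<Rightarrow> bool" where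
  "pseudoline l \<longleftrightarrow> (\<exists>g. simple_path g \<and> pathfinish g = pathstart g \<and> path_image g = l \<and>
     \<not> (\<exists>a. homotopic_loops UNIV g (\<lambda>_. a)))"

text \<open>Topological transversality: in a suitable local chart at \<open>p\<close> the two curves are the
  two coordinate axes.\<close>

definition cross_transversally_at :: "rp2 \<Rightarrow> rp2 set \<Rightarrow> rp2 set \<Rightarrow> bool" where
  "cross_transversally_at p l m \<longleftrightarrow>
     (\<exists>U h k. open U \<and> p \<in> U \<and> homeomorphism U (UNIV :: (real^2) set) h k \<and> h p = 0 \<and>
        h ` (U \<inter> l) = {x. x $ 2 = 0} \<and> h ` (U \<inter> m) = {x. x $ 1 = 0})"

text \<open>The last two conjuncts are the standing assumptions on the position with respect to the
  line at infinity.\<close>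

definition quasiline_arrangement :: "rp2 set set \<Rightarrow> bool" where
  "quasiline_arrangement L \<longleftrightarrow>
     finite L \<and> 2 \<le> card L \<and> (\<forall>l\<in>L. pseudoline l) \<and>
     (\<forall>l\<in>L. \<forall>m\<in>L. l \<noteq> m \<longrightarrow>
        finite (l \<inter> m) \<and> (\<forall>p\<in>l \<inter> m. cross_transversally_at p l m)) \<and>
     (\<forall>l\<in>L. \<forall>m\<in>L. l \<noteq> m \<longrightarrow> l \<inter> m \<inter> line_at_infinity = {}) \<and>
     (\<forall>l\<in>L. \<exists>!p. p \<in> l \<inter> line_at_infinity)"

definition quasi_topological_incidence_structure :: "rp2 set \<Rightarrow> rp2 set set \<Rightarrow> bool" where
  "quasi_topological_incidence_structure P L \<longleftrightarrow>
     quasiline_arrangement L \<and> finite P \<and>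
     (\<forall>p\<in>P. 2 \<le> card {l \<in> L. p \<in> l}) \<and> (\<forall>l\<in>L. 2 \<le> card (P \<inter> l))"


section \<open>Embedding schemes\<close>

text \<open>Loopless multigraphs with a cyclic permutation \<open>rotation v\<close> of the edges at each vertex
  \<open>v\<close> and a signature. Parallel edges are distinct elements of \<open>edges\<close> with the same ends.\<close>

record ('v, 'e) scheme =
  verts :: "'v set"
  edges :: "'e set"
  ends :: "'e \<Rightarrow> 'v set"
  rotation :: "'v \<Rightarrow> 'e \<Rightarrow> 'e"
  signature :: "'e \<Rightarrow> int"

definition edges_at :: "('v, 'e) scheme \<Rightarrow> 'v \<Rightarrow> 'e set" where
  "edges_at M v = {e \<in> edges M. v \<in> ends M e}"

text \<open>As \<open>cyclic_on\<close> forces its set to be nonempty, isolated vertices are excluded.\<close>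

definition embedding_scheme :: "('v, 'e) scheme \<Rightarrow> bool" where
  "embedding_scheme M \<longleftrightarrow>
     finite (verts M) \<and> finite (edges M) \<and>
     (\<forall>e\<in>edges M. ends M e \<subseteq> verts M \<and> card (ends M e) = 2) \<and>
     (\<forall>v\<in>verts M. cyclic_on (rotation M v) (edges_at M v)) \<and>
     (\<forall>e\<in>edges M. signature M e \<in> {1, - 1})"

definition other_end :: "('v, 'e) scheme \<Rightarrow> 'e \<Rightarrow> 'v \<Rightarrow> 'v" where
  "other_end M e v = (THE w. ends M e = {v, w} \<and> w \<noteq> v)"

definition eulerian :: "('v, 'e) scheme \<Rightarrow> bool" where
  "eulerian M \<longleftrightarrow> (\<forall>v\<in>verts M. even (card (edges_at M v)))"


subsection \<open>The surface of an embedding scheme\<close>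

text \<open>The surface is glued from the flag triangles, i.e. the triangles of the barycentric
  subdivision of the facial polygons. The flag \<open>(v, e, s)\<close> is the triangle whose corners are the
  vertex \<open>v\<close>, the midpoint of \<open>e\<close> and the centre of a face along \<open>e\<close>; it lies at the end \<open>v\<close> of
  \<open>e\<close>, after \<open>e\<close> in the rotation at \<open>v\<close> if \<open>s\<close> holds, and before \<open>e\<close> otherwise. A point of a triangle
  is given by its barycentric coordinates with respect to these three corners, in this order.\<close>

type_synonym ('v, 'e) flag = "'v \<times> 'e \<times> bool"
type_synonym ('v, 'e) flag_point = "('v, 'e) flag \<times> real \<times> real \<times> real"

definition flags :: "('v, 'e) scheme \<Rightarrow> ('v, 'e) flag set" where
  "flags M = {(v, e, s). v \<in> verts M \<and> e \<in> edges_at M v}"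

text \<open>Flags sharing the side opposite to the vertex, the edge and the face corner, respectively.
  Seen from the two ends of an edge of signature 1, one and the same side of the edge comes after it
  at one end and before it at the other.\<close>

definition vertex_change :: "('v, 'e) scheme \<Rightarrow> ('v, 'e) flag rel" where
  "vertex_change M = {((v, e, s), (w, e, s')) | v w e s s'.
     (v, e, s) \<in> flags M \<and> w = other_end M e v \<and> s' = (if signature M e = 1 then \<not> s else s)}"

definition edge_change :: "('v, 'e) scheme \<Rightarrow> ('v, 'e) flag rel" where
  "edge_change M = {((v, e, True), (v, rotation M v e, False)) | v e. (v, e, True) \<in> flags M}"

definition face_change :: "('v, 'e) scheme \<Rightarrow> ('v, 'e) flag rel" where
  "face_change M = {((v, e, s), (v, e, \<not> s)) | v e s. (v, e, s) \<in> flags M}"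

definition side_change :: "('v, 'e) scheme \<Rightarrow> real \<times> real \<times> real \<Rightarrow> ('v, 'e) flag rel" where
  "side_change M = (\<lambda>(a, b, c).
     (if a = 0 then vertex_change M else {}) \<union>
     (if b = 0 then edge_change M else {}) \<union>
     (if c = 0 then face_change M else {}))"

definition glue :: "('v, 'e) scheme \<Rightarrow> ('v, 'e) flag_point \<Rightarrow> ('v, 'e) flag_point set" where
  "glue M = (\<lambda>(\<phi>, x). {(\<psi>, x) | \<psi>. (\<phi>, \<psi>) \<in> (side_change M x \<union> (side_change M x)\<inverse>)\<^sup>*})"

definition flag_triangles :: "('v, 'e) scheme \<Rightarrow> ('v, 'e) flag_point topology" where
  "flag_triangles M = prod_topology (discrete_topology (flags M))
     (top_of_set {(a, b, c). 0 \<le> a \<and> 0 \<le> b \<and> 0 \<le> c \<and> a + b + c = 1})"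

definition surface :: "('v, 'e) scheme \<Rightarrow> ('v, 'e) flag_point set topology" where
  "surface M = topology (\<lambda>U. U \<subseteq> glue M ` topspace (flag_triangles M) \<and>
     openin (flag_triangles M) {x \<in> topspace (flag_triangles M). glue M x \<in> U})"

lemma openin_surface:
  "openin (surface M) U \<longleftrightarrow> U \<subseteq> glue M ` topspace (flag_triangles M) \<and>
     openin (flag_triangles M) {x \<in> topspace (flag_triangles M). glue M x \<in> U}"
proof -
  let ?K = "flag_triangles M"
  let ?P = "\<lambda>U. U \<subseteq> glue M ` topspace ?K \<and> openin ?K {x \<in> topspace ?K. glue M x \<in> U}"
  have "istopology ?P"
    unfolding istopology_def
  proof (rule conjI; clarify)
    fix S T
    assume S: "S \<subseteq> glue M ` topspace ?K" "openin ?K {x \<in> topspace ?K. glue M x \<in> S}"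
      and T: "T \<subseteq> glue M ` topspace ?K" "openin ?K {x \<in> topspace ?K. glue M x \<in> T}"
    have "{x \<in> topspace ?K. glue M x \<in> S \<inter> T} =
        {x \<in> topspace ?K. glue M x \<in> S} \<inter> {x \<in> topspace ?K. glue M x \<in> T}"
      by auto
    then show "?P (S \<inter> T)"
      using S T by (auto intro: openin_Int)
  next
    fix \<K>
    assume K: "\<forall>S\<in>\<K>. ?P S"
    have "{x \<in> topspace ?K. glue M x \<in> \<Union>\<K>} = \<Union>((\<lambda>S. {x \<in> topspace ?K. glue M x \<in> S}) ` \<K>)"
      by auto
    moreover have "openin ?K (\<Union>((\<lambda>S. {x \<in> topspace ?K. glue M x \<in> S}) ` \<K>))"
      using K by (intro openin_Union) auto
    ultimately show "?P (\<Union>\<K>)"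
      using K by auto
  qed
  then show ?thesis
    by (simp add: surface_def)
qed

lemma topspace_surface: "topspace (surface M) = glue M ` topspace (flag_triangles M)"
proof -
  have "{x \<in> topspace (flag_triangles M). glue M x \<in> glue M ` topspace (flag_triangles M)}
      = topspace (flag_triangles M)"
    by auto
  then have "openin (surface M) (glue M ` topspace (flag_triangles M))"
    unfolding openin_surface by simp
  moreover have "topspace (surface M) \<subseteq> glue M ` topspace (flag_triangles M)"
    using openin_surface[of M "topspace (surface M)"] by simp
  ultimately show ?thesis
    by (simp add: openin_subset subset_antisym)
qed

lemma quotient_map_glue: "quotient_map (flag_triangles M) (surface M) (glue M)"
  unfolding quotient_map_def topspace_surface openin_surface by auto

text \<open>No connectedness is required: the skeleton of \<open>M(Q)\<close> need not be connected, in which case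
  the surface has one component for each component of the skeleton.\<close>

definition closed_surface :: "'a topology \<Rightarrow> bool" where
  "closed_surface X \<longleftrightarrow> compact_space X \<and> Hausdorff_space X \<and>
     (\<forall>x\<in>topspace X. \<exists>U. openin X U \<and> x \<in> U \<and>
        subtopology X U homeomorphic_space (euclidean :: (real^2) topology))"


subsection \<open>Straight-ahead walks\<close>

text \<open>A walk is given by its darts: \<open>(v, e)\<close> is the edge \<open>e\<close> traversed starting from its end
  \<open>v\<close>.\<close>

definition opposite_edge :: "('v, 'e) scheme \<Rightarrow> 'v \<Rightarrow> 'e \<Rightarrow> 'e" where
  "opposite_edge M v e = (rotation M v ^^ (card (edges_at M v) div 2)) e"

definition straight_ahead_step :: "('v, 'e) scheme \<Rightarrow> 'v \<times> 'e \<Rightarrow> 'v \<times> 'e" where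
  "straight_ahead_step M = (\<lambda>(v, e). let w = other_end M e v in (w, opposite_edge M w e))"

text \<open>Straight-ahead walks are closed (the step after the last dart leads back to the first one);
  distinctness of the darts only says that the closed walk is gone round once.\<close>

definition straight_ahead_walk :: "('v, 'e) scheme \<Rightarrow> ('v \<times> 'e) list \<Rightarrow> bool" where
  "straight_ahead_walk M W \<longleftrightarrow>
     W \<noteq> [] \<and> distinct W \<and> (\<forall>(v, e)\<in>set W. v \<in> verts M \<and> e \<in> edges_at M v) \<and>
     (\<forall>i<length W. W ! (Suc i mod length W) = straight_ahead_step M (W ! i))"

text \<open>A walk as a curve in the surface: an edge from \<open>v\<close> to \<open>w\<close> consists of the sides from
  the vertex corner to the edge corner of its flag triangles at \<open>v\<close> and at \<open>w\<close>.\<close>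

definition dart_curve :: "('v, 'e) scheme \<Rightarrow> 'v \<times> 'e \<Rightarrow> real \<Rightarrow> ('v, 'e) flag_point set" where
  "dart_curve M = (\<lambda>(v, e) t. glue M
     (if t \<le> 1 / 2 then ((v, e, True), 1 - 2 * t, 2 * t, 0)
      else ((other_end M e v, e, True), 2 * t - 1, 2 - 2 * t, 0)))"

definition walk_curve :: "('v, 'e) scheme \<Rightarrow> ('v \<times> 'e) list \<Rightarrow> real \<Rightarrow> ('v, 'e) flag_point set" where
  "walk_curve M W t =
     (let n = length W
      in dart_curve M (W ! (nat \<lfloor>real n * t\<rfloor> mod n)) (frac (real n * t)))"

definition simple_closed_curve :: "'a topology \<Rightarrow> (real \<Rightarrow> 'a) \<Rightarrow> bool" where
  "simple_closed_curve X \<gamma> \<longleftrightarrow> pathin X \<gamma> \<and> \<gamma> 0 = \<gamma> 1 \<and> inj_on \<gamma> {0..<1}"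


section \<open>The map of an incidence structure\<close>

text \<open>The arcs of a line \<open>l\<close> between consecutive points of \<open>P\<close>.\<close>

definition line_arcs :: "rp2 set \<Rightarrow> rp2 set \<Rightarrow> rp2 set set" where
  "line_arcs P l = {path_image g | g. arc g \<and> path_image g \<subseteq> l \<and> pathstart g \<in> P \<and>
     pathfinish g \<in> P \<and> path_image g \<inter> P = {pathstart g, pathfinish g}}"

text \<open>An orientation of the projective plane locally at a point \<open>p\<close> is a choice of one of the two
  unit vectors \<open>n\<close> over \<open>p\<close> (the sphere is the orientation double cover of the projective plane):
  near \<open>p\<close> the plane is identified with the sphere near \<open>n\<close>, oriented counterclockwise about the
  outward normal \<open>n\<close>. Moving a local orientation along an arc amounts to lifting the arc to the
  sphere.\<close>

definition local_orientations :: "rp2 set \<Rightarrow> (rp2 \<Rightarrow> real^3) \<Rightarrow> bool" where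
  "local_orientations P n \<longleftrightarrow> (\<forall>p\<in>P. norm (n p) = 1 \<and> rp2_of (n p) = p)"

definition disc_at :: "real^3 \<Rightarrow> real \<Rightarrow> rp2 set" where
  "disc_at n r = rp2_of ` {y \<in> sphere 0 1. dist n y < r}"

definition closed_disc_at :: "real^3 \<Rightarrow> real \<Rightarrow> rp2 set" where
  "closed_disc_at n r = rp2_of ` {y \<in> sphere 0 1. dist n y \<le> r}"

text \<open>\<open>x\<close> is (the lift of) the point where the arc \<open>e\<close>, starting at the centre of the disc,
  first meets the boundary circle.\<close>

definition first_exit :: "real^3 \<Rightarrow> real \<Rightarrow> rp2 set \<Rightarrow> real^3 \<Rightarrow> bool" where
  "first_exit n r e x \<longleftrightarrow> norm x = 1 \<and> dist n x = r \<and>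
     (\<exists>g t. arc g \<and> path_image g = e \<and> pathstart g = rp2_of n \<and>
        t \<in> {0..1} \<and> g t = rp2_of x \<and> (\<forall>s\<in>{0..<t}. g s \<in> disc_at n r))"

text \<open>For points on a circle around the axis \<open>n\<close>: going counterclockwise from \<open>x\<close>, one meets \<open>y\<close>
  before \<open>z\<close>.\<close>

definition counterclockwise :: "real^3 \<Rightarrow> real^3 \<Rightarrow> real^3 \<Rightarrow> real^3 \<Rightarrow> bool" where
  "counterclockwise n x y z \<longleftrightarrow> 0 < inner n (cross3 (y - x) (z - x))"

text \<open>\<open>\<pi>\<close> is the cyclic order of the arcs in \<open>A\<close> around \<open>rp2_of n\<close>, with respect to the local
  orientation \<open>n\<close>: it takes each arc to the next one in counterclockwise order, read off on the boundary
  circle of a disc in which the arcs meet only at the centre and which they all leave. The result does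
  not depend on the choice of such a disc. (The condition \<open>r < 1\<close> makes \<open>rp2_of\<close> injective on it.)\<close>

definition cyclic_order_at ::
    "rp2 set \<Rightarrow> rp2 set set \<Rightarrow> real^3 \<Rightarrow> (rp2 set \<Rightarrow> rp2 set) \<Rightarrow> bool" where
  "cyclic_order_at P A n \<pi> \<longleftrightarrow>
     (\<exists>r x. 0 < r \<and> r < 1 \<and> closed_disc_at n r \<inter> P = {rp2_of n} \<and>
        (\<forall>e\<in>A. \<forall>f\<in>A. e \<noteq> f \<longrightarrow> e \<inter> f \<inter> closed_disc_at n r = {rp2_of n}) \<and>
        (\<forall>e\<in>A. first_exit n r e (x e)) \<and>
        (\<forall>e\<in>A. \<pi> e \<in> A - {e} \<and> (\<forall>f\<in>A - {e, \<pi> e}. counterclockwise n (x e) (x (\<pi> e)) (x f))))"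

text \<open>The orientations \<open>n u\<close>, \<open>n v\<close> at the ends \<open>u\<close>, \<open>v\<close> of \<open>e\<close> agree along \<open>e\<close>.\<close>

definition orientations_agree :: "(rp2 \<Rightarrow> real^3) \<Rightarrow> rp2 set \<Rightarrow> rp2 \<Rightarrow> rp2 \<Rightarrow> bool" where
  "orientations_agree n e u v \<longleftrightarrow>
     (\<exists>h. path h \<and> path_image h \<subseteq> sphere 0 1 \<and> arc (rp2_of \<circ> h) \<and> path_image (rp2_of \<circ> h) = e \<and>
        pathstart h = n u \<and> pathfinish h = n v)"

text \<open>\<open>M\<close> is the map of the incidence structure with points \<open>P\<close> and lines \<open>L\<close>, for some choice of
  local orientations.\<close>

definition map_of_incidence_structure ::
    "rp2 set \<Rightarrow> rp2 set set \<Rightarrow> (rp2, rp2 set) scheme \<Rightarrow> bool" where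
  "map_of_incidence_structure P L M \<longleftrightarrow>
     verts M = P \<and> edges M = (\<Union>l\<in>L. line_arcs P l) \<and> (\<forall>e\<in>edges M. ends M e = e \<inter> P) \<and>
     (\<exists>n. local_orientations P n \<and>
        (\<forall>v\<in>P. cyclic_order_at P (edges_at M v) (n v) (rotation M v)) \<and>
        (\<forall>e\<in>edges M. \<forall>u v. ends M e = {u, v} \<longrightarrow>
           signature M e = (if orientations_agree n e u v then 1 else - 1)))"

end

theory Submission
  imports Defs "HOL-Complex_Analysis.Contour_Integration"
begin

text \<open>The map is written down from the geometry: its vertices are the points, its edges the arcs of the
  lines between consecutive points, its rotation at a point \<open>v\<close> is the order in which the arcs at \<open>v\<close>
  leave a small round disc, and its signature compares the chosen orientations along the arcs.
  Three things have to be proved about it.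

  \<^emph>\<open>The surface.\<close> Around a corner of the barycentric subdivision the flag triangles form a closed
  fan with an even number of members, because they are permuted by two fixed-point-free
  involutions. Mapping the triangles of the fan linearly onto consecutive cones of the plane shows
  that the open star of the corner is a plane (\<open>star_homeomorphic\<close>). The open stars cover the surface,
  and points that do not lie in a common star are separated by a barycentric coordinate, so the
  surface is a compact Hausdorff 2-manifold (\<open>closed_surface_surface\<close>).

  \<^emph>\<open>Opposite edges.\<close> The heart of the matter is that the two arcs of a line at \<open>v\<close> are opposite in
  the rotation at \<open>v\<close>. If two lines cross transversally at \<open>v\<close>, their four ends on the boundary of a
  small disc alternate (\<open>spokes_alternate\<close>): the first line cuts the disc into two Jordan
  domains, and if both ends of the second line belonged to the same domain, then both sides of the
  first line near \<open>v\<close> would belong to it, whereas \<open>v\<close> is a frontier point of the other domain as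
  well. Hence every line through \<open>v\<close> has as many arcs on one side as on the other, and the arc
  opposite to an arc is the other arc of its line (\<open>vertex_rotation_exists\<close>).

  \<^emph>\<open>The walks.\<close> The points and arcs of a line form a cycle (\<open>line_cycle_start\<close>), so a straight-ahead walk
  follows this cycle and closes up after exactly one turn. It visits every vertex and every edge at
  most once, and therefore it is a simple closed curve in the surface (\<open>simple_closed_walk_curve\<close>).\<close>

section \<open>Fans of triangles and cones in the plane\<close>

text \<open>Applying \<open>a\<close> and \<open>b\<close> alternately, one walks once around the orbit of \<open>\<phi>\<close>, and it closes up after
  an even number of steps. Two equal members at an odd distance cannot occur: applying to both the
  involution that moves them towards each other, one would finally arrive at a fixed point. The
  condition \<open>a x \<noteq> b x\<close> gives \<open>2 \<le> m\<close>.\<close>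

lemma fan_enumeration:
  fixes a b :: "'a \<Rightarrow> 'a"
  assumes "finite F" "\<phi> \<in> F"
    and a: "\<And>x. x \<in> F \<Longrightarrow> a x \<in> F \<and> a (a x) = x \<and> a x \<noteq> x"
    and b: "\<And>x. x \<in> F \<Longrightarrow> b x \<in> F \<and> b (b x) = x \<and> b x \<noteq> x"
    and ab: "\<And>x. x \<in> F \<Longrightarrow> a x \<noteq> b x"
  obtains m :: nat and \<psi> where "2 \<le> m" "\<psi> 0 = \<phi>" "\<And>q. \<psi> q \<in> F" "inj_on \<psi> {..<2 * m}"
    "\<And>q. \<psi> (q + 2 * m) = \<psi> q" "\<And>q. \<psi> (Suc q) = (if even q then a else b) (\<psi> q)"
proof -
  define \<psi> where "\<psi> = rec_nat \<phi> (\<lambda>q x. (if even q then a else b) x)"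
  have 0: "\<psi> 0 = \<phi>" and step: "\<psi> (Suc q) = (if even q then a else b) (\<psi> q)" for q
    by (simp_all add: \<psi>_def)
  have F: "\<psi> q \<in> F" for q
    by (induction q) (auto simp: 0 step assms)
  have backward: "(if even q then a else b) (\<psi> (Suc q)) = \<psi> q" for q
    using a b F[of q] by (simp add: step)
  have shift: "\<psi> p = \<psi> (p + 2 * d) \<longleftrightarrow> \<psi> 0 = \<psi> (2 * d)" for p d
  proof (induction p)
    case (Suc p)
    have "\<psi> (Suc p) = \<psi> (Suc p + 2 * d) \<longleftrightarrow> \<psi> p = \<psi> (p + 2 * d)"
    proof
      assume "\<psi> (Suc p) = \<psi> (Suc p + 2 * d)"
      then show "\<psi> p = \<psi> (p + 2 * d)"
        using backward[of p] backward[of "p + 2 * d"] by simp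
    next
      assume "\<psi> p = \<psi> (p + 2 * d)"
      then show "\<psi> (Suc p) = \<psi> (Suc p + 2 * d)"
        using step[of p] step[of "p + 2 * d"] by simp
    qed
    with Suc show ?case by simp
  qed simp
  have odd: "\<psi> p \<noteq> \<psi> (p + 2 * d + 1)" for p d
  proof (induction d arbitrary: p)
    case 0
    show ?case using a[OF F[of p]] b[OF F[of p]] step[of p] by (auto split: if_splits)
  next
    case (Suc d)
    let ?c = "if even p then a else b"
    have "?c (\<psi> p) = \<psi> (Suc p)" using step[of p] by simp
    moreover have "?c (\<psi> (p + 2 * Suc d + 1)) = \<psi> (p + 2 * Suc d)"
      using backward[of "p + 2 * Suc d"] by simp
    moreover have "\<psi> (Suc p) \<noteq> \<psi> (Suc p + 2 * d + 1)" by (rule Suc.IH)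
    ultimately show ?case by auto
  qed
  have "\<not> inj_on (\<lambda>n. \<psi> (2 * n)) UNIV"
    using F \<open>finite F\<close> by (metis finite_imageD finite_subset image_subsetI infinite_UNIV_nat)
  then obtain p q where pq: "p < q" "\<psi> (2 * p) = \<psi> (2 * q)"
    unfolding inj_on_def by (metis linorder_neqE_nat)
  have ex: "\<exists>m. 0 < m \<and> \<psi> 0 = \<psi> (2 * m)"
    using shift[of "2 * p" "q - p"] pq by (intro exI[of _ "q - p"]) (auto simp: algebra_simps)
  define m where "m = (LEAST m. 0 < m \<and> \<psi> 0 = \<psi> (2 * m))"
  have m: "0 < m" "\<psi> 0 = \<psi> (2 * m)"
    using LeastI_ex[OF ex] by (auto simp: m_def)
  have least: "\<psi> 0 \<noteq> \<psi> (2 * d)" if "0 < d" "d < m" for d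
    using not_less_Least[of d "\<lambda>m. 0 < m \<and> \<psi> 0 = \<psi> (2 * m)"] that by (auto simp: m_def)
  have "\<psi> 2 \<noteq> \<psi> 0"
    using ab[OF \<open>\<phi> \<in> F\<close>] a[OF \<open>\<phi> \<in> F\<close>] b[of "a \<phi>"] step[of 0] step[of 1] 0
    by (auto simp: numeral_2_eq_2)
  then have "m \<noteq> 1" using m by auto
  have inj: "inj_on \<psi> {..<2 * m}"
  proof (rule linorder_inj_onI)
    fix p q assume "p < q" and q: "p \<in> {..<2 * m}" "q \<in> {..<2 * m}"
    show "\<psi> p \<noteq> \<psi> q"
    proof (cases "even (q - p)")
      case True
      then obtain d where "q - p = 2 * d" by blast
      then have "q = p + 2 * d" "0 < d" "d < m" using \<open>p < q\<close> q by auto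
      then show ?thesis using shift least by auto
    next
      case False
      then obtain d where "q - p = 2 * d + 1" by (blast elim: oddE)
      then have "q = p + 2 * d + 1" using \<open>p < q\<close> by auto
      then show ?thesis using odd by auto
    qed
  qed auto
  show thesis
    by (rule that[of m \<psi>]) (use m \<open>m \<noteq> 1\<close> inj F 0 step shift[of _ m] in auto)
qed

lemma sin_pi_multiple_pos:
  assumes "0 < s" "s < m" shows "0 < sin (real s * (pi / real m))"
  using assms by (intro sin_gt_zero) (auto simp: field_simps)

lemma sin_pi_multiple_neg:
  assumes "m < s" "s < 2 * m" shows "sin (real s * (pi / real m)) < 0"
proof -
  have "real s < 2 * real m" using assms by linarith
  then show ?thesis
  using assms by (intro sin_lt_zero) (auto simp: field_simps)
qed

text \<open>The \<open>2 * m\<close> cones spanned by consecutive powers of \<open>\<omega>\<close> overlap only in common rays of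
  neighbours and in the origin; here one of the two cones is rotated to the first one. The
  cases are told apart by the signs of the imaginary parts, if necessary after turning back by one
  step.\<close>

lemma cone_overlap:
  fixes u w u' w' :: real
  assumes "2 \<le> m" "s < 2 * m" and nn: "0 \<le> u" "0 \<le> w" "0 \<le> u'" "0 \<le> w'"
    and \<omega>: "\<omega> = cis (pi / real m)"
    and eq: "of_real u + of_real w * \<omega> = of_real u' * \<omega> ^ s + of_real w' * \<omega> ^ Suc s"
  shows "s = 0 \<and> u = u' \<and> w = w' \<or> s = 1 \<and> u = 0 \<and> w = u' \<and> w' = 0 \<or>
    s = 2 * m - 1 \<and> w = 0 \<and> u' = 0 \<and> u = w' \<or> u = 0 \<and> w = 0 \<and> u' = 0 \<and> w' = 0"
proof -
  define \<theta> where "\<theta> = pi / real m"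
  define S where "S k = sin (real k * \<theta>)" for k
  have m0: "real m > 0" using assms by simp
  have pos: "0 < S k" if "0 < k" "k < m" for k
    unfolding S_def \<theta>_def using that by (rule sin_pi_multiple_pos)
  have neg: "S k < 0" if "m < k" "k < 2 * m" for k
    unfolding S_def \<theta>_def using that by (rule sin_pi_multiple_neg)
  have Sm: "S m = 0" "S (2 * m) = 0" "S 0 = 0" using m0 by (auto simp: S_def \<theta>_def)
  have S1: "0 < S 1" using pos[of 1] assms by simp
  have e1: "w * S 1 = u' * S s + w' * S (Suc s)"
    using arg_cong[OF eq, of Im] unfolding \<omega> Complex.DeMoivre S_def \<theta>_def by simp
  have eq2: "u + w * cos \<theta> = u' * cos (s * \<theta>) + w' * cos (Suc s * \<theta>)"
    using arg_cong[OF eq, of Re] unfolding \<omega> Complex.DeMoivre S_def \<theta>_def by simp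
  have cos_m: "cos (real m * \<theta>) = -1" "cos (real (2 * m) * \<theta>) = 1" using m0 by (auto simp: \<theta>_def)
  consider "s = 0" | "1 \<le> s" "s < m" | "s = m" | "m < s" "s < 2 * m - 1" | "s = 2 * m - 1"
    using assms by linarith
  then show ?thesis
  proof cases
    case 1
    then have "w = w'" using e1 S1 Sm by auto
    with 1 eq2 show ?thesis by auto
  next
    case 2
    \<comment> \<open>Turned back by one step, the first cone is in the lower and the other one in the upper half plane.\<close>
    obtain t where t: "s = Suc t" using 2 by (cases s) auto
    have "(of_real u + of_real w * \<omega>) * cis (- \<theta>) = (of_real u' * \<omega> ^ s + of_real w' * \<omega> ^ Suc s) * cis (- \<theta>)"
      using eq by simp
    moreover have "\<omega> * cis (- \<theta>) = 1" by (simp add: \<omega> \<theta>_def cis_mult)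
    then have "\<omega> ^ Suc k * cis (- \<theta>) = \<omega> ^ k" for k
      by (metis (no_types) mult.assoc mult.right_neutral power_Suc2)
    then have "(of_real u' * \<omega> ^ Suc t + of_real w' * \<omega> ^ Suc s) * cis (- \<theta>) = of_real u' * \<omega> ^ t + of_real w' * \<omega> ^ s"
      by (simp only: distrib_right mult.assoc)
    moreover have "(of_real u + of_real w * \<omega>) * cis (- \<theta>) = of_real u * cis (- \<theta>) + of_real w"
      using \<open>\<omega> * cis (- \<theta>) = 1\<close> by (simp only: distrib_right mult.assoc mult_1_right)
    ultimately have eq3: "of_real u * cis (- \<theta>) + of_real w = of_real u' * \<omega> ^ t + of_real w' * \<omega> ^ Suc t" by (simp add: t)
    have e3: "- u * S 1 = u' * S t + w' * S s"
      using arg_cong[OF eq3, of Im] unfolding \<omega> Complex.DeMoivre S_def \<theta>_def by (simp add: t)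
    have St: "0 \<le> S t" using pos[of t] Sm t 2 by (cases "t = 0") auto
    have Ss: "0 < S s" using pos[of s] 2 by auto
    have "u * S 1 + u' * S t + w' * S s = 0" using e3 by simp
    moreover have "0 \<le> u * S 1" "0 \<le> u' * S t" "0 \<le> w' * S s" using nn S1 St Ss by simp_all
    ultimately have z: "u * S 1 = 0" "u' * S t = 0" "w' * S s = 0" by linarith+
    then have u: "u = 0" "w' = 0" using S1 Ss by auto
    show ?thesis
    proof (cases "t = 0")
      case True
      then have "w = u'" using e1 S1 u t by auto
      then show ?thesis using u True t by simp
    next
      case False
      then have "u' = 0" using z pos[of t] t 2 by auto
      then have "w = 0" using e1 u S1 by auto
      then show ?thesis using u \<open>u' = 0\<close> by simp
    qed
  next
    case 3
    have "S (Suc s) < 0" using neg[of "Suc s"] 3 assms by auto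
    then have "w' * S (Suc s) \<le> 0" using nn by (simp add: mult_nonneg_nonpos)
    moreover have "0 \<le> w * S 1" using nn S1 by simp
    ultimately have "w * S 1 = 0" "w' * S (Suc s) = 0" using e1 3 Sm by auto
    then have "w = 0" "w' = 0" using S1 \<open>S (Suc s) < 0\<close> by auto
    then have "u = - u'" using eq2 cos_m 3 by simp
    then show ?thesis using nn \<open>w = 0\<close> \<open>w' = 0\<close> by auto
  next
    case 4
    have n: "S (Suc s) < 0" "S s < 0" using neg[of "Suc s"] neg[of s] 4 assms by auto
    then have "w' * S (Suc s) \<le> 0" "u' * S s \<le> 0" using nn by (simp_all add: mult_nonneg_nonpos)
    moreover have "0 \<le> w * S 1" using nn S1 by simp
    ultimately have "w * S 1 = 0" "w' * S (Suc s) = 0" "u' * S s = 0" using e1 by linarith+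
    then have "w = 0" "w' = 0" "u' = 0" using S1 n by auto
    then show ?thesis using eq2 by auto
  next
    case 5
    then have Ss: "Suc s = 2 * m" using assms by simp
    have n: "S s < 0" using neg[of s] 5 assms by auto
    then have "u' * S s \<le> 0" using nn by (simp_all add: mult_nonneg_nonpos)
    moreover have "w * S 1 = u' * S s" using e1 Sm unfolding Ss by simp
    moreover have "0 \<le> w * S 1" using nn S1 by simp
    ultimately have "w * S 1 = 0" "u' * S s = 0" using \<open>w * S 1 = u' * S s\<close> by linarith+
    then have "w = 0" "u' = 0" using S1 n by auto
    then show ?thesis using eq2 5 cos_m unfolding Ss by auto
  qed
qed

lemma polar_form:
  obtains t where "0 \<le> t" "t < 2 * pi" "z = of_real (cmod z) * cis t"
proof (cases "0 \<le> Arg z")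
  case True
  show thesis
  proof (rule that[of "Arg z"])
    show "Arg z < 2 * pi" using Arg_bounded[of z] pi_gt_zero by linarith
  qed (use True rcis_cmod_Arg[of z] in \<open>simp_all add: rcis_def\<close>)
next
  case False
  show thesis
  proof (rule that[of "Arg z + 2 * pi"])
    show "0 \<le> Arg z + 2 * pi" "Arg z + 2 * pi < 2 * pi"
      using False Arg_bounded[of z] pi_gt_zero by linarith+
  qed (use rcis_cmod_Arg[of z] in \<open>simp_all add: rcis_def flip: cis_mult\<close>)
qed

text \<open>The vector \<open>cis s\<close> has the coordinates \<open>sin (\<theta> - s) / sin \<theta>\<close> and \<open>sin s / sin \<theta>\<close> with respect
  to the basis consisting of \<open>1\<close> and \<open>cis \<theta>\<close>, where \<open>\<theta> = pi / m\<close>.\<close>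

lemma cone_cover:
  assumes "2 \<le> m" and \<omega>: "\<omega> = cis (pi / real m)"
  obtains q u w where "q < 2 * m" "0 \<le> u" "0 \<le> w" "z = (of_real u + of_real w * \<omega>) * \<omega> ^ q"
proof -
  define \<theta> where "\<theta> = pi / real m"
  have \<theta>: "0 < \<theta>" "2 * real m * \<theta> = 2 * pi" "\<theta> < pi" using assms by (auto simp: \<theta>_def field_simps)
  obtain r t where z: "z = of_real r * cis t" "0 \<le> r" "0 \<le> t" "t < 2 * pi"
    using polar_form[of z] norm_ge_zero by metis
  define q where "q = nat \<lfloor>t / \<theta>\<rfloor>"
  define s where "s = t - real q * \<theta>"
  have "real q \<le> t / \<theta>" "t / \<theta> < real q + 1" using z \<theta> unfolding q_def by (auto simp: floor_less_iff)
  then have s: "0 \<le> s" "s < \<theta>" using \<theta> by (auto simp: s_def field_simps)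
  have "real q * \<theta> < 2 * real m * \<theta>" using s z \<theta> unfolding s_def by linarith
  then have "real q < 2 * real m" using \<theta>(1) by (rule mult_right_less_imp_less[OF _ less_imp_le])
  then have q: "q < 2 * m" by linarith
  have st: "sin \<theta> > 0" using \<theta> by (intro sin_gt_zero) auto
  have "cis s = of_real (sin (\<theta> - s) / sin \<theta>) + of_real (sin s / sin \<theta>) * \<omega>"
    using st by (auto simp: complex_eq_iff \<omega> \<theta>_def[symmetric] sin_diff field_simps)
  moreover have "cis t = cis s * \<omega> ^ q"
    by (simp add: s_def \<omega> \<theta>_def Complex.DeMoivre cis_mult)
  ultimately have "z = (of_real (r * (sin (\<theta> - s) / sin \<theta>)) + of_real (r * (sin s / sin \<theta>)) * \<omega>) * \<omega> ^ q"
    using z by (simp add: algebra_simps)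
  moreover have "0 \<le> sin s" "0 \<le> sin (\<theta> - s)" using s \<theta> by (auto intro!: sin_ge_zero)
  ultimately show thesis
    using q z(2) st by (intro that[of q "r * (sin (\<theta> - s) / sin \<theta>)" "r * (sin s / sin \<theta>)"]) auto
qed

section \<open>Flag triangles and their gluing\<close>

definition coord :: "nat \<Rightarrow> real \<times> real \<times> real \<Rightarrow> real" where
  "coord i x = (if i = 0 then fst x else if i = 1 then fst (snd x) else snd (snd x))"

definition std_triangle :: "(real \<times> real \<times> real) set" where
  "std_triangle = {(a, b, c). 0 \<le> a \<and> 0 \<le> b \<and> 0 \<le> c \<and> a + b + c = 1}"

lemma in_std_triangle:
  assumes "x \<in> std_triangle" shows "0 \<le> coord i x" "coord 0 x + coord 1 x + coord 2 x = 1"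
  using assms by (auto simp: coord_def std_triangle_def)

lemma continuous_on_coord: "continuous_on A (coord i)"
proof -
  have "coord i = (if i = 0 then fst else if i = 1 then (\<lambda>x. fst (snd x)) else (\<lambda>x. snd (snd x)))"
    by (auto simp: coord_def fun_eq_iff)
  then show ?thesis by (auto intro!: continuous_intros simp: id_def)
qed

lemma coord_eqI: "\<lbrakk>coord 0 x = coord 0 y; coord 1 x = coord 1 y; coord 2 x = coord 2 y\<rbrakk> \<Longrightarrow> x = y"
  by (simp add: coord_def prod_eq_iff)

lemma less_3_cases: "(i::nat) < 3 \<longleftrightarrow> i = 0 \<or> i = 1 \<or> i = 2"
  by auto

text \<open>The gluings as involutions of the set of flags, numbered by the barycentric coordinate that
  vanishes on the common side. Number 1 combines the edge change with its converse, which needs the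
  inverse of the rotation.\<close>

definition flag_change :: "('v, 'e) scheme \<Rightarrow> nat \<Rightarrow> ('v, 'e) flag \<Rightarrow> ('v, 'e) flag" where
  "flag_change M i = (\<lambda>(v, e, s).
     if i = 0 then (other_end M e v, e, if signature M e = 1 then \<not> s else s)
     else if i = 1 then
       (if s then (v, rotation M v e, False) else (v, inv_into (edges_at M v) (rotation M v) e, True))
     else (v, e, \<not> s))"

definition side_rel :: "('v, 'e) scheme \<Rightarrow> real \<times> real \<times> real \<Rightarrow> ('v, 'e) flag rel" where
  "side_rel M x = side_change M x \<union> (side_change M x)\<inverse>"

lemma glue_side_rel: "glue M (\<phi>, x) = {(\<psi>, x) | \<psi>. (\<phi>, \<psi>) \<in> (side_rel M x)\<^sup>*}"
  by (simp add: glue_def side_rel_def)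

lemma glue_eq_iff: "glue M (\<phi>, x) = glue M (\<psi>, y) \<longleftrightarrow> x = y \<and> (\<phi>, \<psi>) \<in> (side_rel M x)\<^sup>*"
proof -
  have s: "sym ((side_rel M x)\<^sup>*)"
    by (intro sym_rtrancl) (auto simp: side_rel_def sym_def)
  show ?thesis
  proof
    assume "glue M (\<phi>, x) = glue M (\<psi>, y)"
    moreover have "(\<psi>, y) \<in> glue M (\<psi>, y)" unfolding glue_side_rel by blast
    ultimately have "(\<psi>, y) \<in> glue M (\<phi>, x)" by simp
    then show "x = y \<and> (\<phi>, \<psi>) \<in> (side_rel M x)\<^sup>*" unfolding glue_side_rel by blast
  next
    assume "x = y \<and> (\<phi>, \<psi>) \<in> (side_rel M x)\<^sup>*"
    then show "glue M (\<phi>, x) = glue M (\<psi>, y)"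
      using s unfolding glue_side_rel by (blast dest: symD intro: rtrancl_trans)
  qed
qed

lemma flag_triangles_std:
  "flag_triangles M = prod_topology (discrete_topology (flags M)) (top_of_set std_triangle)"
  by (simp add: flag_triangles_def std_triangle_def)

lemma topspace_flag_triangles: "topspace (flag_triangles M) = flags M \<times> std_triangle"
  by (simp add: flag_triangles_std)

lemma openin_flag_triangles:
  "openin (flag_triangles M) U \<longleftrightarrow>
     U \<subseteq> flags M \<times> std_triangle \<and> (\<forall>\<phi>\<in>flags M. openin (top_of_set std_triangle) {x. (\<phi>, x) \<in> U})"
    (is "?L \<longleftrightarrow> ?R")
proof
  assume L: ?L
  have "openin (top_of_set std_triangle) {x. (\<phi>, x) \<in> U}" if "\<phi> \<in> flags M" for \<phi>
  proof -
    have "continuous_map (top_of_set std_triangle) (flag_triangles M) (\<lambda>x. (\<phi>, x))"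
      unfolding flag_triangles_std using that by (auto simp: continuous_map_pairwise comp_def)
    from openin_continuous_map_preimage[OF this L]
    have "openin (top_of_set std_triangle) {x \<in> std_triangle. (\<phi>, x) \<in> U}" by simp
    moreover have "{x \<in> std_triangle. (\<phi>, x) \<in> U} = {x. (\<phi>, x) \<in> U}"
      using openin_subset[OF L] by (auto simp: topspace_flag_triangles)
    ultimately show ?thesis by simp
  qed
  then show ?R using openin_subset[OF L] by (auto simp: topspace_flag_triangles)
next
  assume R: ?R
  show ?L
    unfolding flag_triangles_std openin_prod_topology_alt
  proof (intro allI impI)
    fix \<phi> x assume "(\<phi>, x) \<in> U"
    then show "\<exists>V W. openin (discrete_topology (flags M)) V \<and> openin (top_of_set std_triangle) W \<and>
        \<phi> \<in> V \<and> x \<in> W \<and> V \<times> W \<subseteq> U"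
      using R by (intro exI[of _ "{\<phi>}"] exI[of _ "{x. (\<phi>, x) \<in> U}"]) auto
  qed
qed

lemma continuous_map_flag_triangles:
  "continuous_map (flag_triangles M) Y f \<longleftrightarrow>
     (\<forall>\<phi>\<in>flags M. continuous_map (top_of_set std_triangle) Y (\<lambda>x. f (\<phi>, x)))"
proof -
  have "{x. (\<phi>, x) \<in> {p \<in> flags M \<times> std_triangle. f p \<in> U}} = {x \<in> std_triangle. f (\<phi>, x) \<in> U}"
    if "\<phi> \<in> flags M" for \<phi> U using that by auto
  then show ?thesis
    unfolding continuous_map_def openin_flag_triangles topspace_flag_triangles
    by (auto simp: Pi_iff)
qed

text \<open>The degree condition makes the three involutions differ at every flag; then every fan consists of
  at least four triangles and its cones are convex.\<close>

locale thick_scheme =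
  fixes M :: "('v, 'e) scheme"
  assumes scheme: "embedding_scheme M"
    and degree: "\<And>v. v \<in> verts M \<Longrightarrow> 2 \<le> card (edges_at M v)"
begin

lemma finite_flags: "finite (flags M)"
proof -
  have "flags M \<subseteq> verts M \<times> edges M \<times> UNIV" by (auto simp: flags_def edges_at_def)
  then show ?thesis using scheme by (auto simp: embedding_scheme_def intro: finite_subset)
qed

lemma other_end:
  assumes "v \<in> verts M" "e \<in> edges_at M v"
  shows "ends M e = {v, other_end M e v}" "other_end M e v \<noteq> v" "other_end M e v \<in> verts M"
    "e \<in> edges_at M (other_end M e v)" "other_end M e (other_end M e v) = v"
proof -
  have e: "e \<in> edges M" "v \<in> ends M e" using assms by (auto simp: edges_at_def)
  then have "ends M e \<subseteq> verts M" "card (ends M e) = 2" using scheme by (auto simp: embedding_scheme_def)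
  then obtain a b where "ends M e = {a, b}" "a \<noteq> b" by (auto simp: card_2_iff)
  then obtain w where w: "ends M e = {v, w}" "w \<noteq> v" using e by (cases "v = a") auto
  have o: "other_end M e v = w" unfolding other_end_def using w by (auto simp: doubleton_eq_iff)
  have "other_end M e w = v" unfolding other_end_def using w by (auto simp: doubleton_eq_iff)
  then show "ends M e = {v, other_end M e v}" "other_end M e v \<noteq> v" "other_end M e v \<in> verts M"
    "e \<in> edges_at M (other_end M e v)" "other_end M e (other_end M e v) = v"
    using o w \<open>ends M e \<subseteq> verts M\<close> e by (auto simp: edges_at_def)
qed

lemma rotation_cyclic: "v \<in> verts M \<Longrightarrow> cyclic_on (rotation M v) (edges_at M v)"
  using scheme by (simp add: embedding_scheme_def)

lemma rotation_image: "v \<in> verts M \<Longrightarrow> rotation M v ` edges_at M v = edges_at M v"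
proof (intro equalityI subsetI)
  fix e assume v: "v \<in> verts M" and e: "e \<in> edges_at M v"
  have "e \<in> orbit (rotation M v) e" using rotation_cyclic[OF v] e unfolding cyclic_on_alldef by blast
  then show "e \<in> rotation M v ` edges_at M v"
  proof cases
    case (step f)
    then have "f \<in> edges_at M v" using rotation_cyclic[OF v] e unfolding cyclic_on_alldef by blast
    then show ?thesis using step by blast
  qed (use e in auto)
next
  fix e assume v: "v \<in> verts M" and e: "e \<in> rotation M v ` edges_at M v"
  then show "e \<in> edges_at M v" using cyclic_on_inI[OF rotation_cyclic[OF v]] by auto
qed

lemma rotation_inj: "v \<in> verts M \<Longrightarrow> inj_on (rotation M v) (edges_at M v)"
  using rotation_image rotation_cyclic finite_cyclic_on eq_card_imp_inj_on by metis

lemma rotation_neq: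
  assumes "v \<in> verts M" "e \<in> edges_at M v" shows "rotation M v e \<noteq> e"
proof
  assume f: "rotation M v e = e"
  have "x = e" if "x \<in> orbit (rotation M v) e" for x
    using that by induction (auto simp: f)
  then have "edges_at M v \<subseteq> {e}"
    using rotation_cyclic[OF assms(1)] assms(2) unfolding cyclic_on_alldef by blast
  then have "card (edges_at M v) \<le> card {e}" by (intro card_mono) auto
  then show False using degree[OF assms(1)] by simp
qed

lemma flag_change:
  assumes "\<phi> \<in> flags M"
  shows "flag_change M i \<phi> \<in> flags M" "flag_change M i (flag_change M i \<phi>) = \<phi>" "flag_change M i \<phi> \<noteq> \<phi>"
proof -
  obtain v e s where \<phi>: "\<phi> = (v, e, s)" "v \<in> verts M" "e \<in> edges_at M v"
    using assms by (auto simp: flags_def)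
  note o = other_end[OF \<phi>(2,3)]
  let ?r = "rotation M v" and ?r' = "inv_into (edges_at M v) (rotation M v)"
  have r: "?r e \<in> edges_at M v" "?r' e \<in> edges_at M v" "?r (?r' e) = e" "?r' (?r e) = e"
    using rotation_image[OF \<phi>(2)] \<phi>(3) rotation_inj[OF \<phi>(2)] f_inv_into_f[of e ?r] inv_into_into[of e ?r]
    by auto
  show "flag_change M i \<phi> \<in> flags M" "flag_change M i (flag_change M i \<phi>) = \<phi>" "flag_change M i \<phi> \<noteq> \<phi>"
    using \<phi> o r by (auto simp: flag_change_def flags_def)
qed

lemma flag_change_neq:
  assumes "\<phi> \<in> flags M" "i < 3" "j < 3" "i \<noteq> j"
  shows "flag_change M i \<phi> \<noteq> flag_change M j \<phi>"
proof -
  obtain v e s where \<phi>: "\<phi> = (v, e, s)" "v \<in> verts M" "e \<in> edges_at M v"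
    using assms by (auto simp: flags_def)
  note o = other_end(2)[OF \<phi>(2,3)]
  have r: "rotation M v e \<noteq> e" "inv_into (edges_at M v) (rotation M v) e \<noteq> e"
    using rotation_image[OF \<phi>(2)] \<phi>(3) rotation_neq[OF \<phi>(2)] f_inv_into_f[of e "rotation M v"]
    by metis+
  show ?thesis
    using assms(2-) o o[symmetric] r r[symmetric] unfolding less_3_cases \<phi> flag_change_def by auto
qed

lemma side_rel_iff:
  assumes "\<phi> \<in> flags M"
  shows "(\<phi>, \<psi>) \<in> side_rel M x \<longleftrightarrow> (\<exists>i<3. coord i x = 0 \<and> \<psi> = flag_change M i \<phi>)"
proof -
  have sub: "\<psi> \<in> flags M \<and> (\<exists>i<3. coord i x = 0 \<and> \<psi> = flag_change M i \<phi>)"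
    if "(\<phi>, \<psi>) \<in> side_change M x" for \<phi> \<psi>
  proof -
    have \<phi>: "\<phi> \<in> flags M"
      using that by (auto simp: side_change_def vertex_change_def edge_change_def face_change_def split: if_splits)
    have "(\<phi>, \<psi>) \<in> vertex_change M \<and> coord 0 x = 0 \<or> (\<phi>, \<psi>) \<in> edge_change M \<and> coord 1 x = 0 \<or>
        (\<phi>, \<psi>) \<in> face_change M \<and> coord 2 x = 0"
      using that by (auto simp: side_change_def coord_def split: if_splits)
    moreover have "\<psi> = flag_change M 0 \<phi>" if "(\<phi>, \<psi>) \<in> vertex_change M"
      using that by (auto simp: vertex_change_def flag_change_def)
    moreover have "\<psi> = flag_change M 1 \<phi>" if "(\<phi>, \<psi>) \<in> edge_change M"
      using that by (auto simp: edge_change_def flag_change_def)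
    moreover have "\<psi> = flag_change M 2 \<phi>" if "(\<phi>, \<psi>) \<in> face_change M"
      using that by (auto simp: face_change_def flag_change_def)
    ultimately have "\<exists>i<3. coord i x = 0 \<and> \<psi> = flag_change M i \<phi>"
      unfolding less_3_cases by blast
    then show ?thesis using flag_change \<phi> by blast
  qed
  have ch: "(\<phi>, flag_change M i \<phi>) \<in> side_change M x \<or> (flag_change M i \<phi>, \<phi>) \<in> side_change M x"
    if i: "i < 3" "coord i x = 0" for i
  proof -
    obtain a b c where x: "x = (a, b, c)" by (cases x)
    obtain v e s where \<phi>: "\<phi> = (v, e, s)" by (cases \<phi>)
    show ?thesis
    proof (cases "i = 1 \<and> \<not> s")
      case True
      have *: "flag_change M i \<phi> \<in> flags M" "flag_change M i (flag_change M i \<phi>) = \<phi>" using flag_change[OF assms] by auto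
      obtain f where f: "flag_change M i \<phi> = (v, f, True)" using True by (auto simp: flag_change_def \<phi>)
      show ?thesis using * f True i unfolding x \<phi>
        by (auto simp: side_change_def edge_change_def coord_def flag_change_def)
    next
      case False
      then consider "i = 0" | "i = 1" "s" | "i = 2" using i(1) unfolding less_3_cases by blast
      then show ?thesis
      proof cases
        case 1
        have "(\<phi>, flag_change M i \<phi>) \<in> vertex_change M"
          using assms unfolding 1 \<phi> vertex_change_def flag_change_def by simp
        then show ?thesis using i by (simp add: 1 x side_change_def coord_def)
      next
        case 2
        have "(\<phi>, flag_change M i \<phi>) \<in> edge_change M"
          using assms 2 unfolding \<phi> edge_change_def flag_change_def by simp
        then show ?thesis using i by (simp add: 2 x side_change_def coord_def)
      next
        case 3
        have "(\<phi>, flag_change M i \<phi>) \<in> face_change M"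
          using assms unfolding 3 \<phi> face_change_def flag_change_def by simp
        then show ?thesis using i by (simp add: 3 x side_change_def coord_def)
      qed
    qed
  qed
  show ?thesis
  proof
    assume "(\<phi>, \<psi>) \<in> side_rel M x"
    then consider "(\<phi>, \<psi>) \<in> side_change M x" | "(\<psi>, \<phi>) \<in> side_change M x" by (auto simp: side_rel_def)
    then show "\<exists>i<3. coord i x = 0 \<and> \<psi> = flag_change M i \<phi>"
    proof cases
      case 2
      from sub[OF 2] obtain i where "i < 3" "coord i x = 0" "\<phi> = flag_change M i \<psi>" by blast
      moreover have "\<psi> \<in> flags M"
        using 2 by (auto simp: side_change_def vertex_change_def edge_change_def face_change_def split: if_splits)
      ultimately show ?thesis using flag_change(2) by metis
    qed (use sub in blast)
  qed (use ch in \<open>auto simp: side_rel_def\<close>)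
qed

text \<open>The tool for showing that points are not glued: what is preserved by the changes available at
  \<open>x\<close> is an invariant of the class of \<open>x\<close>.\<close>

lemma side_rel_invariant:
  assumes "(\<phi>, \<psi>) \<in> (side_rel M x)\<^sup>*" "\<phi> \<in> flags M"
    and inv: "\<And>\<alpha> i. \<lbrakk>\<alpha> \<in> flags M; i < 3; coord i x = 0\<rbrakk> \<Longrightarrow> f (flag_change M i \<alpha>) = f \<alpha>"
  shows "\<psi> \<in> flags M \<and> f \<psi> = f \<phi>"
  using assms(1)
proof induction
  case (step \<alpha> \<beta>)
  then obtain i where "i < 3" "coord i x = 0" "\<beta> = flag_change M i \<alpha>" using side_rel_iff by blast
  then show ?case using step inv flag_change by auto
qed (use assms in simp)

end

section \<open>The open stars of the corners\<close>

text \<open>The point of the triangle whose coordinates \<open>l\<close> and \<open>3 - i - l\<close> are \<open>u\<close> and \<open>w\<close> times its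
  coordinate \<open>i\<close>. For fixed \<open>i\<close> and \<open>l\<close> this is a homeomorphism from a closed quadrant onto the
  triangle without the side opposite to the corner \<open>i\<close>.\<close>

definition fan_point :: "nat \<Rightarrow> nat \<Rightarrow> real \<Rightarrow> real \<Rightarrow> real \<times> real \<times> real" where
  "fan_point i l u w =
     (let f = (\<lambda>n. (if n = i then 1 else if n = l then u else w) / (1 + u + w)) in (f 0, f 1, f 2))"

lemma coord_fan_point:
  "n < 3 \<Longrightarrow> coord n (fan_point i l u w) = (if n = i then 1 else if n = l then u else w) / (1 + u + w)"
  unfolding less_3_cases by (auto simp: coord_def fan_point_def Let_def)

lemma continuous_on_fan_point:
  assumes "continuous_on A u" "continuous_on A w" "\<And>z. z \<in> A \<Longrightarrow> 0 \<le> u z \<and> 0 \<le> w z"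
  shows "continuous_on A (\<lambda>z. fan_point i l (u z) (w z))"
proof -
  have "continuous_on A (\<lambda>z. (if n = i then 1 else if n = l then u z else w z) / (1 + u z + w z))" for n
  proof -
    have "continuous_on A (\<lambda>z. if n = i then 1 else if n = l then u z else w z)"
      using assms by (cases "n = i"; cases "n = l") auto
    moreover have "1 + u z + w z \<noteq> 0" if "z \<in> A" for z
      using assms(3)[OF that] by linarith
    ultimately show ?thesis
      by (intro continuous_on_divide) (use assms in \<open>auto intro!: continuous_intros\<close>)
  qed
  then show ?thesis unfolding fan_point_def Let_def by (intro continuous_on_Pair)
qed

lemma fan_point_in_triangle:
  assumes "i < 3" "l < 3" "i \<noteq> l" "0 \<le> u" "0 \<le> w"
  shows "fan_point i l u w \<in> std_triangle"
proof -
  define t where "t = 1 + u + w"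
  have t: "0 < t" using assms by (simp add: t_def)
  then have "1 / t + u / t + w / t = 1" by (simp add: t_def flip: add_divide_distrib)
  then show ?thesis
    using assms t unfolding less_3_cases fan_point_def Let_def std_triangle_def t_def[symmetric]
    by (elim disjE) simp_all
qed

context thick_scheme
begin

text \<open>The triangles around the corner \<open>i\<close> of the flag \<open>\<phi>\<close>, and the open star of this corner.\<close>

definition star_flags :: "nat \<Rightarrow> ('v, 'e) flag \<Rightarrow> ('v, 'e) flag set" where
  "star_flags i \<phi> = {\<psi>. (\<phi>, \<psi>) \<in> {(\<alpha>, flag_change M l \<alpha>) | \<alpha> l. \<alpha> \<in> flags M \<and> l < 3 \<and> l \<noteq> i}\<^sup>*}"

definition star :: "nat \<Rightarrow> ('v, 'e) flag \<Rightarrow> ('v, 'e) flag_point set set" where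
  "star i \<phi> = glue M ` (star_flags i \<phi> \<times> {x \<in> std_triangle. 0 < coord i x})"

lemma star_flags_subset: "\<phi> \<in> flags M \<Longrightarrow> star_flags i \<phi> \<subseteq> flags M"
proof
  fix \<psi> assume "\<psi> \<in> star_flags i \<phi>" and \<phi>: "\<phi> \<in> flags M"
  then have "(\<phi>, \<psi>) \<in> {(\<alpha>, flag_change M l \<alpha>) | \<alpha> l. \<alpha> \<in> flags M \<and> l < 3 \<and> l \<noteq> i}\<^sup>*"
    by (simp add: star_flags_def)
  then show "\<psi> \<in> flags M" by induction (use \<phi> flag_change in auto)
qed

lemma star_flags_self: "\<phi> \<in> star_flags i \<phi>"
  by (simp add: star_flags_def)

lemma star_flags_change:
  assumes "\<phi> \<in> flags M" "\<psi> \<in> star_flags i \<phi>" "l < 3" "l \<noteq> i"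
  shows "flag_change M l \<psi> \<in> star_flags i \<phi>"
proof -
  have "\<psi> \<in> flags M" using assms star_flags_subset by blast
  then have "(\<psi>, flag_change M l \<psi>) \<in> {(\<alpha>, flag_change M l \<alpha>) | \<alpha> l. \<alpha> \<in> flags M \<and> l < 3 \<and> l \<noteq> i}"
    using assms by blast
  then show ?thesis using assms(2) unfolding star_flags_def by (blast intro: rtrancl_into_rtrancl)
qed

lemma star_flags_change_iff:
  assumes "\<phi> \<in> flags M" "\<psi> \<in> flags M" "l < 3" "l \<noteq> i"
  shows "flag_change M l \<psi> \<in> star_flags i \<phi> \<longleftrightarrow> \<psi> \<in> star_flags i \<phi>"
  using star_flags_change[OF assms(1) _ assms(3,4)] flag_change(2)[OF assms(2)] by metis

lemma glue_star_flags:
  assumes "\<phi> \<in> flags M" "glue M (\<psi>, x) = glue M (\<psi>', y)" "\<psi> \<in> flags M" "0 < coord i x"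
  shows "\<psi> \<in> star_flags i \<phi> \<longleftrightarrow> \<psi>' \<in> star_flags i \<phi>"
proof -
  have "(\<psi>, \<psi>') \<in> (side_rel M x)\<^sup>*" using assms(2) glue_eq_iff by metis
  then have "\<psi>' \<in> flags M \<and> (\<psi>' \<in> star_flags i \<phi>) = (\<psi> \<in> star_flags i \<phi>)"
  proof (rule side_rel_invariant[OF _ assms(3)])
    fix \<alpha> l assume "\<alpha> \<in> flags M" "l < 3" "coord l x = 0"
    moreover from this assms(4) have "l \<noteq> i" by auto
    ultimately show "(flag_change M l \<alpha> \<in> star_flags i \<phi>) = (\<alpha> \<in> star_flags i \<phi>)"
      using star_flags_change_iff[OF assms(1)] by blast
  qed
  then show ?thesis by simp
qed

text \<open>The star is saturated: where the coordinate \<open>i\<close> is positive, gluing does not leave the triangles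
  around the corner.\<close>

lemma star_preimage:
  assumes "\<phi> \<in> flags M"
  shows "{p \<in> topspace (flag_triangles M). glue M p \<in> star i \<phi>} = star_flags i \<phi> \<times> {x \<in> std_triangle. 0 < coord i x}"
    (is "?L = ?R")
proof (intro equalityI subsetI)
  fix p assume p: "p \<in> ?L"
  obtain \<psi> x where [simp]: "p = (\<psi>, x)" by (cases p)
  from p have \<psi>: "\<psi> \<in> flags M" "x \<in> std_triangle" by (auto simp: topspace_flag_triangles)
  obtain \<psi>' y where q: "glue M (\<psi>', y) = glue M (\<psi>, x)" "\<psi>' \<in> star_flags i \<phi>" "0 < coord i y"
    using p by (auto simp: star_def)
  then have "y = x" by (simp add: glue_eq_iff)
  then have "\<psi> \<in> star_flags i \<phi>"
    using glue_star_flags[OF assms q(1) _ q(3)] q(2) star_flags_subset[OF assms] by blast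
  then show "p \<in> ?R" using \<psi> q \<open>y = x\<close> by auto
next
  fix p assume "p \<in> ?R"
  then show "p \<in> ?L"
    using star_flags_subset[OF assms] by (auto simp: topspace_flag_triangles star_def)
qed

lemma openin_coord_pos: "openin (top_of_set A) {x \<in> A. 0 < coord i x}"
proof -
  have "openin (top_of_set A) (A \<inter> coord i -` {0<..})"
    by (rule continuous_openin_preimage_gen[OF continuous_on_coord]) simp
  moreover have "A \<inter> coord i -` {0<..} = {x \<in> A. 0 < coord i x}" by auto
  ultimately show ?thesis by simp
qed

lemma openin_star:
  assumes "\<phi> \<in> flags M" shows "openin (surface M) (star i \<phi>)"
proof -
  have "{x. (\<psi>, x) \<in> star_flags i \<phi> \<times> {x \<in> std_triangle. 0 < coord i x}} =
      (if \<psi> \<in> star_flags i \<phi> then {x \<in> std_triangle. 0 < coord i x} else {})" for \<psi>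
    by simp
  then have "openin (flag_triangles M) (star_flags i \<phi> \<times> {x \<in> std_triangle. 0 < coord i x})"
    unfolding openin_flag_triangles using star_flags_subset[OF assms, of i] openin_coord_pos
    by (auto simp del: mem_Sigma_iff)
  moreover have "star i \<phi> \<subseteq> glue M ` topspace (flag_triangles M)"
    unfolding star_def topspace_flag_triangles
    by (intro image_mono Sigma_mono star_flags_subset[OF assms]) auto
  ultimately show ?thesis unfolding openin_surface star_preimage[OF assms] by simp
qed

text \<open>In the \<open>q\<close>-th triangle of the fan around the corner, the coordinates other than \<open>i\<close>, divided by the
  coordinate \<open>i\<close>, serve as coefficients of \<open>\<omega> ^ q\<close> and \<open>\<omega> ^ Suc q\<close>. They swap their places from one triangle to
  the next, so that the maps of neighbouring triangles agree on the common side. Together they map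
  the star bijectively onto the plane, because two cones overlap exactly where the corresponding
  triangles are glued. The inverse is continuous on each of the finitely many closed cones.\<close>

lemma star_homeomorphic:
  assumes \<phi>: "\<phi> \<in> flags M" and i: "i < 3"
  shows "subtopology (surface M) (star i \<phi>) homeomorphic_space (euclidean :: complex topology)"
proof -
  define j k :: nat where "j = (if i = 0 then 1 else 0)" and "k = (if i = 2 then 1 else 2)"
  have jk: "j < 3" "k < 3" "j \<noteq> k" "j \<noteq> i" "k \<noteq> i" using i by (auto simp: j_def k_def)
  obtain m :: nat and \<psi> where m: "2 \<le> m" and \<psi>0: "\<psi> 0 = \<phi>" and \<psi>F: "\<And>q. \<psi> q \<in> flags M"
    and inj: "inj_on \<psi> {..<2 * m}" and per: "\<And>q. \<psi> (q + 2 * m) = \<psi> q"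
    and step: "\<And>q. \<psi> (Suc q) = (if even q then flag_change M j else flag_change M k) (\<psi> q)"
  proof (rule fan_enumeration[OF finite_flags \<phi>, of "flag_change M j" "flag_change M k"])
    show "flag_change M j \<alpha> \<in> flags M \<and> flag_change M j (flag_change M j \<alpha>) = \<alpha> \<and> flag_change M j \<alpha> \<noteq> \<alpha>"
      "flag_change M k \<alpha> \<in> flags M \<and> flag_change M k (flag_change M k \<alpha>) = \<alpha> \<and> flag_change M k \<alpha> \<noteq> \<alpha>"
      "flag_change M j \<alpha> \<noteq> flag_change M k \<alpha>" if "\<alpha> \<in> flags M" for \<alpha>
      using flag_change[OF that] flag_change_neq[OF that] jk by auto
  qed blast
  \<comment> \<open>On the side \<open>lo q\<close> the triangle \<open>q\<close> meets its successor, on the side \<open>lo (Suc q)\<close> its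
    predecessor.\<close>
  define lo where "lo q = (if even q then j else k)" for q :: nat
  have lo: "lo q < 3" "lo q \<noteq> i" "lo (Suc (Suc q)) = lo q" "lo q \<noteq> lo (Suc q)" for q
    using jk by (auto simp: lo_def)
  have lo_ex: "l = i \<or> l = lo q \<or> l = lo (Suc q)" if "l < 3" for l q
    using that i unfolding lo_def j_def k_def less_3_cases by auto
  have lo_per: "lo (q + 2 * n) = lo q" for q n by (simp add: lo_def)
  have up: "flag_change M (lo q) (\<psi> q) = \<psi> (Suc q)" for q by (simp add: step lo_def)
  have down: "flag_change M (lo q) (\<psi> (Suc q)) = \<psi> q" for q
    using flag_change(2)[OF \<psi>F] up by metis
  have sum1: "coord i x + coord (lo q) x + coord (lo (Suc q)) x = 1" if "x \<in> std_triangle" for x q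
    using in_std_triangle(2)[OF that] i by (auto simp: lo_def j_def k_def less_3_cases)

  define \<omega> where "\<omega> = cis (pi / real m)"
  have m0: "real m \<noteq> 0" using m by simp
  have \<omega>: "\<omega> ^ (2 * m) = 1" "\<omega> \<noteq> 0"
    using m0 by (auto simp: \<omega>_def Complex.DeMoivre)
  have sin_pos: "0 < Im \<omega>"
    using sin_pi_multiple_pos[of 1 m] m by (simp add: \<omega>_def)

  \<comment> \<open>the linear map on the \<open>q\<close>-th triangle of the fan\<close>
  define h where "h q x = (of_real (coord (lo q) x / coord i x) +
      of_real (coord (lo (Suc q)) x / coord i x) * \<omega>) * \<omega> ^ q" for q x
  have h_per: "h (q + 2 * m) = h q" for q
    using lo_per[of q m] lo_per[of "Suc q" m] by (simp add: h_def fun_eq_iff power_add \<omega>)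
  have h_per': "h (q + 2 * m * n) = h q" for q n
  proof (induction n)
    case (Suc n)
    have "q + 2 * m * Suc n = (q + 2 * m * n) + 2 * m" by simp
    then show ?case using h_per Suc by metis
  qed simp
  have per': "\<psi> (q + 2 * m * n) = \<psi> q" for q n
  proof (induction n)
    case (Suc n)
    have "q + 2 * m * Suc n = (q + 2 * m * n) + 2 * m" by simp
    then show ?case using per Suc by metis
  qed simp
  have h_mod: "h (q mod (2 * m)) = h q" for q
    using h_per'[of "q mod (2 * m)" "q div (2 * m)"] by simp
  have \<psi>_mod: "\<psi> (q mod (2 * m)) = \<psi> q" for q
    using per'[of "q mod (2 * m)" "q div (2 * m)"] by simp
  have h_eq: "h q = h r" if "\<psi> q = \<psi> r" for q r
  proof -
    have "\<psi> (q mod (2 * m)) = \<psi> (r mod (2 * m))" using that \<psi>_mod by simp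
    then have "q mod (2 * m) = r mod (2 * m)" using m by (intro inj_onD[OF inj]) auto
    then show ?thesis using h_mod by metis
  qed
  have neighbour: "\<exists>r. flag_change M l (\<psi> q) = \<psi> r \<and> (\<forall>x. coord l x = 0 \<longrightarrow> h r x = h q x)"
    if l: "l < 3" "l \<noteq> i" for l q
  proof -
    have h_up: "h (Suc q) x = h q x" if "coord (lo q) x = 0" for q x
      using that lo(3)[of q] by (simp add: h_def)
    consider "l = lo q" | "l = lo (Suc q)" using lo_ex l by blast
    then show ?thesis
    proof cases
      case 1
      then show ?thesis using up h_up by blast
    next
      case 2
      obtain p where p: "q + 2 * m = Suc p" using m by (cases "q + 2 * m") auto
      have "lo p = l" using 2 lo(3)[of p] lo_per[of "Suc q" m] p by simp
      then have "flag_change M l (\<psi> q) = \<psi> p" using down[of p] per[of q] p by simp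
      moreover have "h p x = h q x" if "coord l x = 0" for x
        using h_up[of p x] that \<open>lo p = l\<close> p h_per[of q] by simp
      ultimately show ?thesis by blast
    qed
  qed
  have flags_eq: "star_flags i \<phi> = range \<psi>"
  proof (intro equalityI subsetI)
    fix \<alpha> assume "\<alpha> \<in> star_flags i \<phi>"
    then have "(\<phi>, \<alpha>) \<in> {(\<alpha>, flag_change M l \<alpha>) | \<alpha> l. \<alpha> \<in> flags M \<and> l < 3 \<and> l \<noteq> i}\<^sup>*"
      by (simp add: star_flags_def)
    then show "\<alpha> \<in> range \<psi>"
    proof induction
      case base
      then show ?case using \<psi>0 by (metis rangeI)
    next
      case (step \<alpha> \<beta>)
      then obtain l q where "l < 3" "l \<noteq> i" "\<beta> = flag_change M l (\<psi> q)" by blast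
      then show ?case using neighbour by (metis rangeI)
    qed
  next
    fix \<alpha> assume "\<alpha> \<in> range \<psi>"
    moreover have "\<psi> q \<in> star_flags i \<phi>" for q
    proof (induction q)
      case (Suc q)
      then show ?case using star_flags_change[OF \<phi> Suc lo(1,2)[of q]] up by simp
    qed (simp add: \<psi>0 star_flags_self)
    ultimately show "\<alpha> \<in> star_flags i \<phi>" by blast
  qed

  define h' where "h' p = h (SOME q. \<psi> q = fst p) (snd p)" for p
  have h': "h' (\<psi> q, x) = h q x" for q x
  proof -
    have "\<psi> (SOME r. \<psi> r = \<psi> q) = \<psi> q" by (rule someI) simp
    then have "h (SOME r. \<psi> r = \<psi> q) = h q" by (rule h_eq)
    then show ?thesis by (simp only: h'_def fst_conv snd_conv)
  qed
  have h'_glue: "h' (\<psi> q, x) = h' (\<alpha>, y)"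
    if "glue M (\<psi> q, x) = glue M (\<alpha>, y)" "0 < coord i x" for q x \<alpha> y
  proof -
    define f where "f \<beta> = (if \<beta> \<in> range \<psi> then Some (h' (\<beta>, x)) else None)" for \<beta>
    have "x = y" and chain: "(\<psi> q, \<alpha>) \<in> (side_rel M x)\<^sup>*" using that(1) unfolding glue_eq_iff by blast+
    have "\<alpha> \<in> flags M \<and> f \<alpha> = f (\<psi> q)"
    proof (rule side_rel_invariant[OF chain \<psi>F])
      fix \<beta> l assume \<beta>: "\<beta> \<in> flags M" "l < 3" "coord l x = 0"
      then have "l \<noteq> i" using that by auto
      show "f (flag_change M l \<beta>) = f \<beta>"
      proof (cases "\<beta> \<in> range \<psi>")
        case True
        then obtain r where r: "\<beta> = \<psi> r" by blast
        obtain s where "flag_change M l (\<psi> r) = \<psi> s" "h s x = h r x"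
          using neighbour[OF \<beta>(2) \<open>l \<noteq> i\<close>, of r] \<beta>(3) by blast
        then show ?thesis by (simp add: f_def r h')
      next
        case False
        then have "flag_change M l \<beta> \<notin> range \<psi>"
          using star_flags_change_iff[OF \<phi> \<beta>(1,2) \<open>l \<noteq> i\<close>] flags_eq by simp
        then show ?thesis using False by (simp add: f_def)
      qed
    qed
    then show ?thesis using \<open>x = y\<close> by (auto simp: f_def split: if_splits)
  qed

  have glue_up: "glue M (\<psi> q, x) = glue M (\<psi> (Suc q), x)" if "coord (lo q) x = 0" for q x
  proof -
    have "(\<psi> q, \<psi> (Suc q)) \<in> side_rel M x"
      using side_rel_iff[OF \<psi>F] that up lo by metis
    then show ?thesis by (simp only: glue_eq_iff) blast
  qed
  have same_point: "x = y"
    if "x \<in> std_triangle" "y \<in> std_triangle" "0 < coord i x" "0 < coord i y"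
      "coord (lo q) x / coord i x = coord (lo q) y / coord i y"
      "coord (lo (Suc q)) x / coord i x = coord (lo (Suc q)) y / coord i y" for x y q
  proof -
    have s: "1 / coord i z = 1 + coord (lo q) z / coord i z + coord (lo (Suc q)) z / coord i z"
      if "z \<in> std_triangle" "0 < coord i z" for z
      using sum1[OF that(1), of q] that(2) by (simp add: field_simps)
    have "1 / coord i x = 1 / coord i y" using s[of x] s[of y] that by simp
    then have e: "coord i x = coord i y" by simp
    then have "coord (lo q) x = coord (lo q) y" "coord (lo (Suc q)) x = coord (lo (Suc q)) y"
      using that by auto
    then have "coord l x = coord l y" if "l < 3" for l using lo_ex[OF that, of q] e by metis
    then show ?thesis by (intro coord_eqI) auto
  qed
  have fibre_le: "glue M (\<psi> q, x) = glue M (\<psi> r, y)"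
    if x: "x \<in> std_triangle" "0 < coord i x" and y: "y \<in> std_triangle" "0 < coord i y"
      and eq: "h q x = h r y" and qr: "q \<le> r" "r < 2 * m" for q r x y
  proof -
    define s where "s = r - q"
    have s: "r = q + s" "s < 2 * m" using qr by (auto simp: s_def)
    define u w u' w' where "u = coord (lo q) x / coord i x" and "w = coord (lo (Suc q)) x / coord i x"
      and "u' = coord (lo r) y / coord i y" and "w' = coord (lo (Suc r)) y / coord i y"
    have nn: "0 \<le> u" "0 \<le> w" "0 \<le> u'" "0 \<le> w'"
      using in_std_triangle(1) x y by (auto simp: u_def w_def u'_def w'_def intro!: divide_nonneg_pos)
    have "(of_real u + of_real w * \<omega>) * \<omega> ^ q = (of_real u' * \<omega> ^ s + of_real w' * \<omega> ^ Suc s) * \<omega> ^ q"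
      using eq by (simp add: h_def u_def w_def u'_def w'_def s(1) power_add algebra_simps)
    then have "of_real u + of_real w * \<omega> = of_real u' * \<omega> ^ s + of_real w' * \<omega> ^ Suc s"
      using \<omega>(2) by simp
    from cone_overlap[OF m s(2) nn \<omega>_def this]
    consider "s = 0" "u = u'" "w = w'" | "s = 1" "u = 0" "w = u'" "w' = 0"
      | "s = 2 * m - 1" "w = 0" "u' = 0" "u = w'" | "u = 0" "w = 0" "u' = 0" "w' = 0" by blast
    then show ?thesis
    proof cases
      case 1
      then have "x = y" using s by (intro same_point[OF x(1) y(1) x(2) y(2), of q]) (auto simp: u_def w_def u'_def w'_def)
      then show ?thesis using 1 s by simp
    next
      case 2
      then have "r = Suc q" using s by simp
      then have "x = y" using 2 lo(3)[of q]
        by (intro same_point[OF x(1) y(1) x(2) y(2), of q]) (auto simp: u_def w_def u'_def w'_def)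
      moreover have "coord (lo q) x = 0" using 2 x by (simp add: u_def)
      ultimately show ?thesis using glue_up \<open>r = Suc q\<close> by simp
    next
      case 3
      then have r: "q = 0" "Suc r = 2 * m" using s m qr by auto
      have "lo (Suc r) = lo 0" using lo_per[of 0 m] r by simp
      moreover have "lo r = lo (Suc 0)" using lo(3)[of r] lo_per[of "Suc 0" m] r by simp
      ultimately have "x = y" using 3 r
        by (intro same_point[OF x(1) y(1) x(2) y(2), of q]) (auto simp: u_def w_def u'_def w'_def)
      moreover have "coord (lo r) y = 0" using 3 y by (simp add: u'_def)
      then have "glue M (\<psi> r, y) = glue M (\<psi> (Suc r), y)" by (rule glue_up)
      ultimately show ?thesis using per[of 0] r by simp
    next
      case 4
      have z: "coord (lo q) x = 0" "coord (lo (Suc q)) x = 0" "coord (lo r) y = 0" "coord (lo (Suc r)) y = 0"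
        using 4 x y by (auto simp: u_def w_def u'_def w'_def)
      have ly: "coord l y = 0" if "l < 3" "l \<noteq> i" for l using lo_ex[OF that(1), of r] that z by auto
      have "x = y" using z ly[OF lo(1,2), of q] ly[OF lo(1,2), of "Suc q"]
        by (intro same_point[OF x(1) y(1) x(2) y(2), of q]) auto
      have "glue M (\<psi> (q + n), y) = glue M (\<psi> q, y)" for n
      proof (induction n)
        case (Suc n)
        then show ?case using glue_up[of "q + n" y] ly[OF lo(1,2)[of "q + n"]] by simp
      qed simp
      then show ?thesis using s(1) \<open>x = y\<close> by simp
    qed
  qed
  have fibre: "glue M (\<psi> q, x) = glue M (\<psi> r, y)"
    if x: "x \<in> std_triangle" "0 < coord i x" and y: "y \<in> std_triangle" "0 < coord i y"
      and eq: "h q x = h r y" for q r x y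
  proof -
    let ?q = "q mod (2 * m)" and ?r = "r mod (2 * m)"
    have "?q < 2 * m" "?r < 2 * m" using m by auto
    then have "glue M (\<psi> ?q, x) = glue M (\<psi> ?r, y)"
      using fibre_le[OF x y, of ?q ?r] fibre_le[OF y x, of ?r ?q] eq h_mod by (metis linear)
    then show ?thesis by (simp only: \<psi>_mod)
  qed

  \<comment> \<open>the coordinates of \<open>z\<close> with respect to \<open>\<omega> ^ q\<close> and \<open>\<omega> ^ Suc q\<close>, and the closed cone where both
    are nonnegative\<close>
  define W where "W q z = Im (z / \<omega> ^ q) / Im \<omega>" for q z
  define U where "U q z = Re (z / \<omega> ^ q) - W q z * Re \<omega>" for q z
  have UW: "(of_real (U q z) + of_real (W q z) * \<omega>) * \<omega> ^ q = z" for q z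
  proof -
    have "of_real (U q z) + of_real (W q z) * \<omega> = z / \<omega> ^ q"
      using sin_pos by (simp add: complex_eq_iff U_def W_def)
    then show ?thesis using \<omega>(2) by simp
  qed
  define T where "T q = {z. 0 \<le> U q z \<and> 0 \<le> W q z}" for q
  define pt where "pt q z = fan_point i (lo q) (U q z) (W q z)" for q z
  have contW: "continuous_on A (W q)" and contU: "continuous_on A (U q)" for A q
    unfolding U_def W_def using \<omega>(2) sin_pos by (intro continuous_intros; simp)+
  have closedT: "closed (T q)" for q
    unfolding T_def by (intro closed_Collect_conj closed_Collect_le contU contW continuous_on_const)
  have pt: "pt q z \<in> std_triangle" "0 < coord i (pt q z)" "h q (pt q z) = z" if "z \<in> T q" for q z
  proof -
    have nn: "0 \<le> U q z" "0 \<le> W q z" using that by (auto simp: T_def)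
    then have t: "0 < 1 + U q z + W q z" by simp
    show "pt q z \<in> std_triangle"
      unfolding pt_def using i lo(1,2)[of q] nn by (intro fan_point_in_triangle) auto
    show "0 < coord i (pt q z)" unfolding pt_def using i t by (simp add: coord_fan_point)
    have "coord (lo q) (pt q z) / coord i (pt q z) = U q z"
      "coord (lo (Suc q)) (pt q z) / coord i (pt q z) = W q z"
      unfolding pt_def using i t lo(1,2)[of q] lo(1,2)[of "Suc q"] lo(4)[of q] by (simp_all add: coord_fan_point)
    then show "h q (pt q z) = z" unfolding h_def using UW by simp
  qed
  have cover: "\<exists>q<2 * m. z \<in> T q" for z
  proof -
    obtain q u w where q: "q < 2 * m" "0 \<le> u" "0 \<le> w" "z = (of_real u + of_real w * \<omega>) * \<omega> ^ q"
      using cone_cover[OF m \<omega>_def] .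
    then have "z / \<omega> ^ q = of_real u + of_real w * \<omega>" using \<omega>(2) by simp
    then have "W q z = w" "U q z = u" using sin_pos by (simp_all add: U_def W_def)
    then show ?thesis using q by (auto simp: T_def)
  qed

  let ?S = "subtopology (surface M) (star i \<phi>)"
  let ?D = "range \<psi> \<times> {x \<in> std_triangle. 0 < coord i x}"
  have star_eq: "star i \<phi> = glue M ` ?D" by (simp add: star_def flags_eq)
  have D_sub: "?D \<subseteq> topspace (flag_triangles M)" using \<psi>F by (auto simp: topspace_flag_triangles)
  have topS: "topspace ?S = glue M ` ?D"
    using openin_subset[OF openin_star[OF \<phi>, of i]]
    unfolding star_eq[symmetric] topspace_subtopology by (rule Int_absorb1)
  have quot: "quotient_map (subtopology (flag_triangles M) ?D) ?S (glue M)"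
    by (rule quotient_map_restriction[OF quotient_map_glue])
      (use star_preimage[OF \<phi>] openin_star[OF \<phi>] in \<open>simp_all add: flags_eq\<close>)
  have topD: "topspace (subtopology (flag_triangles M) ?D) = ?D" using D_sub by auto

  have conth: "continuous_on {x \<in> std_triangle. 0 < coord i x} (h q)" for q
    unfolding h_def by (intro continuous_intros continuous_on_coord) auto
  have "continuous_map (subtopology (flag_triangles M) ?D) (euclidean :: complex topology) h'"
    unfolding continuous_map_def topD
  proof (intro conjI allI impI)
    fix V :: "complex set" assume "openin euclidean V"
    then have V: "open V" by simp
    have "openin (flag_triangles M) {p \<in> ?D. h' p \<in> V}"
      unfolding openin_flag_triangles
    proof (intro conjI ballI)
      fix \<alpha> assume "\<alpha> \<in> flags M"
      show "openin (top_of_set std_triangle) {x. (\<alpha>, x) \<in> {p \<in> ?D. h' p \<in> V}}"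
      proof (cases "\<alpha> \<in> range \<psi>")
        case True
        then obtain q where q: "\<alpha> = \<psi> q" by blast
        have "openin (top_of_set {x \<in> std_triangle. 0 < coord i x}) ({x \<in> std_triangle. 0 < coord i x} \<inter> h q -` V)"
          by (rule continuous_openin_preimage_gen[OF conth V])
        then have "openin (top_of_set std_triangle) ({x \<in> std_triangle. 0 < coord i x} \<inter> h q -` V)"
          using openin_coord_pos openin_trans by blast
        moreover have "{x. (\<alpha>, x) \<in> {p \<in> ?D. h' p \<in> V}} = {x \<in> std_triangle. 0 < coord i x} \<inter> h q -` V"
          by (auto simp: q h')
        ultimately show ?thesis by simp
      qed simp
    qed (use D_sub topspace_flag_triangles in blast)
    then show "openin (subtopology (flag_triangles M) ?D) {p \<in> ?D. h' p \<in> V}"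
      unfolding openin_subtopology by blast
  qed simp
  then obtain H where H: "continuous_map ?S euclidean H"
    and H_glue: "\<And>p. p \<in> ?D \<Longrightarrow> H (glue M p) = h' p"
  proof (rule quotient_map_lift_exists[OF quot])
    fix p p' assume p: "p \<in> topspace (subtopology (flag_triangles M) ?D)"
      "p' \<in> topspace (subtopology (flag_triangles M) ?D)" "glue M p = glue M p'"
    obtain q x where q: "p = (\<psi> q, x)" "0 < coord i x" using p(1) unfolding topD by auto
    obtain \<alpha> y where "p' = (\<alpha>, y)" by (cases p')
    then show "h' p = h' p'" using h'_glue p(3) q by simp
  qed (unfold topD, blast)

  \<comment> \<open>the inverse, pasted together from its restrictions to the cones\<close>
  obtain G where G: "continuous_map euclidean ?S G"
    and G_glue: "\<And>z q. \<lbrakk>q \<in> {..<2 * m}; z \<in> T q\<rbrakk> \<Longrightarrow> G z = glue M (\<psi> q, pt q z)"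
  proof (rule pasting_lemma_exists_closed[of "{..<2 * m}" euclidean T ?S "\<lambda>q z. glue M (\<psi> q, pt q z)"])
    show "topspace (euclidean :: complex topology) \<subseteq> \<Union> (T ` {..<2 * m})" using cover by auto
    show "closedin euclidean (T q)" for q using closedT by simp
    show "continuous_map (subtopology euclidean (T q)) ?S (\<lambda>z. glue M (\<psi> q, pt q z))" for q
    proof -
      have "continuous_on (T q) (pt q)"
        unfolding pt_def by (intro continuous_on_fan_point contU contW) (auto simp: T_def)
      then have "continuous_map (top_of_set (T q)) (flag_triangles M) (\<lambda>z. (\<psi> q, pt q z))"
        unfolding flag_triangles_std continuous_map_pairwise
        using \<psi>F pt(1) by (auto simp: comp_def)
      then have "continuous_map (top_of_set (T q)) (surface M) (glue M \<circ> (\<lambda>z. (\<psi> q, pt q z)))"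
        by (rule continuous_map_compose[OF _ quotient_imp_continuous_map[OF quotient_map_glue]])
      then show ?thesis
        using pt(1,2) by (auto simp: continuous_map_in_subtopology comp_def star_eq)
    qed
    show "glue M (\<psi> q, pt q z) = glue M (\<psi> r, pt r z)"
      if "z \<in> topspace euclidean \<inter> T q \<inter> T r" for q r z
      using that pt by (intro fibre) auto
  qed auto
  have "homeomorphic_maps ?S euclidean H G"
    unfolding homeomorphic_maps_def
  proof (intro conjI ballI H G)
    fix X assume "X \<in> topspace ?S"
    then obtain q x where X: "X = glue M (\<psi> q, x)" "x \<in> std_triangle" "0 < coord i x"
      unfolding topS by auto
    then have "H X = h q x" using H_glue h' by auto
    moreover obtain r where r: "r < 2 * m" "h q x \<in> T r" using cover by blast
    ultimately have "G (H X) = glue M (\<psi> r, pt r (h q x))" using G_glue by simp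
    also have "\<dots> = X" unfolding X using X pt r by (intro fibre) auto
    finally show "G (H X) = X" .
  next
    fix z :: complex
    obtain r where r: "r < 2 * m" "z \<in> T r" using cover by blast
    then have "H (G z) = h' (\<psi> r, pt r z)" using G_glue H_glue pt by auto
    then show "H (G z) = z" using h' pt r by simp
  qed
  then show ?thesis by (rule homeomorphic_maps_imp_homeomorphic_space)
qed

end

section \<open>The surface of an embedding scheme\<close>

lemma homeomorphic_space_complex_plane:
  "(euclidean :: complex topology) homeomorphic_space (euclidean :: (real^2) topology)"
proof -
  have "(UNIV :: complex set) homeomorphic (UNIV :: (real^2) set)"
    by (rule homeomorphic_subspaces) auto
  then obtain f and g :: "real^2 \<Rightarrow> complex" where "homeomorphism UNIV UNIV f g"
    by (auto simp: homeomorphic_def)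
  then have "homeomorphic_maps euclidean euclidean f g"
    by (auto simp: homeomorphism_def homeomorphic_maps_def)
  then show ?thesis by (rule homeomorphic_maps_imp_homeomorphic_space)
qed

lemma compact_std_triangle: "compact std_triangle"
proof -
  let ?A = "{x :: real \<times> real \<times> real. 0 \<le> fst x \<and> 0 \<le> fst (snd x) \<and> 0 \<le> snd (snd x) \<and> fst x + fst (snd x) + snd (snd x) = 1}"
  have "closed ?A"
    by (intro closed_Collect_conj closed_Collect_le closed_Collect_eq continuous_intros)
  moreover have "compact ({0..1::real} \<times> {0..1::real} \<times> {0..1::real})"
    by (intro compact_Times compact_Icc)
  ultimately have "compact (({0..1} \<times> {0..1} \<times> {0..1}) \<inter> ?A)" by (rule compact_Int_closed[rotated])
  moreover have "({0..1} \<times> {0..1} \<times> {0..1}) \<inter> ?A = std_triangle" by (auto simp: std_triangle_def)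
  ultimately show ?thesis by simp
qed

context thick_scheme
begin

lemma surface_pointE:
  assumes "X \<in> topspace (surface M)"
  obtains \<phi> x i where "X = glue M (\<phi>, x)" "\<phi> \<in> flags M" "x \<in> std_triangle" "i < 3" "0 < coord i x"
proof -
  obtain \<phi> x where X: "X = glue M (\<phi>, x)" "\<phi> \<in> flags M" "x \<in> std_triangle"
    using assms unfolding topspace_surface topspace_flag_triangles by blast
  have "\<exists>i<3. 0 < coord i x"
    unfolding less_3_cases using in_std_triangle[OF X(3)] by (metis add_0 less_eq_real_def zero_neq_one)
  then show thesis using that X by blast
qed

lemma in_starI:
  "\<lbrakk>\<psi> \<in> star_flags i \<phi>; x \<in> std_triangle; 0 < coord i x\<rbrakk> \<Longrightarrow> glue M (\<psi>, x) \<in> star i \<phi>"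
  by (simp add: star_def)

lemma Hausdorff_star: "\<lbrakk>\<phi> \<in> flags M; i < 3\<rbrakk> \<Longrightarrow> Hausdorff_space (subtopology (surface M) (star i \<phi>))"
  using star_homeomorphic homeomorphic_Hausdorff_space Hausdorff_space_euclidean by blast

text \<open>The barycentric coordinate with respect to a corner extends by \<open>0\<close> to the whole surface: the sides
  through the corner are glued within its star, and on the opposite sides the coordinate vanishes.\<close>

lemma barycentric_function:
  assumes \<phi>: "\<phi> \<in> flags M" and "i < 3"
  shows "\<exists>b :: ('v, 'e) flag_point set \<Rightarrow> real. continuous_map (surface M) euclidean b \<and>
    (\<forall>\<psi>\<in>flags M. \<forall>x\<in>std_triangle. b (glue M (\<psi>, x)) = (if \<psi> \<in> star_flags i \<phi> then coord i x else 0))"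
proof -
  define b' where "b' p = (if fst p \<in> star_flags i \<phi> then coord i (snd p) else 0)" for p :: "('v, 'e) flag_point"
  have "continuous_map (flag_triangles M) euclidean b'"
    unfolding continuous_map_flag_triangles b'_def by (auto simp: continuous_on_coord)
  moreover have "b' p = b' q"
    if pq: "p \<in> topspace (flag_triangles M)" "q \<in> topspace (flag_triangles M)" "glue M p = glue M q" for p q
  proof -
    obtain \<psi> x where p: "p = (\<psi>, x)" "\<psi> \<in> flags M" "x \<in> std_triangle"
      using pq(1) unfolding topspace_flag_triangles by blast
    obtain \<psi>' y where q: "q = (\<psi>', y)" by (cases q)
    have "x = y" using pq(3) unfolding p q glue_eq_iff by blast
    show ?thesis
    proof (cases "coord i x = 0")
      case True
      then show ?thesis using \<open>x = y\<close> by (simp add: b'_def p q)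
    next
      case False
      then have "0 < coord i x" using in_std_triangle(1)[OF p(3), of i] by linarith
      then show ?thesis
        using glue_star_flags[OF \<phi> pq(3)[unfolded p q] p(2)] \<open>x = y\<close> by (simp add: b'_def p q)
    qed
  qed
  ultimately obtain b where "continuous_map (surface M) euclidean b"
    "\<And>p. p \<in> topspace (flag_triangles M) \<Longrightarrow> b (glue M p) = b' p"
    using quotient_map_lift_exists[OF quotient_map_glue] by metis
  then show ?thesis by (intro exI[of _ b]) (simp add: topspace_flag_triangles b'_def)
qed

text \<open>Two points of a common star are separated in this star, which is a plane. If no star of a corner of
  the first point contains the second one, then the barycentric coordinate of such a corner separates
  them.\<close>

lemma Hausdorff_surface: "Hausdorff_space (surface M)"
  unfolding Hausdorff_space_def
proof (intro allI impI)
  fix X Y assume XY: "X \<in> topspace (surface M) \<and> Y \<in> topspace (surface M) \<and> X \<noteq> Y"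
  obtain \<phi> x i where X: "X = glue M (\<phi>, x)" "\<phi> \<in> flags M" "x \<in> std_triangle" "i < 3" "0 < coord i x"
    using surface_pointE XY by metis
  obtain \<psi> y where Y: "Y = glue M (\<psi>, y)" "\<psi> \<in> flags M" "y \<in> std_triangle"
    using surface_pointE XY by metis
  have Xs: "X \<in> star i \<phi>" unfolding X using X by (intro in_starI star_flags_self)
  show "\<exists>U V. openin (surface M) U \<and> openin (surface M) V \<and> X \<in> U \<and> Y \<in> V \<and> disjnt U V"
  proof (cases "\<psi> \<in> star_flags i \<phi> \<and> 0 < coord i y")
    case True
    then have "Y \<in> star i \<phi>" unfolding Y using Y by (intro in_starI) auto
    then have "X \<in> topspace (subtopology (surface M) (star i \<phi>)) \<and>
        Y \<in> topspace (subtopology (surface M) (star i \<phi>)) \<and> X \<noteq> Y"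
      using Xs XY by simp
    then obtain U V where "openin (subtopology (surface M) (star i \<phi>)) U"
      "openin (subtopology (surface M) (star i \<phi>)) V" "X \<in> U" "Y \<in> V" "disjnt U V"
      using Hausdorff_star[OF X(2,4)] unfolding Hausdorff_space_def by meson
    then show ?thesis using openin_star[OF X(2)] openin_trans_full by meson
  next
    case False
    obtain b :: "('v, 'e) flag_point set \<Rightarrow> real" where b: "continuous_map (surface M) euclidean b"
      "\<And>\<psi> x. \<lbrakk>\<psi> \<in> flags M; x \<in> std_triangle\<rbrakk> \<Longrightarrow>
         b (glue M (\<psi>, x)) = (if \<psi> \<in> star_flags i \<phi> then coord i x else 0)"
      using barycentric_function[OF X(2,4)] by blast
    have bX: "b X = coord i x" using b(2)[OF X(2,3)] star_flags_self X(1) by simp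
    have bY: "b Y = 0"
      using b(2)[OF Y(2,3)] False in_std_triangle(1)[OF Y(3), of i] Y(1) by (simp split: if_splits)
    let ?c = "coord i x / 2"
    have "openin (surface M) {Z \<in> topspace (surface M). b Z \<in> {?c<..}}"
      "openin (surface M) {Z \<in> topspace (surface M). b Z \<in> {..<?c}}"
      by (rule openin_continuous_map_preimage[OF b(1)]; simp)+
    then show ?thesis
      using bX bY XY X(5)
      by (intro exI[of _ "{Z \<in> topspace (surface M). b Z \<in> {?c<..}}"]
          exI[of _ "{Z \<in> topspace (surface M). b Z \<in> {..<?c}}"]) (auto simp: disjnt_iff)
  qed
qed

lemma compact_surface: "compact_space (surface M)"
proof -
  have "compact_space (flag_triangles M)"
    unfolding flag_triangles_std compact_space_prod_topology
    using finite_flags compact_std_triangle by (simp add: compact_space_discrete_topology compact_space_subtopology)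
  then have "compactin (surface M) (glue M ` topspace (flag_triangles M))"
    unfolding compact_space_def
    by (rule image_compactin[OF _ quotient_imp_continuous_map[OF quotient_map_glue]])
  then show ?thesis by (simp add: compact_space_def topspace_surface)
qed

text \<open>Every point has a positive barycentric coordinate, so the open stars of the corners cover the
  surface.\<close>

theorem closed_surface_surface: "closed_surface (surface M)"
  unfolding closed_surface_def
proof (intro conjI ballI compact_surface Hausdorff_surface)
  fix X assume "X \<in> topspace (surface M)"
  then obtain \<phi> x i where X: "X = glue M (\<phi>, x)" "\<phi> \<in> flags M" "x \<in> std_triangle" "i < 3" "0 < coord i x"
    using surface_pointE by metis
  have "X \<in> star i \<phi>" unfolding X using X by (intro in_starI star_flags_self)
  moreover have "subtopology (surface M) (star i \<phi>) homeomorphic_space (euclidean :: (real^2) topology)"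
    using star_homeomorphic[OF X(2,4)] homeomorphic_space_complex_plane by (rule homeomorphic_space_trans)
  ultimately show "\<exists>U. openin (surface M) U \<and> X \<in> U \<and>
        subtopology (surface M) U homeomorphic_space (euclidean :: (real^2) topology)"
    using openin_star[OF X(2)] by blast
qed

section \<open>Walks as curves in the surface\<close>

lemma glue_flag_change:
  assumes "\<phi> \<in> flags M" "i < 3" "coord i x = 0"
  shows "glue M (flag_change M i \<phi>, x) = glue M (\<phi>, x)"
proof -
  have "(\<phi>, flag_change M i \<phi>) \<in> side_rel M x" using assms side_rel_iff by blast
  then have "glue M (\<phi>, x) = glue M (flag_change M i \<phi>, x)" unfolding glue_eq_iff by blast
  then show ?thesis by simp
qed

lemma glue_side:
  assumes "(v, e, s) \<in> flags M" "coord 2 x = 0"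
  shows "glue M ((v, e, s'), x) = glue M ((v, e, s), x)"
  using glue_flag_change[OF assms(1), of 2 x] assms by (cases "s' = s") (auto simp: flag_change_def)

lemma glue_edge_corner:
  assumes "(v, e, s) \<in> flags M"
  shows "glue M ((other_end M e v, e, s'), 0, 1, 0) = glue M ((v, e, s), 0, 1, 0)"
proof -
  obtain s'' where s'': "flag_change M 0 (v, e, s) = (other_end M e v, e, s'')"
    by (simp add: flag_change_def)
  have "glue M ((other_end M e v, e, s''), 0, 1, 0) = glue M ((v, e, s), 0, 1, 0)"
    using glue_flag_change[OF assms, of 0 "(0, 1, 0)"] s'' by (simp add: coord_def)
  moreover have "(other_end M e v, e, s'') \<in> flags M" using flag_change(1)[OF assms, of 0] s'' by simp
  then have "glue M ((other_end M e v, e, s'), 0, 1, 0) = glue M ((other_end M e v, e, s''), 0, 1, 0)"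
    by (rule glue_side) (simp add: coord_def)
  ultimately show ?thesis by simp
qed

text \<open>The rotation being cyclic, going around \<open>v\<close> one passes through all flags at \<open>v\<close>.\<close>

lemma glue_vertex_corner:
  assumes v: "v \<in> verts M" and e: "e \<in> edges_at M v" and f: "f \<in> edges_at M v"
  shows "glue M ((v, f, s'), 1, 0, 0) = glue M ((v, e, s), 1, 0, 0)"
proof -
  have next_edge: "glue M ((v, rotation M v g, s), 1, 0, 0) = glue M ((v, g, s), 1, 0, 0)"
    if g: "g \<in> edges_at M v" for g s
  proof -
    have g': "(v, g, t) \<in> flags M" "(v, rotation M v g, t) \<in> flags M" for t
      using v g rotation_image[OF v] by (auto simp: flags_def)
    have "glue M ((v, rotation M v g, False), 1, 0, 0) = glue M ((v, g, True), 1, 0, 0)"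
      using glue_flag_change[OF g'(1)[of True], of 1 "(1, 0, 0)"] by (simp add: flag_change_def coord_def)
    then show ?thesis
      using glue_side[OF g'(1), of "(1, 0, 0)" True s] glue_side[OF g'(2), of "(1, 0, 0)" False s]
      by (simp add: coord_def)
  qed
  have "f \<in> orbit (rotation M v) e" using rotation_cyclic[OF v] e f unfolding cyclic_on_alldef by blast
  then have "f \<in> edges_at M v \<and> glue M ((v, f, s), 1, 0, 0) = glue M ((v, e, s), 1, 0, 0)"
    by induction (use next_edge e rotation_image[OF v] in auto)
  moreover have "glue M ((v, f, s'), 1, 0, 0) = glue M ((v, f, s), 1, 0, 0)"
    using v f by (intro glue_side) (auto simp: flags_def coord_def)
  ultimately show ?thesis by simp
qed

text \<open>Off the side opposite to the vertex corner, only changes are available that keep the vertex; the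
  next lemma is the analogue for the edge.\<close>

lemma glue_same_vertex:
  assumes "glue M ((v, e, s), x) = glue M ((v', e', s'), y)" "(v, e, s) \<in> flags M" "coord 0 x \<noteq> 0"
  shows "v = v'"
proof -
  have "((v, e, s), (v', e', s')) \<in> (side_rel M x)\<^sup>*" using assms(1) unfolding glue_eq_iff by blast
  then have "(v', e', s') \<in> flags M \<and> fst (v', e', s') = fst (v, e, s)"
    by (rule side_rel_invariant[OF _ assms(2)])
      (use assms(3) in \<open>auto simp: less_3_cases flag_change_def split: prod.splits\<close>)
  then show ?thesis by simp
qed

lemma glue_same_edge:
  assumes "glue M ((v, e, s), x) = glue M ((v', e', s'), y)" "(v, e, s) \<in> flags M" "coord 1 x \<noteq> 0"
  shows "e = e'"
proof -
  have "((v, e, s), (v', e', s')) \<in> (side_rel M x)\<^sup>*" using assms(1) unfolding glue_eq_iff by blast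
  then have "(v', e', s') \<in> flags M \<and> (fst \<circ> snd) (v', e', s') = (fst \<circ> snd) (v, e, s)"
    by (rule side_rel_invariant[OF _ assms(2)])
      (use assms(3) in \<open>auto simp: less_3_cases flag_change_def split: prod.splits\<close>)
  then show ?thesis by simp
qed

lemma continuous_map_side:
  assumes "\<phi> \<in> flags M" "continuous_on A a" "\<And>t. t \<in> A \<Longrightarrow> 0 \<le> a t \<and> a t \<le> 1"
  shows "continuous_map (top_of_set A) (surface M) (\<lambda>t. glue M (\<phi>, 1 - a t, a t, 0))"
proof -
  have "continuous_on A (\<lambda>t. (1 - a t, a t, 0 :: real))" using assms(2) by (intro continuous_intros)
  then have "continuous_map (top_of_set A) (flag_triangles M) (\<lambda>t. (\<phi>, 1 - a t, a t, 0))"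
    unfolding flag_triangles_std continuous_map_pairwise
    using assms by (auto simp: comp_def std_triangle_def)
  then have "continuous_map (top_of_set A) (surface M) (glue M \<circ> (\<lambda>t. (\<phi>, 1 - a t, a t, 0)))"
    by (rule continuous_map_compose[OF _ quotient_imp_continuous_map[OF quotient_map_glue]])
  then show ?thesis by (simp add: comp_def)
qed

lemma continuous_map_dart_curve:
  assumes "v \<in> verts M" "e \<in> edges_at M v"
  shows "continuous_map (top_of_set {0..1}) (surface M) (dart_curve M (v, e))"
proof (rule pasting_lemma_closed[of "UNIV :: bool set" _ "\<lambda>b. if b then {0..1/2} else {1/2..1}" _
      "\<lambda>b t. glue M (if b then ((v, e, True), 1 - 2 * t, 2 * t, 0)
        else ((other_end M e v, e, True), 1 - (2 - 2 * t), 2 - 2 * t, 0))"])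
  have fl: "(v, e, True) \<in> flags M" "(other_end M e v, e, True) \<in> flags M"
    using assms other_end[OF assms] by (auto simp: flags_def)
  show "closedin (top_of_set {0..1}) (if b then {0..1/2} else {1/2..1::real})" for b
    by (intro closed_subset) auto
  show "continuous_map (subtopology (top_of_set {0..1}) (if b then {0..1/2} else {1/2..1})) (surface M)
      (\<lambda>t. glue M (if b then ((v, e, True), 1 - 2 * t, 2 * t, 0)
        else ((other_end M e v, e, True), 1 - (2 - 2 * t), 2 - 2 * t, 0)))" for b
  proof (cases b)
    case True
    have "continuous_map (top_of_set ({0..1} \<inter> {0..1/2})) (surface M) (\<lambda>t. glue M ((v, e, True), 1 - 2 * t, 2 * t, 0))"
      by (rule continuous_map_side[OF fl(1)]) (auto intro!: continuous_intros)
    then show ?thesis using True by (simp add: subtopology_subtopology)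
  next
    case False
    have "continuous_map (top_of_set ({0..1} \<inter> {1/2..1})) (surface M)
        (\<lambda>t. glue M ((other_end M e v, e, True), 1 - (2 - 2 * t), 2 - 2 * t, 0))"
      by (rule continuous_map_side[OF fl(2)]) (auto intro!: continuous_intros)
    then show ?thesis using False by (simp add: subtopology_subtopology)
  qed
  show "glue M (if b then ((v, e, True), 1 - 2 * t, 2 * t, 0)
        else ((other_end M e v, e, True), 1 - (2 - 2 * t), 2 - 2 * t, 0)) =
      glue M (if c then ((v, e, True), 1 - 2 * t, 2 * t, 0)
        else ((other_end M e v, e, True), 1 - (2 - 2 * t), 2 - 2 * t, 0))"
    if "t \<in> topspace (top_of_set {0..1}) \<inter> (if b then {0..1/2} else {1/2..1})
        \<inter> (if c then {0..1/2} else {1/2..1})" for b c and t :: real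
  proof (cases "b = c")
    case False
    then have "2 * t = 1" using that by (auto split: if_splits)
    then have "1 - 2 * t = 0" "1 - (2 - 2 * t) = 0" "2 - 2 * t = 1" by simp_all
    then show ?thesis
      using glue_edge_corner[OF fl(1), of True] \<open>2 * t = 1\<close> by (cases b; cases c) (simp_all only: if_True if_False)
  qed simp
  show "\<exists>b. b \<in> UNIV \<and> t \<in> (if b then {0..1/2} else {1/2..1}) \<and>
      dart_curve M (v, e) t = glue M (if b then ((v, e, True), 1 - 2 * t, 2 * t, 0)
        else ((other_end M e v, e, True), 1 - (2 - 2 * t), 2 - 2 * t, 0))"
    if "t \<in> topspace (top_of_set {0..1})" for t
    using that by (intro exI[of _ "t \<le> 1/2"]) (auto simp: dart_curve_def)
qed simp

text \<open>A point in the interior of an edge determines the edge and, unless it is the midpoint, the end that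
  it is closer to; an end point determines the vertex. The assumption \<open>same\<close> is what distinct
  vertices and distinct edges of a walk provide.\<close>

lemma dart_curve_eq:
  assumes d: "v \<in> verts M" "e \<in> edges_at M v" "v' \<in> verts M" "e' \<in> edges_at M v'"
    and a: "0 \<le> a" "a < 1" and b: "0 \<le> b" "b < 1"
    and eq: "dart_curve M (v, e) a = dart_curve M (v', e') b"
    and same: "v = v' \<longleftrightarrow> e = e'"
  shows "v = v' \<and> a = b"
proof -
  have fl: "(v, e, True) \<in> flags M" "(other_end M e v, e, True) \<in> flags M"
    "(v', e', True) \<in> flags M" "(other_end M e' v', e', True) \<in> flags M"
    using d other_end[OF d(1,2)] other_end[OF d(3,4)] by (auto simp: flags_def)
  have ne: "other_end M e v \<noteq> v" using other_end[OF d(1,2)] by blast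
  define V where "V t u w = (if t \<le> 1/2 then u else w)" for t :: real and u w :: 'v
  define x where "x t = (if t \<le> 1/2 then (1 - 2 * t, 2 * t, 0) else (2 * t - 1, 2 - 2 * t, 0 :: real))" for t :: real
  have dc: "dart_curve M (u, f) t = glue M ((V t u (other_end M f u), f, True), x t)" for u f t
    by (simp add: dart_curve_def V_def x_def)
  have eq': "glue M ((V a v (other_end M e v), e, True), x a) = glue M ((V b v' (other_end M e' v'), e', True), x b)"
    using eq by (simp only: dc)
  then have "x a = x b" unfolding glue_eq_iff by blast
  then have ab: "a = b \<or> a = 1 - b" using a b by (auto simp: x_def split: if_splits)
  have flV: "(V a v (other_end M e v), e, True) \<in> flags M" using fl by (simp add: V_def)
  show ?thesis
  proof (cases "a = 0")
    case True
    then have "b = 0" using ab b by auto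
    have "V a v (other_end M e v) = V b v' (other_end M e' v')"
      by (rule glue_same_vertex[OF eq' flV]) (simp add: True x_def coord_def)
    then show ?thesis using True \<open>b = 0\<close> by (simp add: V_def)
  next
    case False
    have "e = e'"
      by (rule glue_same_edge[OF eq' flV]) (use False a in \<open>auto simp: x_def coord_def\<close>)
    then have "v = v'" using same by simp
    have "a = b"
    proof (rule ccontr)
      assume "a \<noteq> b"
      then have "V a v (other_end M e v) = V b v' (other_end M e' v')"
        using ab by (intro glue_same_vertex[OF eq' flV]) (auto simp: x_def coord_def)
      then show False
        using ab \<open>a \<noteq> b\<close> ne \<open>e = e'\<close> \<open>v = v'\<close> by (auto simp: V_def split: if_splits)
    qed
    then show ?thesis using \<open>v = v'\<close> by simp
  qed
qed

text \<open>The curve passes through each vertex and each edge only once.\<close>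

lemma simple_closed_walk_curve:
  assumes W: "W \<noteq> []" "\<And>d. d \<in> set W \<Longrightarrow> fst d \<in> verts M \<and> snd d \<in> edges_at M (fst d)"
    and nxt: "\<And>i. i < length W \<Longrightarrow> fst (W ! (Suc i mod length W)) = other_end M (snd (W ! i)) (fst (W ! i))"
    and dist: "distinct (map fst W)" "distinct (map snd W)"
  shows "simple_closed_curve (surface M) (walk_curve M W)"
proof -
  define n where "n = length W"
  have n: "0 < n" "real n \<noteq> 0" "0 < real n" using W by (auto simp: n_def)
  have dart: "fst (W ! i) \<in> verts M" "snd (W ! i) \<in> edges_at M (fst (W ! i))" if "i < n" for i
    using W(2)[of "W ! i"] that by (auto simp: n_def)
  have start: "dart_curve M (W ! (Suc i mod n)) 0 = dart_curve M (W ! i) 1" if i: "i < n" for i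
  proof -
    obtain v e where ve: "W ! i = (v, e)" by (cases "W ! i")
    obtain w f where wf: "W ! (Suc i mod n) = (w, f)" by (cases "W ! (Suc i mod n)")
    \<comment> \<open>the end of an edge is glued to the beginning of the next one\<close>
    have "Suc i mod n < n" using n by simp
    then have "w \<in> verts M" "f \<in> edges_at M w" using dart[of "Suc i mod n"] wf by auto
    moreover have "w = other_end M e v" using nxt[of i] i ve wf by (simp add: n_def)
    moreover have "e \<in> edges_at M w" using other_end dart[OF i] ve \<open>w = _\<close> by simp
    ultimately show ?thesis unfolding ve wf using glue_vertex_corner[of w e f True True] by (simp add: dart_curve_def)
  qed
  have wc: "walk_curve M W t = dart_curve M (W ! i) (real n * t - real i)"
    if "i < n" "real i \<le> real n * t" "real n * t \<le> real i + 1" for i t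
  proof (cases "real n * t = real i + 1")
    case True
    have r: "real n * t = real (Suc i)" using True by simp
    have "nat \<lfloor>real n * t\<rfloor> = Suc i" "frac (real n * t) = 0"
      unfolding r by (simp_all add: frac_def)
    then have "walk_curve M W t = dart_curve M (W ! (Suc i mod n)) 0"
      unfolding walk_curve_def Let_def n_def[symmetric] by (simp only:)
    then show ?thesis using start that True by simp
  next
    case False
    then have f: "\<lfloor>real n * t\<rfloor> = int i" using that by (intro floor_unique) auto
    then show ?thesis using that by (simp add: walk_curve_def n_def Let_def frac_def)
  qed
  have "pathin (surface M) (walk_curve M W)"
    unfolding pathin_def
  proof (rule pasting_lemma_closed[of "{..<n}" _ "\<lambda>i. {real i / real n..(real i + 1) / real n}" _
        "\<lambda>i t. dart_curve M (W ! i) (real n * t - real i)"])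
    let ?T = "\<lambda>i. {real i / real n..(real i + 1) / real n}"
    have T: "t \<in> ?T i \<longleftrightarrow> real i \<le> real n * t \<and> real n * t \<le> real i + 1" for i t
      using n by (auto simp: field_simps)
    have sub: "{0..1} \<inter> ?T i = ?T i" if "i < n" for i
      using that n by (auto simp: T field_simps intro: order_trans)
    show "closedin (top_of_set {0..1}) (?T i)" if "i \<in> {..<n}" for i
      using sub[of i] that by (intro closed_subset) auto
    show "continuous_map (subtopology (top_of_set {0..1}) (?T i)) (surface M) (\<lambda>t. dart_curve M (W ! i) (real n * t - real i))"
      if "i \<in> {..<n}" for i
    proof -
      have i: "i < n" using that by simp
      have "continuous_map (top_of_set (?T i)) (top_of_set {0..1}) (\<lambda>t. real n * t - real i)"
        using T by (auto intro!: continuous_intros)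
      moreover have "continuous_map (top_of_set {0..1}) (surface M) (dart_curve M (W ! i))"
        using continuous_map_dart_curve[OF dart[OF i]] by simp
      ultimately have "continuous_map (top_of_set (?T i)) (surface M) (dart_curve M (W ! i) \<circ> (\<lambda>t. real n * t - real i))"
        by (rule continuous_map_compose)
      then show ?thesis unfolding subtopology_subtopology sub[OF i] comp_def .
    qed
    show "dart_curve M (W ! i) (real n * t - real i) = dart_curve M (W ! j) (real n * t - real j)"
      if "i \<in> {..<n}" "j \<in> {..<n}" "t \<in> topspace (top_of_set {0..1}) \<inter> ?T i \<inter> ?T j" for i j t
      using wc[of i t] wc[of j t] that T by auto
    show "\<exists>j. j \<in> {..<n} \<and> t \<in> ?T j \<and> walk_curve M W t = dart_curve M (W ! j) (real n * t - real j)"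
      if "t \<in> topspace (top_of_set {0..1})" for t
    proof -
      have t: "0 \<le> t" "t \<le> 1" using that by auto
      have "\<exists>j<n. real j \<le> real n * t \<and> real n * t \<le> real j + 1"
      proof (cases "t = 1")
        case True
        then show ?thesis using n by (intro exI[of _ "n - 1"]) (auto simp: of_nat_diff)
      next
        case False
        have "real n * t < real n" using n t False by (simp add: mult_less_cancel_left2)
        moreover have "0 \<le> real n * t" using n t by simp
        ultimately show ?thesis
          by (intro exI[of _ "nat \<lfloor>real n * t\<rfloor>"]) (auto simp: nat_less_iff floor_less_iff; linarith)
      qed
      then show ?thesis using wc T by auto
    qed
  qed auto
  moreover have "walk_curve M W 0 = walk_curve M W 1"
    using n by (simp add: walk_curve_def n_def Let_def frac_def)
  moreover have "inj_on (walk_curve M W) {0..<1}"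
  proof (rule inj_onI)
    fix s t assume st: "s \<in> {0..<1}" "t \<in> {0..<1}" and eq: "walk_curve M W s = walk_curve M W t"
    have fl: "\<exists>i<n. \<lfloor>real n * u\<rfloor> = int i" if "u \<in> {0..<1}" for u
    proof -
      have "real n * u < real n" using n that by simp
      moreover have "0 \<le> real n * u" using n that by simp
      ultimately show ?thesis
        by (intro exI[of _ "nat \<lfloor>real n * u\<rfloor>"]) (auto simp: nat_less_iff floor_less_iff)
    qed
    obtain i j where ij: "i < n" "\<lfloor>real n * s\<rfloor> = int i" "j < n" "\<lfloor>real n * t\<rfloor> = int j"
      using fl st by meson
    have "dart_curve M (W ! i) (frac (real n * s)) = dart_curve M (W ! j) (frac (real n * t))"
      using eq ij by (simp add: walk_curve_def n_def Let_def)
    moreover have "fst (W ! i) = fst (W ! j) \<longleftrightarrow> i = j" "snd (W ! i) = snd (W ! j) \<longleftrightarrow> i = j"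
      using nth_eq_iff_index_eq[OF dist(1), of i j] nth_eq_iff_index_eq[OF dist(2), of i j] ij
      by (auto simp: n_def)
    ultimately have "i = j \<and> frac (real n * s) = frac (real n * t)"
      using dart_curve_eq[OF dart[OF ij(1)] dart[OF ij(3)], of "frac (real n * s)" "frac (real n * t)"]
      by (auto simp: frac_lt_1)
    then have "real n * s = real n * t" using ij by (auto simp: frac_def)
    then show "s = t" using n by simp
  qed
  ultimately show ?thesis by (simp add: simple_closed_curve_def)
qed

end

section \<open>The projective plane and its gnomonic charts\<close>

lemma rp2_of_eq_iff:
  assumes "norm x = 1" "norm y = 1"
  shows "rp2_of x = rp2_of y \<longleftrightarrow> x = y \<or> x = - y"
proof -
  have "{x, - x} \<in> {{x, - x} | x :: real^3. norm x = 1}" "{y, - y} \<in> {{x, - x} | x :: real^3. norm x = 1}"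
    using assms by blast+
  then have "rp2_of x = rp2_of y \<longleftrightarrow> {x, - x} = {y, - y}"
    unfolding rp2_of_def by (rule Abs_rp2_inject)
  then show ?thesis by (auto simp: doubleton_eq_iff)
qed

lemma rp2_of_minus: "norm x = 1 \<Longrightarrow> rp2_of (- x) = rp2_of x"
  by (subst rp2_of_eq_iff) auto

lemma rp2_exhaust: obtains x where "norm x = 1" "p = rp2_of x"
proof -
  have "Rep_rp2 p \<in> {{x, - x} | x :: real^3. norm x = 1}" by (rule Rep_rp2)
  then obtain x where "norm x = 1" "Rep_rp2 p = {x, - x}" by blast
  then show thesis using that[of x] Rep_rp2_inverse[of p] by (simp add: rp2_of_def)
qed

lemma open_rp2_iff: "open U \<longleftrightarrow> openin (top_of_set (sphere 0 1)) {x \<in> sphere 0 1. rp2_of x \<in> U}"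
  by (simp add: open_rp2_def)

lemma continuous_on_rp2_of: "continuous_on (sphere 0 1) rp2_of"
proof -
  have "openin (top_of_set (sphere 0 1)) (sphere 0 1 \<inter> rp2_of -` U)" if "open U" for U
  proof -
    have "sphere 0 1 \<inter> rp2_of -` U = {x \<in> sphere 0 1. rp2_of x \<in> U}" by blast
    then show ?thesis using that unfolding open_rp2_iff by (simp only:)
  qed
  then show ?thesis
    using continuous_on_open_gen[of rp2_of "sphere 0 1" UNIV] by simp
qed

lemma continuous_on_rp2:
  fixes f :: "rp2 \<Rightarrow> 'a::topological_space"
  assumes "open A" "continuous_on {x \<in> sphere 0 1. rp2_of x \<in> A} (f \<circ> rp2_of)"
  shows "continuous_on A f"
  unfolding continuous_on_open_vimage[OF assms(1)]
proof (intro allI impI)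
  fix B :: "'a set" assume "open B"
  let ?S = "{x \<in> sphere 0 1. rp2_of x \<in> A}"
  have "openin (top_of_set ?S) (?S \<inter> (f \<circ> rp2_of) -` B)"
    using assms(2) \<open>open B\<close> by (rule continuous_openin_preimage_gen)
  moreover have "openin (top_of_set (sphere 0 1)) ?S" using assms(1) open_rp2_iff by blast
  ultimately have "openin (top_of_set (sphere 0 1)) (?S \<inter> (f \<circ> rp2_of) -` B)" by (rule openin_trans)
  moreover have "?S \<inter> (f \<circ> rp2_of) -` B = {x \<in> sphere 0 1. rp2_of x \<in> f -` B \<inter> A}" by auto
  ultimately show "open (f -` B \<inter> A)" unfolding open_rp2_iff by simp
qed

text \<open>For a unit vector \<open>x\<close> over \<open>p\<close>, the function \<open>(inner x z)\<^sup>2\<close> of \<open>z\<close> does not distinguish antipodal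
  points and attains the value 1 only at \<open>\<plusminus>x\<close>.\<close>

lemma rp2_separation:
  fixes p q :: rp2
  assumes "p \<noteq> q"
  obtains f :: "rp2 \<Rightarrow> real" where "continuous_on UNIV f" "f p \<noteq> f q"
proof -
  obtain x where x: "norm x = 1" "p = rp2_of x" by (rule rp2_exhaust)
  obtain y where y: "norm y = 1" "q = rp2_of y" by (rule rp2_exhaust)
  define f where "f r = (inner x (SOME z. norm z = 1 \<and> rp2_of z = r))\<^sup>2" for r
  have f: "f (rp2_of z) = (inner x z)\<^sup>2" if "norm z = 1" for z
  proof -
    let ?z = "SOME w. norm w = 1 \<and> rp2_of w = rp2_of z"
    have "norm ?z = 1 \<and> rp2_of ?z = rp2_of z" by (rule someI) (use that in simp)
    then have "?z = z \<or> ?z = - z" using that rp2_of_eq_iff by blast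
    then show ?thesis by (auto simp: f_def)
  qed
  have "continuous_on UNIV f"
  proof (rule continuous_on_rp2)
    have "continuous_on {z \<in> sphere 0 1. rp2_of z \<in> UNIV} (\<lambda>z. (inner x z)\<^sup>2)"
      by (intro continuous_intros)
    then show "continuous_on {z \<in> sphere 0 1. rp2_of z \<in> UNIV} (f \<circ> rp2_of)"
      by (rule continuous_on_eq) (simp add: f)
  qed simp
  moreover have "f p \<noteq> f q"
  proof
    assume "f p = f q"
    then have "(inner x y)\<^sup>2 = 1" using x y by (simp add: f power2_norm_eq_inner[symmetric] dot_square_norm)
    then have "inner x y = 1 \<or> inner x y = -1" by (simp add: power2_eq_1_iff)
    moreover have "inner x x = 1" "inner y y = 1" using x(1) y(1) by (simp_all add: dot_square_norm)
    ultimately have "inner (x - y) (x - y) = 0 \<or> inner (x + y) (x + y) = 0"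
      by (auto simp: inner_diff inner_add inner_commute[of y x])
    then have "x = y \<or> x = - y" by (auto simp: eq_neg_iff_add_eq_0)
    then show False using assms x y rp2_of_eq_iff by blast
  qed
  ultimately show thesis by (rule that)
qed

instance rp2 :: t2_space
proof
  fix p q :: rp2 assume "p \<noteq> q"
  then obtain f :: "rp2 \<Rightarrow> real" where f: "continuous_on UNIV f" "f p \<noteq> f q" by (rule rp2_separation)
  then obtain U V where "open U" "open V" "f p \<in> U" "f q \<in> V" "U \<inter> V = {}"
    using hausdorff by metis
  then show "\<exists>U V. open U \<and> open V \<and> p \<in> U \<and> q \<in> V \<and> U \<inter> V = {}"
    using f(1) by (intro exI[of _ "f -` U"] exI[of _ "f -` V"]) (auto simp: open_vimage)
qed

definition positive_frame :: "real^3 \<Rightarrow> real^3 \<Rightarrow> real^3 \<Rightarrow> bool" where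
  "positive_frame a b n \<longleftrightarrow> norm a = 1 \<and> norm b = 1 \<and> norm n = 1 \<and>
     inner a b = 0 \<and> inner a n = 0 \<and> inner b n = 0 \<and> cross3 a b = n"

lemma positive_frame_exists:
  assumes "norm n = 1" obtains a b where "positive_frame a b n"
proof -
  have "n \<noteq> 0" using assms by auto
  then obtain c where c: "cross3 n c \<noteq> 0" using cross_basis_nonzero by blast
  define a where "a = (1 / norm (cross3 n c)) *\<^sub>R cross3 n c"
  have a: "norm a = 1" "inner a n = 0" using c by (simp_all add: a_def dot_cross_self)
  define b where "b = cross3 n a"
  have orth: "inner b n = 0" "inner a b = 0" by (simp_all add: b_def dot_cross_self)
  have "(norm b)\<^sup>2 = 1" using a assms by (simp add: b_def norm_cross inner_commute)
  then have "norm b = 1" using power2_eq_iff_nonneg[of "norm b" 1] by simp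
  moreover have "cross3 a b = n"
    using a by (simp add: b_def Lagrange dot_square_norm)
  ultimately show thesis using that a assms orth by (simp add: positive_frame_def)
qed

text \<open>Central projection from the tangent plane at \<open>n\<close>, with coordinates with respect to \<open>a\<close> and \<open>b\<close>, to
  the sphere. It sends the circles around the origin to circles around \<open>n\<close>; the chordal radius of
  the image of a circle of radius \<open>\<rho>\<close> is \<open>chart_radius \<rho>\<close>.\<close>

definition gnomonic_lift :: "real^3 \<Rightarrow> real^3 \<Rightarrow> real^3 \<Rightarrow> complex \<Rightarrow> real^3" where
  "gnomonic_lift a b n z = (1 / sqrt (1 + (cmod z)\<^sup>2)) *\<^sub>R (Re z *\<^sub>R a + Im z *\<^sub>R b + n)"

definition chart_radius :: "real \<Rightarrow> real" where
  "chart_radius \<rho> = sqrt (2 - 2 / sqrt (1 + \<rho>\<^sup>2))"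

lemma sqrt_one_plus_pos: "0 < sqrt (1 + (x::real)\<^sup>2)"
  by (simp add: add_pos_nonneg)

lemma sqrt_one_plus_ge: "1 \<le> sqrt (1 + (x::real)\<^sup>2)"
  by simp

lemma chart_radius_mono:
  assumes "0 \<le> x" "0 \<le> y"
  shows "chart_radius x < chart_radius y \<longleftrightarrow> x < y" "chart_radius x \<le> chart_radius y \<longleftrightarrow> x \<le> y"
proof -
  have "2 / sqrt (1 + y\<^sup>2) < 2 / sqrt (1 + x\<^sup>2) \<longleftrightarrow> x < y" if "0 \<le> x" "0 \<le> y" for x y :: real
  proof -
    have "2 / sqrt (1 + y\<^sup>2) < 2 / sqrt (1 + x\<^sup>2) \<longleftrightarrow> sqrt (1 + x\<^sup>2) < sqrt (1 + y\<^sup>2)"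
      using sqrt_one_plus_pos[of x] sqrt_one_plus_pos[of y] by (simp add: field_simps)
    also have "\<dots> \<longleftrightarrow> x < y"
      using that by (auto intro: power_strict_mono dest: power_less_imp_less_base)
    finally show ?thesis .
  qed
  then have "chart_radius x < chart_radius y \<longleftrightarrow> x < y" if "0 \<le> x" "0 \<le> y" for x y
    using that by (simp add: chart_radius_def)
  from this[OF assms] this[OF assms(2,1)]
  show "chart_radius x < chart_radius y \<longleftrightarrow> x < y" "chart_radius x \<le> chart_radius y \<longleftrightarrow> x \<le> y"
    by auto
qed

lemma chart_radius_bounds:
  assumes "0 < \<rho>" "\<rho> \<le> 1" shows "0 < chart_radius \<rho>" "chart_radius \<rho> < 1"
proof -
  show "0 < chart_radius \<rho>" using chart_radius_mono(1)[of 0 \<rho>] assms by (simp add: chart_radius_def)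
  have "sqrt (1 + \<rho>\<^sup>2) \<le> sqrt 2" using assms power_le_one[of \<rho> 2] by simp
  also have "sqrt 2 < 2" by (rule real_less_lsqrt) auto
  finally have "1 < 2 / sqrt (1 + \<rho>\<^sup>2)" using sqrt_one_plus_pos[of \<rho>] by (simp add: field_simps)
  then show "chart_radius \<rho> < 1" by (simp add: chart_radius_def)
qed

(* The lift is named by a variable, so that the results below are stated in terms of a single
   function of a complex argument. *)
context
  fixes a b n :: "real^3" and s :: "complex \<Rightarrow> real^3"
  assumes fr: "positive_frame a b n" and s_eq: "s = gnomonic_lift a b n"
begin

lemma frame_inner: "inner a a = 1" "inner b b = 1" "inner n n = 1" "inner a b = 0" "inner b a = 0"
  "inner a n = 0" "inner n a = 0" "inner b n = 0" "inner n b = 0" "cross3 a b = n"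
  using fr by (simp_all add: positive_frame_def dot_square_norm inner_commute)

text \<open>The double cross product \<open>cross3 n (cross3 y n)\<close> is the component of \<open>y\<close> orthogonal to \<open>n\<close>.\<close>

lemma frame_expansion: "y = inner y a *\<^sub>R a + inner y b *\<^sub>R b + inner y n *\<^sub>R n"
proof -
  have "cross3 n (cross3 y n) = y - inner y n *\<^sub>R n"
    by (simp add: Lagrange frame_inner inner_commute)
  moreover have "cross3 y n = inner y b *\<^sub>R a - inner y a *\<^sub>R b"
    unfolding frame_inner(10)[symmetric] Lagrange ..
  moreover have "cross3 n a = b" "cross3 n b = - a"
  proof -
    have "cross3 a n = - b" "cross3 b n = a"
      unfolding frame_inner(10)[symmetric] Lagrange by (simp_all add: frame_inner)
    then show "cross3 n a = b" "cross3 n b = - a"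
      using cross_skew[of n a] cross_skew[of n b] by simp_all
  qed
  ultimately have "y - inner y n *\<^sub>R n = inner y b *\<^sub>R b + inner y a *\<^sub>R a"
    by (simp add: Cross3.right_diff_distrib cross_mult_right)
  then show ?thesis by (simp add: algebra_simps)
qed

lemma inner_lift:
  "inner (s z) a = Re z / sqrt (1 + (cmod z)\<^sup>2)" "inner (s z) b = Im z / sqrt (1 + (cmod z)\<^sup>2)"
  "inner (s z) n = 1 / sqrt (1 + (cmod z)\<^sup>2)"
  by (simp_all add: s_eq gnomonic_lift_def inner_add frame_inner)

lemma norm_lift: "norm (s z) = 1"
proof -
  have "(norm (Re z *\<^sub>R a + Im z *\<^sub>R b + n))\<^sup>2 = 1 + (cmod z)\<^sup>2"
    unfolding cmod_power2 power2_norm_eq_inner[where 'a = "real^3"]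
    by (simp add: inner_add frame_inner power2_eq_square)
  then have "norm (Re z *\<^sub>R a + Im z *\<^sub>R b + n) = sqrt (1 + (cmod z)\<^sup>2)"
    by (metis norm_ge_zero real_sqrt_unique)
  then show ?thesis using sqrt_one_plus_pos[of "cmod z"] by (simp add: s_eq gnomonic_lift_def)
qed

lemma lift_0: "s 0 = n"
  by (simp add: s_eq gnomonic_lift_def)

lemma continuous_on_lift: "continuous_on A s"
proof -
  have "sqrt (1 + (cmod z)\<^sup>2) \<noteq> 0" for z using sqrt_one_plus_pos[of "cmod z"] by simp
  then show ?thesis unfolding s_eq gnomonic_lift_def by (intro continuous_intros) auto
qed

lemma continuous_on_chart: "continuous_on A (rp2_of \<circ> s)"
  by (rule continuous_on_compose[OF continuous_on_lift continuous_on_subset[OF continuous_on_rp2_of]])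
    (auto simp: norm_lift)

lemma inj_chart: "inj (rp2_of \<circ> s)"
proof (rule injI)
  fix z w assume "(rp2_of \<circ> s) z = (rp2_of \<circ> s) w"
  then have e: "s z = s w \<or> s z = - s w" using rp2_of_eq_iff norm_lift by simp
  have "s z \<noteq> - s w"
  proof
    assume "s z = - s w"
    then have "inner (s z) n = - inner (s w) n" by simp
    moreover have "0 < inner (s u) n" for u using sqrt_one_plus_pos[of "cmod u"] by (simp add: inner_lift)
    ultimately show False by (metis neg_0_less_iff_less less_asym)
  qed
  then have e: "s z = s w" using e by blast
  then have "inner (s z) n = inner (s w) n" by simp
  then have t: "sqrt (1 + (cmod z)\<^sup>2) = sqrt (1 + (cmod w)\<^sup>2)"
    unfolding inner_lift by simp
  have "inner (s z) a = inner (s w) a" "inner (s z) b = inner (s w) b" using e by simp_all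
  then show "z = w"
    unfolding inner_lift t using sqrt_one_plus_pos[of "cmod w"] by (simp add: complex_eq_iff)
qed

lemma dist_lift: "dist n (s z) = chart_radius (cmod z)"
proof -
  have "(dist n (s z))\<^sup>2 = 2 - 2 * inner (s z) n"
    unfolding dist_norm power2_norm_eq_inner
    using norm_lift[of z] by (simp add: inner_diff frame_inner inner_commute norm_eq_1)
  then have "dist n (s z) = sqrt (2 - 2 * inner (s z) n)"
    by (metis zero_le_dist real_sqrt_unique)
  then show ?thesis by (simp add: inner_lift chart_radius_def)
qed

lemma lift_surj:
  assumes "norm y = 1" "0 < inner y n" obtains z where "y = s z"
proof -
  let ?t = "inner y n"
  define z where "z = Complex (inner y a / ?t) (inner y b / ?t)"
  have "1 = inner y y" using assms by (simp add: dot_square_norm)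
  also have "\<dots> = (inner y a)\<^sup>2 + (inner y b)\<^sup>2 + ?t\<^sup>2"
    by (subst (2) frame_expansion[of y]) (simp add: inner_add power2_eq_square)
  finally have one: "(inner y a)\<^sup>2 + (inner y b)\<^sup>2 + ?t\<^sup>2 = 1" by simp
  have "1 + (cmod z)\<^sup>2 = ((inner y a)\<^sup>2 + (inner y b)\<^sup>2 + ?t\<^sup>2) / ?t\<^sup>2"
    using assms(2) by (simp add: z_def cmod_power2 power_divide field_simps)
  then have "1 + (cmod z)\<^sup>2 = (1 / ?t)\<^sup>2" using one by (simp add: power_divide)
  then have "sqrt (1 + (cmod z)\<^sup>2) = 1 / ?t" using assms(2) by simp
  then have "s z = ?t *\<^sub>R ((inner y a / ?t) *\<^sub>R a + (inner y b / ?t) *\<^sub>R b + n)"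
    by (simp add: s_eq gnomonic_lift_def z_def)
  also have "\<dots> = inner y a *\<^sub>R a + inner y b *\<^sub>R b + ?t *\<^sub>R n"
    using assms(2) by (simp add: scaleR_add_right)
  also have "\<dots> = y" using frame_expansion[of y] by simp
  finally show thesis using that by metis
qed

lemma discs_chart:
  assumes "0 < \<rho>"
  shows "disc_at n (chart_radius \<rho>) = (rp2_of \<circ> s) ` ball 0 \<rho>"
    "closed_disc_at n (chart_radius \<rho>) = (rp2_of \<circ> s) ` cball 0 \<rho>"
proof -
  have ex: "\<exists>z. y = s z" if "norm y = 1" "dist n y \<le> chart_radius \<rho>" for y
  proof -
    have "(dist n y)\<^sup>2 = 2 - 2 * inner y n"
      unfolding dist_norm power2_norm_eq_inner
      using that(1) by (simp add: inner_diff frame_inner inner_commute norm_eq_1)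
    moreover have "(dist n y)\<^sup>2 \<le> (chart_radius \<rho>)\<^sup>2" using that(2) by (intro power_mono) auto
    moreover have "(chart_radius \<rho>)\<^sup>2 < 2"
      using sqrt_one_plus_pos[of \<rho>] sqrt_one_plus_ge[of \<rho>] by (simp add: chart_radius_def field_simps)
    ultimately have "0 < inner y n" by linarith
    then show ?thesis using lift_surj that(1) by metis
  qed
  have 1: "{y \<in> sphere 0 1. dist n y < chart_radius \<rho>} = s ` ball 0 \<rho>"
  proof (intro equalityI subsetI)
    fix y assume y: "y \<in> {y \<in> sphere 0 1. dist n y < chart_radius \<rho>}"
    then obtain z where "y = s z" using ex by force
    then show "y \<in> s ` ball 0 \<rho>" using y assms chart_radius_mono by (auto simp: dist_lift)
  qed (use assms chart_radius_mono in \<open>auto simp: norm_lift dist_lift\<close>)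
  have 2: "{y \<in> sphere 0 1. dist n y \<le> chart_radius \<rho>} = s ` cball 0 \<rho>"
  proof (intro equalityI subsetI)
    fix y assume y: "y \<in> {y \<in> sphere 0 1. dist n y \<le> chart_radius \<rho>}"
    then obtain z where "y = s z" using ex by force
    then show "y \<in> s ` cball 0 \<rho>" using y assms chart_radius_mono by (auto simp: dist_lift)
  qed (use assms chart_radius_mono in \<open>auto simp: norm_lift dist_lift\<close>)
  show "disc_at n (chart_radius \<rho>) = (rp2_of \<circ> s) ` ball 0 \<rho>"
    "closed_disc_at n (chart_radius \<rho>) = (rp2_of \<circ> s) ` cball 0 \<rho>"
    by (simp_all only: disc_at_def closed_disc_at_def 1 2 image_comp)
qed

text \<open>The lift restricted to a circle around the origin is a similarity into a plane orthogonal to \<open>n\<close>,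
  and it preserves the orientation, as \<open>a\<close>, \<open>b\<close>, \<open>n\<close> is a positive frame.\<close>

lemma counterclockwise_lift:
  assumes "cmod z1 = \<rho>" "cmod z2 = \<rho>" "cmod z3 = \<rho>"
  shows "counterclockwise n (s z1) (s z2) (s z3) \<longleftrightarrow> 0 < Im (cnj (z2 - z1) * (z3 - z1))"
proof -
  define t where "t = 1 / sqrt (1 + \<rho>\<^sup>2)"
  have t: "0 < t" using sqrt_one_plus_pos by (simp add: t_def)
  have d: "s z - s w = t *\<^sub>R (Re (z - w) *\<^sub>R a + Im (z - w) *\<^sub>R b)" if "cmod z = \<rho>" "cmod w = \<rho>" for z w
    using that by (simp add: s_eq gnomonic_lift_def t_def algebra_simps)
  have c: "inner n (cross3 (x *\<^sub>R a + y *\<^sub>R b) (x' *\<^sub>R a + y' *\<^sub>R b)) = x * y' - y * x'" for x y x' y'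
    using cross_skew[of b a]
    by (simp add: cross_add_left cross_add_right cross_mult_left cross_mult_right frame_inner inner_add inner_diff)
  have "inner n (cross3 (s z2 - s z1) (s z3 - s z1)) = t * t * Im (cnj (z2 - z1) * (z3 - z1))"
    unfolding d[OF assms(2,1)] d[OF assms(3,1)] cross_mult_left cross_mult_right
    by (simp add: c) (simp add: algebra_simps)
  then show ?thesis using t by (simp add: counterclockwise_def zero_less_mult_iff)
qed

end

lemma open_disc_at:
  assumes "norm n = 1" shows "open (disc_at n r)"
proof -
  have "{x \<in> sphere 0 1. rp2_of x \<in> disc_at n r} = sphere 0 1 \<inter> (ball n r \<union> uminus -` ball n r)"
    (is "?L = ?R")
  proof (intro equalityI subsetI)
    fix x assume "x \<in> ?L"
    then obtain y where "norm x = 1" "norm y = 1" "dist n y < r" "rp2_of x = rp2_of y"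
      by (auto simp: disc_at_def)
    then show "x \<in> ?R" using rp2_of_eq_iff[of x y] by auto
  next
    fix x assume "x \<in> ?R"
    then have x: "norm x = 1" "dist n x < r \<or> dist n (- x) < r" by auto
    then obtain y where "norm y = 1" "dist n y < r" "rp2_of y = rp2_of x"
      using rp2_of_minus[OF x(1)] by (metis norm_minus_cancel)
    then have "rp2_of x \<in> disc_at n r" unfolding disc_at_def by (intro image_eqI[of _ _ y]) auto
    then show "x \<in> ?L" using x(1) by simp
  qed
  moreover have "open (ball n r \<union> uminus -` ball n r)"
    by (intro open_Un open_ball open_vimage continuous_intros)
  ultimately show ?thesis unfolding open_rp2_iff by (metis openin_open_Int)
qed

section \<open>The points and arcs of a line\<close>

text \<open>The points of \<open>P\<close> on the line \<open>l\<close> and the arcs between them in cyclic order: the arc \<open>a i\<close> leads from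
  \<open>p i\<close> to the next point.\<close>

definition line_cycle ::
    "rp2 set \<Rightarrow> rp2 set \<Rightarrow> nat \<Rightarrow> (nat \<Rightarrow> rp2) \<Rightarrow> (nat \<Rightarrow> rp2 set) \<Rightarrow> bool" where
  "line_cycle P l k p a \<longleftrightarrow> 2 \<le> k \<and> inj_on p {..<k} \<and> p ` {..<k} = P \<inter> l \<and>
     inj_on a {..<k} \<and> a ` {..<k} = line_arcs P l \<and> \<Union> (a ` {..<k}) = l \<and>
     (\<forall>i<k. a i \<inter> P = {p i, p (Suc i mod k)}) \<and> (\<forall>i<k. \<forall>j<k. i \<noteq> j \<longrightarrow> a i \<inter> a j \<subseteq> P)"

lemma loop_inj:
  assumes "simple_path g" "s \<in> {0..1}" "s' \<in> {0..1}" "g s = g s'"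
  shows "s = s' \<or> s = 0 \<and> s' = 1 \<or> s = 1 \<and> s' = 0"
  using assms by (auto simp: simple_path_def loop_free_def)

lemma arc_piece:
  fixes g :: "real \<Rightarrow> 'a::t2_space"
  assumes g: "simple_path g" and uv: "0 \<le> u" "u < v" "v \<le> 1" "u \<noteq> 0 \<or> v \<noteq> 1"
  obtains h where "arc h" "path_image h = g ` {u..v}" "pathstart h = g u" "pathfinish h = g v"
proof -
  let ?f = "\<lambda>s. (v - u) * s + u"
  have im: "?f ` {0..1} = {u..v}"
    using uv by (subst image_affinity_atLeastAtMost) auto
  have "continuous_on {0..1} (g \<circ> ?f)"
  proof (rule continuous_on_compose)
    show "continuous_on (?f ` {0..1}) g"
      using g uv unfolding im simple_path_def path_def by (auto intro: continuous_on_subset)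
  qed (intro continuous_intros)
  moreover have "inj_on (g \<circ> ?f) {0..1}"
  proof (rule inj_onI)
    fix x y :: real assume xy: "x \<in> {0..1}" "y \<in> {0..1}" "(g \<circ> ?f) x = (g \<circ> ?f) y"
    then have "?f x \<in> {u..v}" "?f y \<in> {u..v}" using im by blast+
    moreover from this have "?f x = ?f y \<or> ?f x = 0 \<and> ?f y = 1 \<or> ?f x = 1 \<and> ?f y = 0"
      using xy uv by (intro loop_inj[OF g]) auto
    ultimately have "?f x = ?f y" using uv by auto
    then show "x = y" using uv by simp
  qed
  ultimately have "arc (g \<circ> ?f)" by (simp add: arc_def path_def)
  moreover have "path_image (g \<circ> ?f) = g ` {u..v}" using im by (simp only: path_image_def image_comp[symmetric])
  ultimately show thesis by (rule that) (simp_all add: pathstart_def pathfinish_def)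
qed

lemma arc_between_ends_unique:
  fixes h :: "real \<Rightarrow> 'a::t2_space"
  assumes "arc h" "connected C" "C \<subseteq> path_image h" "pathstart h \<in> C" "pathfinish h \<in> C"
  shows "C = path_image h"
proof -
  obtain k where k: "homeomorphism {0..1} (path_image h) h k" using homeomorphism_arc[OF assms(1)] .
  have "continuous_on C k" using k assms(3) by (auto simp: homeomorphism_def intro: continuous_on_subset)
  then have "connected (k ` C)" using assms(2) by (rule connected_continuous_image)
  moreover have "k (h 0) = 0" "k (h 1) = 1" using k by (auto simp: homeomorphism_def)
  then have "0 \<in> k ` C" "1 \<in> k ` C" using assms(4,5) by (auto simp: pathstart_def pathfinish_def intro: image_eqI[rotated])
  ultimately have "{0..1} \<subseteq> k ` C" using connected_contains_Icc by blast
  then have "h ` {0..1} \<subseteq> h ` k ` C" by blast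
  moreover have "h (k x) = x" if "x \<in> C" for x using k assms(3) that by (auto simp: homeomorphism_def)
  then have "h ` k ` C = C" by (simp add: image_image)
  ultimately show ?thesis using assms(3) by (auto simp: path_image_def)
qed

text \<open>The parameters of the points of \<open>P\<close> cut \<open>{0..1}\<close> into intervals, whose images are arcs of the line.
  There are no other ones: an arc without points of \<open>P\<close> in its interior has a connected interior,
  which is covered by the finitely many closed arcs \<open>a i\<close>. These meet only in points of \<open>P\<close>, so that
  one of them contains the interior, and it has the same ends as the given arc.\<close>

lemma line_cycle_start:
  assumes g: "simple_path g" "pathfinish g = pathstart g" "path_image g = l"
    and P: "finite P" "2 \<le> card (P \<inter> l)" "pathstart g \<in> P"
  obtains k p a where "line_cycle P l k p a" "p 0 = pathstart g"
proof -
  define S where "S = {s \<in> {0..1}. g s \<in> P}"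
  have g01: "g 0 = g 1" "g 0 \<in> P" using g P by (auto simp: pathstart_def pathfinish_def)
  have inj: "inj_on g {0..<1}"
    by (rule inj_onI) (use loop_inj[OF g(1)] in force)
  have S: "S = insert 1 (S \<inter> {0..<1})" using g01 by (auto simp: S_def)
  have "finite (g ` (S \<inter> {0..<1}))" using P(1) by (rule finite_subset[rotated]) (auto simp: S_def)
  then have fin1: "finite (S \<inter> {0..<1})"
    by (rule finite_imageD) (rule inj_on_subset[OF inj], auto)
  then have fin: "finite S" by (subst S) simp
  have gS: "g ` (S \<inter> {0..<1}) = P \<inter> l"
  proof (intro equalityI subsetI)
    fix x assume "x \<in> P \<inter> l"
    then obtain s where s: "s \<in> {0..1}" "x = g s" "x \<in> P" using g(3) by (auto simp: path_image_def)
    show "x \<in> g ` (S \<inter> {0..<1})"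
    proof (cases "s = 1")
      case True
      then show ?thesis using s g01 by (intro image_eqI[of _ _ 0]) (auto simp: S_def)
    qed (use s in \<open>auto simp: S_def\<close>)
  qed (use g(3) in \<open>auto simp: S_def path_image_def\<close>)
  define k where "k = card (S \<inter> {0..<1})"
  have k: "2 \<le> k"
    using P(2) card_image[OF inj_on_subset[OF inj], of "S \<inter> {0..<1}"] by (simp add: gS k_def)
  have cardS: "card S = Suc k" unfolding k_def by (subst S) (use fin1 in auto)
  define xs where "xs = sorted_list_of_set S"
  define t where "t i = xs ! i" for i
  have xs: "sorted_wrt (<) xs" "set xs = S" "length xs = Suc k"
    using fin cardS by (simp_all add: xs_def)
  have mono: "t i < t j" if "i < j" "j \<le> k" for i j
    using sorted_wrt_nth_less[OF xs(1), of i j] that xs(3) by (simp add: t_def)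
  \<comment> \<open>\<open>S\<close> contains both 0 and 1, so the \<open>k\<close> points of the line have \<open>k + 1\<close> parameters.\<close>
  have tS: "t ` {..k} = S"
    using xs by (auto simp: t_def in_set_conv_nth less_Suc_eq_le image_iff set_conv_nth)
  have t_in: "t i \<in> {0..1}" "g (t i) \<in> P" if "i \<le> k" for i
  proof -
    have "t i \<in> S" using tS that by blast
    then show "t i \<in> {0..1}" "g (t i) \<in> P" by (auto simp: S_def)
  qed
  have mono_le: "t i \<le> t j" if "i \<le> j" "j \<le> k" for i j
    using mono[of i j] that by (cases "i = j") auto
  have "0 \<in> S" "1 \<in> S" using g01 by (auto simp: S_def)
  then obtain i0 i1 where "i0 \<le> k" "t i0 = 0" "i1 \<le> k" "t i1 = 1" using tS by (metis atMost_iff imageE)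
  then have t0: "t 0 = 0" and tk: "t k = 1"
    using mono_le[of 0 i0] mono_le[of i1 k] t_in[of 0] t_in[of k] by auto
  have t_index: "s = t i \<or> s = t (Suc i)" if "i < k" "t i \<le> s" "s \<le> t (Suc i)" "g s \<in> P" for s i
  proof -
    have "s \<in> S" using that t_in[of i] t_in[of "Suc i"] by (auto simp: S_def)
    then obtain j where j: "j \<le> k" "s = t j" using tS by blast
    then have "\<not> j < i" "\<not> Suc i < j" using mono[of j i] mono[of "Suc i" j] that by auto
    then have "j = i \<or> j = Suc i" by linarith
    then show ?thesis using j by auto
  qed
  define p where "p i = g (t i)" for i
  define a where "a i = g ` {t i..t (Suc i)}" for i
  have p_mod: "p (Suc i mod k) = g (t (Suc i))" if "i < k" for i
    using that g01 t0 tk by (cases "Suc i = k") (auto simp: p_def)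
  have t_lt1: "t i < 1" if "i < k" for i using mono[of i k] that tk by simp
  have p_inj: "inj_on p {..<k}"
  proof (rule linorder_inj_onI)
    fix i j assume ij: "i < j" "i \<in> {..<k}" "j \<in> {..<k}"
    show "p i \<noteq> p j"
    proof
      assume "p i = p j"
      then have "t i = t j"
        using ij t_in[of i] t_in[of j] t_lt1[of i] t_lt1[of j] by (intro inj_onD[OF inj]) (auto simp: p_def)
      then show False using mono[of i j] ij by simp
    qed
  qed auto
  have p_im: "p ` {..<k} = P \<inter> l"
  proof -
    have "p ` {..<k} \<subseteq> P \<inter> l" using t_in g(3) by (auto simp: p_def path_image_def)
    moreover have "card (p ` {..<k}) = k" using p_inj by (simp add: card_image)
    moreover have "card (P \<inter> l) = k"
      using card_image[OF inj_on_subset[OF inj], of "S \<inter> {0..<1}"] by (simp add: gS k_def)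
    ultimately show ?thesis using P(1) by (metis card_subset_eq finite_Int)
  qed
  have aP: "a i \<inter> P = {p i, p (Suc i mod k)}" if "i < k" for i
    unfolding p_mod[OF that]
  proof (intro equalityI subsetI)
    fix x assume "x \<in> a i \<inter> P"
    then obtain s where "x = g s" "t i \<le> s" "s \<le> t (Suc i)" "g s \<in> P" by (auto simp: a_def)
    then show "x \<in> {p i, g (t (Suc i))}" using t_index[OF that] unfolding p_def by blast
  next
    fix x assume "x \<in> {p i, g (t (Suc i))}"
    then show "x \<in> a i \<inter> P"
      using t_in[of i] t_in[of "Suc i"] that mono_le[of i "Suc i"] by (auto simp: a_def p_def)
  qed
  have aa: "a i \<inter> a j \<subseteq> P" if "i < j" "j < k" for i j
  proof
    fix x assume x: "x \<in> a i \<inter> a j"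
    then have "x \<in> a i" "x \<in> a j" by simp_all
    from \<open>x \<in> a i\<close> obtain s where s: "x = g s" "t i \<le> s" "s \<le> t (Suc i)" by (auto simp: a_def)
    from \<open>x \<in> a j\<close> obtain s' where s': "x = g s'" "t j \<le> s'" "s' \<le> t (Suc j)"
      by (auto simp: a_def)
    have "t (Suc i) \<le> t j" using that mono_le by auto
    have "s \<in> {0..1}" "s' \<in> {0..1}" using s s' t_in[of i] t_in[of "Suc i"] t_in[of j] t_in[of "Suc j"] that by auto
    then have "s = s' \<or> s = 0 \<or> s = 1" using loop_inj[OF g(1)] s(1) s'(1) by metis
    then have "s = t j \<or> s = 0 \<or> s = 1" using s s' \<open>t (Suc i) \<le> t j\<close> by auto
    then show "x \<in> P" using s(1) g01 t_in that by auto
  qed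
  have aa': "a i \<inter> a j \<subseteq> P" if "i < k" "j < k" "i \<noteq> j" for i j
    using aa[of i j] aa[of j i] that by (cases "i < j") auto
  have arcs: "\<exists>h. arc h \<and> path_image h = a i \<and> pathstart h = p i \<and> pathfinish h = p (Suc i mod k)" if "i < k" for i
  proof -
    have "t i \<noteq> 0 \<or> t (Suc i) \<noteq> 1"
    proof (rule ccontr)
      assume "\<not> ?thesis"
      then have "i = 0" "Suc i = k" using mono[of 0 i] mono[of "Suc i" k] that t0 tk by (cases "i = 0"; cases "Suc i = k"; auto)+
      then show False using k by simp
    qed
    moreover have "0 \<le> t i" "t i < t (Suc i)" "t (Suc i) \<le> 1"
      using that mono[of i "Suc i"] t_in[of i] t_in[of "Suc i"] by auto
    ultimately obtain h where "arc h" "path_image h = g ` {t i..t (Suc i)}" "pathstart h = g (t i)" "pathfinish h = g (t (Suc i))"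
      using arc_piece[OF g(1)] by metis
    then show ?thesis using p_mod[OF that] by (auto simp: a_def p_def)
  qed
  have a_cover: "\<Union> (a ` {..<k}) = l"
  proof -
    have "{t 0..t j} \<subseteq> (\<Union>i<j. {t i..t (Suc i)})" if "j \<le> k" "0 < j" for j
      using that
    proof (induction j)
      case (Suc j)
      show ?case
      proof (cases "j = 0")
        case False
        have "{t 0..t (Suc j)} \<subseteq> {t 0..t j} \<union> {t j..t (Suc j)}" by auto
        then show ?thesis using Suc False by (auto simp: lessThan_Suc)
      qed auto
    qed simp
    from this[of k] have "{0..1} \<subseteq> (\<Union>i<k. {t i..t (Suc i)})" using t0 tk k by simp
    moreover have "{t i..t (Suc i)} \<subseteq> {0..1}" if "i < k" for i using t_in[of i] t_in[of "Suc i"] that by auto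
    ultimately have "{0..1} = (\<Union>i<k. {t i..t (Suc i)})" by blast
    then show ?thesis using g(3) by (simp add: path_image_def a_def image_UN)
  qed
  have a_inj: "inj_on a {..<k}"
  proof (rule inj_onI, rule ccontr)
    fix i j assume ij: "i \<in> {..<k}" "j \<in> {..<k}" "a i = a j" "i \<noteq> j"
    let ?m = "(t i + t (Suc i)) / 2"
    have "t i < t (Suc i)" using mono ij by simp
    then have "g ?m \<in> a i" by (auto simp: a_def)
    then have "g ?m \<in> P" using aa'[of i j] ij by auto
    then show False using t_index[of i ?m] ij \<open>t i < t (Suc i)\<close> by auto
  qed
  have p_neq: "p i \<noteq> p (Suc i mod k)" if "i < k" for i
  proof
    assume "p i = p (Suc i mod k)"
    then have "i = Suc i mod k" using that by (intro inj_onD[OF p_inj]) auto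
    then show False using that k by (cases "Suc i = k") auto
  qed
  have a_im: "a ` {..<k} = line_arcs P l"
  proof (intro equalityI subsetI)
    fix e assume "e \<in> a ` {..<k}"
    then obtain i where i: "i < k" "e = a i" by auto
    obtain h where h: "arc h" "path_image h = a i" "pathstart h = p i" "pathfinish h = p (Suc i mod k)"
      using arcs[OF i(1)] by blast
    have "a i \<subseteq> l" using a_cover i by blast
    then show "e \<in> line_arcs P l"
      unfolding line_arcs_def using h i aP[OF i(1)] by (auto intro!: exI[of _ h])
  next
    fix e assume "e \<in> line_arcs P l"
    then obtain q where q: "arc q" "e = path_image q" "path_image q \<subseteq> l" "pathstart q \<in> P" "pathfinish q \<in> P"
      "path_image q \<inter> P = {pathstart q, pathfinish q}" by (auto simp: line_arcs_def)
    let ?Q = "path_image q - {pathstart q, pathfinish q}"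
    have conn: "connected ?Q" using q(1) by (intro connected_simple_path_endless arc_imp_simple_path)
    have QP: "?Q \<inter> P = {}" using q by blast
    have "q (1/2) \<noteq> q 0" "q (1/2) \<noteq> q 1" using arcD[OF q(1), of "1/2" 0] arcD[OF q(1), of "1/2" 1] by auto
    then have "q (1/2) \<in> ?Q" by (auto simp: path_image_def pathstart_def pathfinish_def)
    then obtain i where i: "i < k" "a i \<inter> ?Q \<noteq> {}" using q(3) a_cover by blast
    let ?R = "\<Union> (a ` ({..<k} - {i}))"
    have closed_a: "closed (a j)" if "j < k" for j
      using arcs[OF that] compact_arc_image compact_imp_closed by metis
    have "a i \<inter> ?Q = {} \<or> ?R \<inter> ?Q = {}"
    proof (rule connected_closedD[OF conn])
      show "a i \<inter> ?R \<inter> ?Q = {}" using aa'[OF i(1)] QP by blast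
      show "?Q \<subseteq> a i \<union> ?R" using q(3) a_cover by blast
      show "closed (a i)" using closed_a i by simp
      show "closed ?R" using closed_a by (intro closed_UN) auto
    qed
    then have "?Q \<subseteq> a i" using i q(3) a_cover by blast
    moreover have "path_image q \<subseteq> closure ?Q"
    proof -
      have "q ` {0..1} = q ` closure {0<..<1}" by simp
      also have "\<dots> \<subseteq> closure (q ` {0<..<1})"
        using q(1) by (intro image_closure_subset closed_closure closure_subset) (simp add: arc_def path_def)
      also have "q ` {0<..<1} \<subseteq> ?Q"
        using arcD[OF q(1)] by (force simp: path_image_def pathstart_def pathfinish_def)
      then have "closure (q ` {0<..<1}) \<subseteq> closure ?Q" by (rule closure_mono)
      finally show ?thesis by (simp add: path_image_def)
    qed
    ultimately have qa: "path_image q \<subseteq> a i"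
      using closure_minimal[OF _ closed_a[OF i(1)]] by blast
    then have "{pathstart q, pathfinish q} \<subseteq> {p i, p (Suc i mod k)}"
      using aP[OF i(1)] q(4,5) by auto
    moreover have "pathstart q \<noteq> pathfinish q" using arc_distinct_ends[OF q(1)] by simp
    ultimately have "{p i, p (Suc i mod k)} = {pathstart q, pathfinish q}" by auto
    then have "{p i, p (Suc i mod k)} \<subseteq> path_image q"
      by (simp add: pathstart_in_path_image pathfinish_in_path_image)
    moreover obtain h where h: "arc h" "path_image h = a i" "pathstart h = p i" "pathfinish h = p (Suc i mod k)"
      using arcs[OF i(1)] by blast
    ultimately have "path_image q = path_image h"
      using qa q(1) by (intro arc_between_ends_unique) (auto simp: connected_arc_image)
    then show "e \<in> a ` {..<k}" using q(2) h(2) i(1) by auto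
  qed
  have "line_cycle P l k p a"
    unfolding line_cycle_def using k p_inj p_im a_inj a_im a_cover aP aa' by auto
  moreover have "p 0 = pathstart g" by (simp add: p_def t0 pathstart_def)
  ultimately show thesis by (rule that)
qed

text \<open>Reversal keeps the first point and makes the last arc the first one.\<close>

lemma line_cycle_reverse:
  assumes c: "line_cycle P l k p a"
  defines "p' \<equiv> \<lambda>i. p ((k - i) mod k)" and "a' \<equiv> \<lambda>i. a (k - 1 - i)"
  shows "line_cycle P l k p' a'"
proof -
  have k: "2 \<le> k" using c by (simp add: line_cycle_def)
  define f where "f i = (k - i) mod k" for i
  define r where "r i = k - 1 - i" for i
  have f: "f i = (if i = 0 then 0 else k - i)" if "i < k" for i using that by (auto simp: f_def)
  have "inj_on f {..<k}" by (rule inj_onI) (auto simp: f split: if_splits)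
  moreover have "f ` {..<k} \<subseteq> {..<k}" using k by (auto simp: f_def)
  ultimately have bf: "bij_betw f {..<k} {..<k}" by (simp add: bij_betw_def endo_inj_surj)
  have "inj_on r {..<k}" by (rule inj_onI) (auto simp: r_def)
  moreover have "r ` {..<k} \<subseteq> {..<k}" using k by (auto simp: r_def)
  ultimately have br: "bij_betw r {..<k} {..<k}" by (simp add: bij_betw_def endo_inj_surj)
  have fr: "f (Suc i mod k) = r i" "Suc (r i) mod k = f i" if "i < k" for i
    using that k by (cases "Suc i = k"; cases "i = 0"; auto simp: f_def r_def)+
  have rk: "r i < k" if "i < k" for i using that by (auto simp: r_def)
  have "inj_on (p \<circ> f) {..<k}" "(p \<circ> f) ` {..<k} = p ` {..<k}"
    "inj_on (a \<circ> r) {..<k}" "(a \<circ> r) ` {..<k} = a ` {..<k}"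
    using bf br c unfolding bij_betw_def line_cycle_def image_comp[symmetric]
    by (simp_all add: comp_inj_on)
  moreover have "p' = p \<circ> f" "a' = a \<circ> r" by (auto simp: p'_def a'_def f_def r_def)
  moreover have "a' i \<inter> P = {p' i, p' (Suc i mod k)}" if "i < k" for i
  proof -
    have "a (r i) \<inter> P = {p (r i), p (Suc (r i) mod k)}" using c rk[OF that] by (simp add: line_cycle_def)
    then show ?thesis using fr[OF that] \<open>p' = _\<close> \<open>a' = _\<close> by auto
  qed
  moreover have "a' i \<inter> a' j \<subseteq> P" if "i < k" "j < k" "i \<noteq> j" for i j
  proof -
    have "r i \<noteq> r j" using br that by (auto simp: bij_betw_def inj_on_def)
    then show ?thesis using c rk that \<open>a' = _\<close> by (simp add: line_cycle_def)
  qed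
  moreover have "\<Union> (a' ` {..<k}) = l"
    using \<open>(a \<circ> r) ` {..<k} = a ` {..<k}\<close> c unfolding \<open>a' = a \<circ> r\<close> line_cycle_def by metis
  ultimately show ?thesis using c unfolding line_cycle_def by metis
qed

lemma line_cycle_arcs_at:
  assumes c: "line_cycle P l k p a" and i: "i < k" and j: "j < k" and "p (Suc i mod k) \<in> a j"
  shows "j = i \<or> j = Suc i mod k"
proof -
  have k: "2 \<le> k" "Suc i mod k < k" "Suc j mod k < k" using c i by (auto simp: line_cycle_def)
  then have "p (Suc i mod k) \<in> P" using c by (auto simp: line_cycle_def)
  then have "p (Suc i mod k) = p j \<or> p (Suc i mod k) = p (Suc j mod k)"
    using assms(4) c j by (auto simp: line_cycle_def)
  then have "Suc i mod k = j \<or> Suc i mod k = Suc j mod k"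
    using k j c by (auto simp: line_cycle_def inj_on_def)
  then show ?thesis using i j by (cases "Suc i = k"; cases "Suc j = k") auto
qed

lemma line_cycle_exists:
  assumes l: "pseudoline l" and P: "finite P" "2 \<le> card (P \<inter> l)" and v: "v \<in> P \<inter> l"
  obtains k p a where "line_cycle P l k p a" "p 0 = v"
proof -
  obtain g where g: "simple_path g" "pathfinish g = pathstart g" "path_image g = l"
    using l by (auto simp: pseudoline_def)
  obtain u where u: "u \<in> {0..1}" "v = g u" using v g(3) by (auto simp: path_image_def)
  obtain k p a where "line_cycle P l k p a" "p 0 = pathstart (shiftpath u g)"
  proof (rule line_cycle_start[of "shiftpath u g" l P])
    show "simple_path (shiftpath u g)" using g u by (intro simple_path_shiftpath) auto
    show "pathfinish (shiftpath u g) = pathstart (shiftpath u g)" using g u by (intro closed_shiftpath)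
    show "path_image (shiftpath u g) = l" using g u by (simp add: path_image_shiftpath)
    show "pathstart (shiftpath u g) \<in> P" using u v by (simp add: pathstart_shiftpath)
  qed (use P in auto)
  then show thesis using u that by (simp add: pathstart_shiftpath)
qed

text \<open>An arc at \<open>v\<close> is the first or the last one of a cycle starting at \<open>v\<close>; in the second case the cycle
  is reversed.\<close>

lemma line_cycle_exists_from:
  assumes l: "pseudoline l" and P: "finite P" "2 \<le> card (P \<inter> l)"
    and e: "e \<in> line_arcs P l" "v \<in> e" "v \<in> P"
  obtains k p a where "line_cycle P l k p a" "p 0 = v" "a 0 = e"
proof -
  have "v \<in> P \<inter> l" using e by (auto simp: line_arcs_def)
  then obtain k p a where c: "line_cycle P l k p a" "p 0 = v" using line_cycle_exists[OF l P] by blast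
  have k: "2 \<le> k" using c by (simp add: line_cycle_def)
  obtain j where j: "j < k" "e = a j" using c e by (auto simp: line_cycle_def)
  have "j = k - 1 \<or> j = Suc (k - 1) mod k"
    using k c e j by (intro line_cycle_arcs_at[OF c(1)]) auto
  then consider "j = 0" | "j = k - 1" using k by auto
  then show thesis
  proof cases
    case 1
    then show thesis using that c j by blast
  next
    case 2
    then show thesis using that[OF line_cycle_reverse[OF c(1)]] c j k by simp
  qed
qed

lemma card_line_arcs_at:
  assumes l: "pseudoline l" and P: "finite P" "2 \<le> card (P \<inter> l)" and v: "v \<in> P \<inter> l"
  shows "card {e \<in> line_arcs P l. v \<in> e} = 2"
proof -
  obtain k p a where c: "line_cycle P l k p a" "p 0 = v" using line_cycle_exists[OF assms] .
  have k: "2 \<le> k" using c by (simp add: line_cycle_def)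
  have "{e \<in> line_arcs P l. v \<in> e} = {a 0, a (k - 1)}"
  proof (intro equalityI subsetI)
    fix e assume e: "e \<in> {e \<in> line_arcs P l. v \<in> e}"
    then obtain j where j: "j < k" "e = a j" using c by (auto simp: line_cycle_def)
    have "j = k - 1 \<or> j = Suc (k - 1) mod k"
      using k c e j by (intro line_cycle_arcs_at[OF c(1)]) auto
    then show "e \<in> {a 0, a (k - 1)}" using j k by auto
  next
    fix e assume "e \<in> {a 0, a (k - 1)}"
    moreover have "a 0 \<in> line_arcs P l" "a (k - 1) \<in> line_arcs P l" using c k by (auto simp: line_cycle_def)
    moreover have "a 0 \<inter> P = {p 0, p (Suc 0 mod k)}" "a (k - 1) \<inter> P = {p (k - 1), p (Suc (k - 1) mod k)}"
      using c k by (auto simp: line_cycle_def)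
    then have "v \<in> a 0" "v \<in> a (k - 1)" using c k by auto
    ultimately show "e \<in> {e \<in> line_arcs P l. v \<in> e}" by auto
  qed
  moreover have "a 0 \<noteq> a (k - 1)"
  proof
    assume "a 0 = a (k - 1)"
    moreover have "inj_on a {..<k}" using c by (simp add: line_cycle_def)
    ultimately have "0 = k - 1" using k by (intro inj_onD[of a "{..<k}"]) auto
    then show False using k by simp
  qed
  ultimately show ?thesis by simp
qed

lemma line_arc_from:
  assumes "e \<in> line_arcs P l" "v \<in> e" "v \<in> P"
  obtains q where "arc q" "path_image q = e" "pathstart q = v" "pathfinish q \<noteq> v" "e \<inter> P = {v, pathfinish q}"
proof -
  obtain g where g: "arc g" "e = path_image g" "path_image g \<inter> P = {pathstart g, pathfinish g}"
    using assms(1) by (auto simp: line_arcs_def)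
  then have "v = pathstart g \<or> v = pathfinish g" using assms by auto
  then show thesis
  proof
    assume "v = pathstart g"
    then show thesis using that[of g] g arc_distinct_ends[OF g(1)] by auto
  next
    assume "v = pathfinish g"
    then show thesis using that[of "reversepath g"] g arc_distinct_ends[OF g(1)] by (auto simp: arc_reversepath)
  qed
qed

section \<open>Crossing curves alternate on a circle\<close>

lemma inside_sphere_complex: "0 < \<rho> \<Longrightarrow> inside (sphere (0::complex) \<rho>) = ball 0 \<rho>"
  using inside_frontier_eq_interior[of "cball (0::complex) \<rho>"] by simp

lemma cis_eq_close:
  assumes "cis s = cis t" "\<bar>s - t\<bar> < 2 * pi" shows "s = t"
proof -
  have "cis (s - t) = 1" using assms(1) by (simp flip: cis_divide)
  then have "cos (s - t) = 1" by (metis Re_complex_of_real cis.sel(1) of_real_1)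
  then obtain n :: int where n: "s - t = of_int n * 2 * pi" using cos_one_2pi_int by blast
  then have "\<bar>of_int n\<bar> * (2 * pi) < 1 * (2 * pi)" using assms(2) by (simp add: abs_mult)
  then have "\<bar>of_int n :: real\<bar> < 1" using pi_gt_zero by (subst (asm) mult_less_cancel_right) auto
  then have "n = 0" by linarith
  then show ?thesis using n by simp
qed

text \<open>An arc from the centre of a disc to the point at the angle \<open>\<alpha>\<close> of the boundary circle that meets the
  circle only there.\<close>

definition spoke :: "real \<Rightarrow> real \<Rightarrow> (real \<Rightarrow> complex) \<Rightarrow> bool" where
  "spoke \<rho> \<alpha> \<gamma> \<longleftrightarrow> arc \<gamma> \<and> pathstart \<gamma> = 0 \<and> pathfinish \<gamma> = of_real \<rho> * cis \<alpha> \<and>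
     \<gamma> ` {0..<1} \<subseteq> ball 0 \<rho>"

lemma spoke_sphere:
  assumes "spoke \<rho> \<alpha> \<gamma>"
  shows "path_image \<gamma> = insert (of_real \<rho> * cis \<alpha>) (\<gamma> ` {0..<1})"
proof -
  have "{0..1} = insert 1 {0..<1::real}" by auto
  then show ?thesis using assms by (simp add: path_image_def spoke_def pathfinish_def)
qed

text \<open>The spokes \<open>e\<close> and \<open>e'\<close> form a cross-cut, which divides the disc into two Jordan domains, each of them
  adjacent to one of the two circular arcs between their ends. A spoke that meets the cross-cut only
  at the centre lies in the domain belonging to the circular arc that contains its end. If the
  ends of \<open>f\<close> and \<open>f'\<close> were on the same circular arc, both spokes would therefore lie in the same
  domain \<open>A\<close>. Transversality enters through the two connected sets \<open>Np\<close> and \<open>Nm\<close>, the sides of the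
  cross-cut near the centre: both contain points of the spokes \<open>f\<close> and \<open>f'\<close>, and would therefore be
  contained in \<open>A\<close>. Then a neighbourhood of the centre would miss the second domain, although the
  centre belongs to its frontier.\<close>

lemma spokes_alternate:
  assumes \<rho>: "0 < \<rho>"
    and e: "spoke \<rho> \<alpha> e" "spoke \<rho> \<alpha>' e'" and f: "spoke \<rho> \<beta> f" "spoke \<rho> \<beta>' f'"
    and ee: "path_image e \<inter> path_image e' = {0}"
    and ef: "(path_image e \<union> path_image e') \<inter> (path_image f \<union> path_image f') = {0}"
    and ang: "0 \<le> \<alpha>" "\<alpha> < \<alpha>'" "\<alpha>' < 2 * pi" "0 \<le> \<beta>" "\<beta> < 2 * pi" "0 \<le> \<beta>'" "\<beta>' < 2 * pi"
    and N: "open N" "0 \<in> N" "N \<subseteq> ball 0 \<rho>" "N - (path_image e \<union> path_image e') \<subseteq> Np \<union> Nm"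
    and Np: "connected Np" "Np \<subseteq> ball 0 \<rho> - (path_image e \<union> path_image e')"
      "Np \<inter> (path_image f \<union> path_image f') \<noteq> {}"
    and Nm: "connected Nm" "Nm \<subseteq> ball 0 \<rho> - (path_image e \<union> path_image e')"
      "Nm \<inter> (path_image f \<union> path_image f') \<noteq> {}"
  shows "(\<alpha> < \<beta> \<and> \<beta> < \<alpha>') \<noteq> (\<alpha> < \<beta>' \<and> \<beta>' < \<alpha>')"
proof
  assume same: "(\<alpha> < \<beta> \<and> \<beta> < \<alpha>') = (\<alpha> < \<beta>' \<and> \<beta>' < \<alpha>')"
  define pt where "pt t = of_real \<rho> * cis t" for t
  let ?E = "path_image e \<union> path_image e'"
  define c1 where "c1 = part_circlepath 0 \<rho> \<alpha> \<alpha>'"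
  define c2 where "c2 = part_circlepath 0 \<rho> (\<alpha> + 2 * pi) \<alpha>'"
  define c where "c = reversepath e +++ e'"
  have pt_inj: "s = t" if "pt s = pt t" "\<bar>s - t\<bar> < 2 * pi" for s t
    using that \<rho> cis_eq_close by (simp add: pt_def)
  have pt_per: "pt (t + 2 * pi) = pt t" for t by (simp add: pt_def flip: cis_mult)
  have c1_im: "path_image c1 = pt ` {\<alpha>..\<alpha>'}"
    using ang by (simp add: c1_def path_image_part_circlepath' pt_def[abs_def] closed_segment_eq_real_ivl)
  have c2_im: "path_image c2 = pt ` {\<alpha>'..\<alpha> + 2 * pi}"
    using ang by (simp add: c2_def path_image_part_circlepath' pt_def[abs_def] closed_segment_eq_real_ivl)
  have ends: "pathstart c1 = pt \<alpha>" "pathfinish c1 = pt \<alpha>'" "pathstart c2 = pt \<alpha>" "pathfinish c2 = pt \<alpha>'"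
    "pathstart c = pt \<alpha>" "pathfinish c = pt \<alpha>'"
    using e pt_per[of \<alpha>] by (simp_all add: c1_def c2_def c_def spoke_def pt_def cis_conv_exp)
  have arcs: "arc c1" "arc c2" using \<rho> ang by (auto simp: c1_def c2_def intro!: arc_part_circlepath)
  have "arc c" unfolding c_def
    using e ee by (intro arc_join arc_reversepath) (auto simp: spoke_def)
  have c_im: "path_image c = ?E"
    unfolding c_def using e by (subst path_image_join) (auto simp: spoke_def)
  have ab: "pt \<alpha> \<noteq> pt \<alpha>'" using pt_inj[of \<alpha> \<alpha>'] ang by auto
  have sph: "path_image c1 \<union> path_image c2 = sphere 0 \<rho>"
  proof (intro equalityI subsetI)
    fix z :: complex assume "z \<in> sphere 0 \<rho>"
    then obtain t where t: "z = pt t" "0 \<le> t" "t < 2 * pi"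
      using polar_form[of z] unfolding pt_def by auto
    consider "\<alpha> \<le> t" "t \<le> \<alpha>'" | "\<alpha>' \<le> t" | "t \<le> \<alpha>" by linarith
    then show "z \<in> path_image c1 \<union> path_image c2"
    proof cases
      case 3
      then have "t + 2 * pi \<in> {\<alpha>'..\<alpha> + 2 * pi}" using t ang by auto
      then show ?thesis using t pt_per[of t] unfolding c2_im by (metis UnI2 imageI)
    qed (use t ang in \<open>auto simp: c1_im c2_im\<close>)
  qed (use \<rho> in \<open>auto simp: c1_im c2_im pt_def norm_mult\<close>)
  have c12: "path_image c1 \<inter> path_image c2 = {pt \<alpha>, pt \<alpha>'}"
  proof (intro equalityI subsetI)
    fix z assume "z \<in> path_image c1 \<inter> path_image c2"
    then have "z \<in> path_image c1" "z \<in> path_image c2" by simp_all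
    from this(1) obtain s where s: "z = pt s" "\<alpha> \<le> s" "s \<le> \<alpha>'" by (auto simp: c1_im)
    from \<open>z \<in> path_image c2\<close> obtain t where t: "z = pt t" "\<alpha>' \<le> t" "t \<le> \<alpha> + 2 * pi" by (auto simp: c2_im)
    show "z \<in> {pt \<alpha>, pt \<alpha>'}"
    proof (cases "t - s < 2 * pi")
      case True
      then have "s = t" using s t by (intro pt_inj) auto
      then show ?thesis using s t by auto
    next
      case False
      then have "s = \<alpha>" using s t by linarith
      then show ?thesis using s by simp
    qed
  qed (use ends pathstart_in_path_image pathfinish_in_path_image in \<open>metis IntI insertE singletonD\<close>)
  have E_sph: "sphere 0 \<rho> \<inter> ?E = {pt \<alpha>, pt \<alpha>'}"
    unfolding spoke_sphere[OF e(1)] spoke_sphere[OF e(2)] pt_def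
    using e \<rho> by (auto simp: spoke_def norm_mult subset_iff)
  have c1c: "path_image c1 \<inter> path_image c = {pt \<alpha>, pt \<alpha>'}" "path_image c2 \<inter> path_image c = {pt \<alpha>, pt \<alpha>'}"
    using E_sph sph c12 unfolding c_im by blast+
  have zE: "0 \<in> ?E" using ee by blast
  have ins: "inside (path_image c1 \<union> path_image c2) = ball 0 \<rho>"
    using sph inside_sphere_complex[OF \<rho>] by simp
  define I1 where "I1 = inside (path_image c1 \<union> path_image c)"
  define I2 where "I2 = inside (path_image c2 \<union> path_image c)"
  obtain "I1 \<inter> I2 = {}" "I1 \<union> I2 \<union> (path_image c - {pt \<alpha>, pt \<alpha>'}) = ball 0 \<rho>"
  proof (rule split_inside_simple_closed_curve[of c1 "pt \<alpha>" "pt \<alpha>'" c2 c])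
    show "path_image c \<inter> inside (path_image c1 \<union> path_image c2) \<noteq> {}"
      using zE \<rho> unfolding ins c_im by auto
  qed (use arcs \<open>arc c\<close> ends ab c12 c1c ins in \<open>auto simp: I1_def I2_def intro: arc_imp_simple_path\<close>)
  then have I: "I1 \<inter> I2 = {}" "ball 0 \<rho> - ?E \<subseteq> I1 \<union> I2" "I1 \<subseteq> ball 0 \<rho>" "I2 \<subseteq> ball 0 \<rho>"
    unfolding c_im by blast+
  have half: "open (inside (path_image d \<union> path_image c))"
    "closure (inside (path_image d \<union> path_image c)) \<subseteq> path_image d \<union> ?E \<union> inside (path_image d \<union> path_image c)"
    "0 \<in> closure (inside (path_image d \<union> path_image c))"
    if d: "arc d" "pathstart d = pt \<alpha>" "pathfinish d = pt \<alpha>'" "path_image d \<inter> path_image c = {pt \<alpha>, pt \<alpha>'}" for d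
  proof -
    have sp: "simple_path (d +++ reversepath c)"
      using d \<open>arc c\<close> ends by (intro simple_path_join_loop arc_reversepath) auto
    have im: "path_image (d +++ reversepath c) = path_image d \<union> path_image c"
      using d ends by (subst path_image_join) auto
    have cl: "pathfinish (d +++ reversepath c) = pathstart (d +++ reversepath c)"
      using d ends by simp
    note J = Jordan_inside_outside[OF sp cl, unfolded im]
    show "open (inside (path_image d \<union> path_image c))" using J by blast
    have fr: "frontier (inside (path_image d \<union> path_image c)) = path_image d \<union> path_image c" using J by blast
    show "closure (inside (path_image d \<union> path_image c)) \<subseteq> path_image d \<union> ?E \<union> inside (path_image d \<union> path_image c)"
      unfolding closure_Un_frontier fr unfolding c_im by blast
    show "0 \<in> closure (inside (path_image d \<union> path_image c))"
      unfolding closure_Un_frontier fr unfolding c_im using zE by blast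
  qed
  note h1 = half[OF arcs(1) ends(1,2) c1c(1), folded I1_def] and h2 = half[OF arcs(2) ends(3,4) c1c(2), folded I2_def]

  have side: "C \<subseteq> I1 \<or> C \<subseteq> I2" if "connected C" "C \<subseteq> ball 0 \<rho> - ?E" for C
  proof -
    have "C \<subseteq> I1 \<union> I2" using I(2) that(2) by (rule order_trans[rotated])
    moreover have "I1 \<inter> I2 \<inter> C = {}" using I(1) by simp
    ultimately have "I1 \<inter> C = {} \<or> I2 \<inter> C = {}" using connectedD[OF that(1) h1(1) h2(1)] by simp
    then show ?thesis using \<open>C \<subseteq> I1 \<union> I2\<close> by blast
  qed
  \<comment> \<open>The end of the spoke is not in the closure of the domain adjacent to the other circular arc.\<close>
  have spoke_side: "g ` {0<..<1} \<subseteq> (if \<alpha> < \<gamma> \<and> \<gamma> < \<alpha>' then I1 else I2)"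
    if g: "spoke \<rho> \<gamma> g" "?E \<inter> path_image g \<subseteq> {0}" and \<gamma>: "0 \<le> \<gamma>" "\<gamma> < 2 * pi" for g \<gamma>
  proof -
    have cont: "continuous_on {0..1} g" using g by (simp add: spoke_def arc_def path_def)
    have "connected (g ` {0<..<1})"
      by (intro connected_continuous_image continuous_on_subset[OF cont]) auto
    moreover have "g ` {0<..<1} \<subseteq> ball 0 \<rho> - ?E"
    proof -
      have "g s \<noteq> 0" if "s \<in> {0<..<1}" for s
        using g(1) arcD[of g s 0] that by (auto simp: spoke_def pathstart_def)
      then have "g s \<in> ball 0 \<rho> - ?E" if s: "s \<in> {0<..<1}" for s
      proof -
        have "g s \<in> path_image g" using s by (auto simp: path_image_def)
        then have "g s \<notin> ?E" using g(2) \<open>\<And>s. s \<in> {0<..<1} \<Longrightarrow> g s \<noteq> 0\<close>[OF s] by blast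
        moreover have "s \<in> {0..<1}" using s by simp
        then have "g s \<in> ball 0 \<rho>" using g(1) unfolding spoke_def by blast
        ultimately show ?thesis by simp
      qed
      then show ?thesis by blast
    qed
    ultimately have S: "g ` {0<..<1} \<subseteq> I1 \<or> g ` {0<..<1} \<subseteq> I2" by (rule side)
    have "pt \<gamma> \<in> path_image g" using g(1) pathfinish_in_path_image[of g] by (simp add: spoke_def pt_def)
    moreover have "pt \<gamma> \<in> sphere 0 \<rho>" using \<rho> by (simp add: pt_def norm_mult)
    ultimately have off: "pt \<gamma> \<notin> ?E" "pt \<gamma> \<notin> ball 0 \<rho>" using g(2) \<rho> by auto
    have lim: "pt \<gamma> \<in> closure (g ` {0<..<1})"
    proof -
      have "g ` closure {0<..<1} \<subseteq> closure (g ` {0<..<1})"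
        using cont by (intro image_closure_subset closed_closure closure_subset) simp
      moreover have "pt \<gamma> = g 1" using g(1) by (simp add: spoke_def pt_def pathfinish_def)
      ultimately show ?thesis by auto
    qed
    have "\<gamma> \<noteq> \<alpha>" "\<gamma> \<noteq> \<alpha>'" using off(1) E_sph by auto
    show ?thesis
    proof (cases "\<alpha> < \<gamma> \<and> \<gamma> < \<alpha>'")
      case True
      have "pt \<gamma> \<in> path_image c1" unfolding c1_im using True by auto
      then have "pt \<gamma> \<notin> path_image c2" using c12 off(1) E_sph by blast
      then have "pt \<gamma> \<notin> closure I2" using h2(2) off I(4) by blast
      then have "\<not> g ` {0<..<1} \<subseteq> I2" using lim closure_mono by blast
      then show ?thesis using S True by auto
    next
      case False
      have "pt \<gamma> \<notin> path_image c1"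
      proof
        assume "pt \<gamma> \<in> path_image c1"
        then obtain t where t: "pt \<gamma> = pt t" "\<alpha> \<le> t" "t \<le> \<alpha>'" unfolding c1_im by auto
        then have "\<gamma> = t" using ang \<gamma> by (intro pt_inj) auto
        then show False using t False \<open>\<gamma> \<noteq> \<alpha>\<close> \<open>\<gamma> \<noteq> \<alpha>'\<close> by auto
      qed
      then have "pt \<gamma> \<notin> closure I1" using h1(2) off I(3) by blast
      then have "\<not> g ` {0<..<1} \<subseteq> I1" using lim closure_mono by blast
      then show ?thesis using S False by auto
    qed
  qed
  \<comment> \<open>the domain that contains both spokes, and the other one\<close>
  define A where "A = (if \<alpha> < \<beta> \<and> \<beta> < \<alpha>' then I1 else I2)"
  define B where "B = (if \<alpha> < \<beta> \<and> \<beta> < \<alpha>' then I2 else I1)"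
  have off: "I1 \<inter> ?E = {}" "I2 \<inter> ?E = {}"
    unfolding I1_def I2_def c_im[symmetric] using inside_no_overlap by blast+
  have AB: "A \<inter> B = {}" "0 \<in> closure B" "B \<inter> ?E = {}" "B \<subseteq> ball 0 \<rho>"
    using I h1(3) h2(3) off unfolding A_def B_def by auto
  have AB_side: "C \<subseteq> A \<or> C \<subseteq> B" if "connected C" "C \<subseteq> ball 0 \<rho> - ?E" for C
    using side[OF that] unfolding A_def B_def by (cases "\<alpha> < \<beta> \<and> \<beta> < \<alpha>'") (simp_all only: if_True if_False simp_thms disj_commute)
  have fA: "f ` {0<..<1} \<subseteq> A" "f' ` {0<..<1} \<subseteq> A"
  proof -
    have "?E \<inter> path_image f \<subseteq> {0}" "?E \<inter> path_image f' \<subseteq> {0}" using ef by blast+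
    then show "f ` {0<..<1} \<subseteq> A" "f' ` {0<..<1} \<subseteq> A"
      using spoke_side[OF f(1) _ ang(4,5)] spoke_side[OF f(2) _ ang(6,7)] unfolding A_def same by simp_all
  qed
  have FA: "z \<in> A" if z: "z \<in> path_image f \<union> path_image f'" "z \<in> ball 0 \<rho> - ?E" for z
  proof -
    have "z \<noteq> 0" using z(2) zE by auto
    have "z \<in> g ` {0<..<1}" if g: "spoke \<rho> \<gamma> g" "z \<in> path_image g" for g \<gamma>
    proof -
      obtain s where s: "s \<in> {0..1}" "z = g s" using g(2) by (auto simp: path_image_def)
      have "g 0 = 0" "cmod (g 1) = \<rho>" using g(1) \<rho> by (auto simp: spoke_def pathstart_def pathfinish_def norm_mult)
      then have "s \<noteq> 0" "s \<noteq> 1" using \<open>z \<noteq> 0\<close> z(2) s by auto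
      then show ?thesis using s by auto
    qed
    then show ?thesis using f fA z(1) by blast
  qed
  have "Np \<subseteq> A" "Nm \<subseteq> A"
    using AB(1) AB_side[OF Np(1,2)] AB_side[OF Nm(1,2)] FA Np(2,3) Nm(2,3) by blast+
  then have "N \<inter> B = {}" using N(4) AB(1,3) by blast
  then have "N \<inter> closure B = {}" using N(1) by (simp add: open_Int_closure_eq_empty)
  then show False using N(2) AB(2) by blast
qed

section \<open>Rotations given by angles\<close>

text \<open>The positive quantity, twice the signed area of the triangle, is
  \<open>4 * \<rho>\<^sup>2 * sin x * sin y * sin (x + y)\<close> with \<open>x = (\<beta> - \<alpha>) / 2\<close> and \<open>y = (\<gamma> - \<beta>) / 2\<close>.\<close>

lemma counterclockwise_on_circle:
  assumes "\<alpha> < \<beta>" "\<beta> < \<gamma>" "\<gamma> < \<alpha> + 2 * pi" "0 < \<rho>"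
  shows "0 < Im (cnj (of_real \<rho> * cis \<beta> - of_real \<rho> * cis \<alpha>) * (of_real \<rho> * cis \<gamma> - of_real \<rho> * cis \<alpha>))"
proof -
  define x y where "x = (\<beta> - \<alpha>) / 2" and "y = (\<gamma> - \<beta>) / 2"
  have xy: "\<beta> = \<alpha> + 2 * x" "\<gamma> = \<alpha> + 2 * x + 2 * y" by (simp_all add: x_def y_def field_simps)
  have "Im (cnj (of_real \<rho> * cis \<beta> - of_real \<rho> * cis \<alpha>) * (of_real \<rho> * cis \<gamma> - of_real \<rho> * cis \<alpha>)) =
      \<rho> * \<rho> * (sin (\<gamma> - \<beta>) + sin (\<beta> - \<alpha>) - sin (\<gamma> - \<alpha>))"
    by (simp add: sin_diff algebra_simps)
  also have "sin (\<gamma> - \<beta>) + sin (\<beta> - \<alpha>) - sin (\<gamma> - \<alpha>) = sin (2 * x) + sin (2 * y) - sin (2 * (x + y))"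
    by (simp add: xy)
  also have "\<dots> = 4 * sin x * sin y * sin (x + y)"
  proof -
    have "sin (2 * x) + sin (2 * y) = 2 * sin (x + y) * cos (x - y)"
    proof -
      have "(2 * x + 2 * y) / 2 = x + y" "(2 * x - 2 * y) / 2 = x - y" by simp_all
      then show ?thesis using sin_plus_sin[of "2 * x" "2 * y"] by (simp only:)
    qed
    moreover have "cos (x - y) - cos (x + y) = 2 * sin x * sin y"
      by (simp add: cos_diff cos_add)
    ultimately show ?thesis unfolding sin_double by (simp add: algebra_simps)
  qed
  finally have eq: "Im (cnj (of_real \<rho> * cis \<beta> - of_real \<rho> * cis \<alpha>) * (of_real \<rho> * cis \<gamma> - of_real \<rho> * cis \<alpha>)) =
      \<rho> * \<rho> * (4 * sin x * sin y * sin (x + y))" .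
  have "0 < sin x" "0 < sin y" "0 < sin (x + y)"
    using assms by (auto intro!: sin_gt_zero simp: x_def y_def field_simps)
  then show ?thesis unfolding eq using assms(4) by simp
qed

lemma enumerate_by_key:
  fixes \<theta> :: "'a \<Rightarrow> real"
  assumes "finite A" "inj_on \<theta> A"
  obtains x where "bij_betw x {..<card A} A" "\<And>i j. \<lbrakk>i < j; j < card A\<rbrakk> \<Longrightarrow> \<theta> (x i) < \<theta> (x j)"
proof -
  define ys where "ys = sorted_list_of_set (\<theta> ` A)"
  have ys: "sorted_wrt (<) ys" "set ys = \<theta> ` A" "length ys = card A"
    using assms by (simp_all add: ys_def card_image)
  define x where "x i = inv_into A \<theta> (ys ! i)" for i
  have x: "\<theta> (x i) = ys ! i" "x i \<in> A" if "i < card A" for i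
  proof -
    have "ys ! i \<in> \<theta> ` A" using ys that by (metis nth_mem)
    then show "\<theta> (x i) = ys ! i" "x i \<in> A" unfolding x_def by (auto simp: f_inv_into_f inv_into_into)
  qed
  have mono: "\<theta> (x i) < \<theta> (x j)" if "i < j" "j < card A" for i j
    using sorted_wrt_nth_less[OF ys(1) that(1)] x[of i] x[of j] that ys(3) by simp
  have "inj_on x {..<card A}"
    by (rule linorder_inj_onI) (use mono in fastforce)+
  moreover have "x ` {..<card A} \<subseteq> A" using x by auto
  ultimately have "bij_betw x {..<card A} A"
    by (metis assms(1) bij_betw_def card_image card_lessThan card_subset_eq)
  then show thesis using that mono by blast
qed

text \<open>The rotation takes every element to the one with the next larger angle. The involution \<open>opp\<close> exchanges
  the elements between \<open>e\<close> and \<open>opp e\<close> with the remaining ones. So half of the other elements lie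
  between \<open>e\<close> and \<open>opp e\<close>, whence \<open>opp e\<close> is reached from \<open>e\<close> after half a turn.\<close>

lemma angular_rotation_exists:
  fixes \<theta> :: "'a \<Rightarrow> real"
  assumes A: "finite A" "2 \<le> card A" "inj_on \<theta> A" and \<theta>: "\<And>e. e \<in> A \<Longrightarrow> 0 \<le> \<theta> e \<and> \<theta> e < 2 * pi"
    and opp: "\<And>e. e \<in> A \<Longrightarrow> opp e \<in> A \<and> opp e \<noteq> e \<and> opp (opp e) = e"
    and sep: "\<And>e f. \<lbrakk>e \<in> A; f \<in> A; f \<noteq> e; f \<noteq> opp e; \<theta> e < \<theta> (opp e)\<rbrakk> \<Longrightarrow>
      (\<theta> e < \<theta> f \<and> \<theta> f < \<theta> (opp e)) \<noteq> (\<theta> e < \<theta> (opp f) \<and> \<theta> (opp f) < \<theta> (opp e))"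
  obtains \<pi> where "cyclic_on \<pi> A" "\<And>e. e \<in> A \<Longrightarrow> \<pi> e \<in> A - {e}"
    "\<And>e f. \<lbrakk>e \<in> A; f \<in> A - {e, \<pi> e}\<rbrakk> \<Longrightarrow> \<exists>\<beta> \<gamma>. cis \<beta> = cis (\<theta> (\<pi> e)) \<and> cis \<gamma> = cis (\<theta> f) \<and>
      \<theta> e < \<beta> \<and> \<beta> < \<gamma> \<and> \<gamma> < \<theta> e + 2 * pi"
    "\<And>e. e \<in> A \<Longrightarrow> (\<pi> ^^ (card A div 2)) e = opp e"
proof -
  define N where "N = card A"
  obtain x where bij: "bij_betw x {..<N} A" and mono: "\<And>i j. \<lbrakk>i < j; j < N\<rbrakk> \<Longrightarrow> \<theta> (x i) < \<theta> (x j)"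
    using enumerate_by_key[OF A(1,3)] unfolding N_def by blast
  have N: "2 \<le> N" using A by (simp add: N_def)
  have xA: "x i \<in> A" if "i < N" for i using bij that by (auto simp: bij_betw_def)
  have ex: "\<exists>i<N. e = x i" if "e \<in> A" for e using bij that by (auto simp: bij_betw_def)
  have x_inj: "i = j" if "x i = x j" "i < N" "j < N" for i j
    using bij that by (auto simp: bij_betw_def inj_on_def)
  define \<pi> where "\<pi> e = x (Suc (inv_into {..<N} x e) mod N)" for e
  have \<pi>: "\<pi> (x i) = x (Suc i mod N)" if "i < N" for i
    using bij that by (simp add: \<pi>_def bij_betw_def inv_into_f_f)
  have pow: "(\<pi> ^^ n) (x i) = x ((i + n) mod N)" if "i < N" for i n
  proof (induction n)
    case (Suc n)
    have "(\<pi> ^^ Suc n) (x i) = \<pi> (x ((i + n) mod N))" using Suc by simp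
    also have "\<dots> = x (Suc ((i + n) mod N) mod N)" using N by (intro \<pi>) simp
    finally show ?case by (simp add: mod_Suc_eq)
  qed (use that in simp)
  have "orbit \<pi> (x 0) = A"
  proof (intro equalityI subsetI)
    fix e assume "e \<in> orbit \<pi> (x 0)"
    then obtain n where "e = (\<pi> ^^ n) (x 0)" by (auto simp: orbit_altdef)
    then show "e \<in> A" using pow[of 0 n] N xA by simp
  next
    fix e assume "e \<in> A"
    then obtain i where i: "i < N" "e = x i" using ex by blast
    then have "e = (\<pi> ^^ (i + N)) (x 0)" using pow[of 0 "i + N"] N by simp
    then show "e \<in> orbit \<pi> (x 0)" using N by (auto simp: orbit_altdef intro!: exI[of _ "i + N"])
  qed
  then have "cyclic_on \<pi> A" using N xA[of 0] by (auto simp: cyclic_on_def)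
  moreover have "\<pi> e \<in> A - {e}" if "e \<in> A" for e
  proof -
    obtain i where i: "i < N" "e = x i" using ex \<open>e \<in> A\<close> by blast
    have "Suc i mod N \<noteq> i" using i N by (cases "Suc i = N") auto
    moreover have "Suc i mod N < N" using N by simp
    ultimately show ?thesis using \<pi>[OF i(1)] xA x_inj i by auto
  qed
  moreover have "\<exists>\<beta> \<gamma>. cis \<beta> = cis (\<theta> (\<pi> e)) \<and> cis \<gamma> = cis (\<theta> f) \<and> \<theta> e < \<beta> \<and> \<beta> < \<gamma> \<and> \<gamma> < \<theta> e + 2 * pi"
    if ef: "e \<in> A" "f \<in> A - {e, \<pi> e}" for e f
  proof -
    obtain i where i: "i < N" "e = x i" using ex ef by blast
    obtain k where k: "k < N" "f = x k" using ex ef by blast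
    have ne: "k \<noteq> i" "k \<noteq> Suc i mod N" using ef i k \<pi>[OF i(1)] by auto
    have per: "cis (t + 2 * pi) = cis t" for t by (simp flip: cis_mult)
    have b: "0 \<le> \<theta> (x j)" "\<theta> (x j) < 2 * pi" if "j < N" for j using \<theta> xA that by auto
    consider "Suc i < N" "Suc i < k" | "Suc i < N" "k < i" | "Suc i = N" "0 < k" "k < i"
      using i k ne by (cases "Suc i = N"; cases "k < i") auto
    then show ?thesis
    proof cases
      case 1
      then show ?thesis using \<pi>[OF i(1)] i k mono[of i "Suc i"] mono[of "Suc i" k] b[of i] b[of k]
        by (intro exI[of _ "\<theta> (x (Suc i))"] exI[of _ "\<theta> f"]) auto
    next
      case 2
      then show ?thesis using \<pi>[OF i(1)] i k mono[of i "Suc i"] mono[of k i] b[of "Suc i"] b[of k] per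
        by (intro exI[of _ "\<theta> (x (Suc i))"] exI[of _ "\<theta> f + 2 * pi"]) auto
    next
      case 3
      then show ?thesis using \<pi>[OF i(1)] i k mono[of k i] mono[of 0 k] b[of 0] b[of i] per
        by (intro exI[of _ "\<theta> (x 0) + 2 * pi"] exI[of _ "\<theta> f + 2 * pi"]) auto
    qed
  qed
  moreover have "(\<pi> ^^ (card A div 2)) e = opp e" if "e \<in> A" for e
  proof -
    have half: "N = 2 * (j - i)" if ij: "i < j" "j < N" and o: "opp (x i) = x j" for i j
    proof -
      define B where "B = {f \<in> A. \<theta> (x i) < \<theta> f \<and> \<theta> f < \<theta> (x j)}"
      define C where "C = A - B - {x i, x j}"
      have xi: "x i \<in> A" "x j \<in> A" "x i \<noteq> x j" "opp (x j) = x i"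
        using xA[of i] xA[of j] ij opp[of "x i"] o by auto
      have lt: "\<theta> (x i) < \<theta> (opp (x i))" using mono ij o by simp
      have "opp ` B \<subseteq> C"
      proof
        fix g assume "g \<in> opp ` B"
        then obtain f where f: "f \<in> B" "g = opp f" by blast
        then have "f \<in> A" "f \<noteq> x i" "f \<noteq> x j" by (auto simp: B_def)
        then show "g \<in> C" using sep[of "x i" f] lt o f opp[of f] opp[of "x i"] xi by (auto simp: C_def B_def)
      qed
      moreover have "opp ` C \<subseteq> B"
      proof
        fix g assume "g \<in> opp ` C"
        then obtain f where f: "f \<in> C" "g = opp f" by blast
        then have "f \<in> A" "f \<noteq> x i" "f \<noteq> x j" by (auto simp: C_def)
        then show "g \<in> B" using sep[of "x i" f] lt o f opp[of f] xi by (auto simp: C_def B_def)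
      qed
      moreover have "inj_on opp B" "inj_on opp C"
      proof -
        have "inj_on opp A" by (rule inj_onI) (metis opp)
        then show "inj_on opp B" "inj_on opp C" by (auto simp: B_def C_def intro: inj_on_subset)
      qed
      moreover have fin: "finite B" "finite C" using A(1) by (auto simp: B_def C_def)
      ultimately have BC: "card B = card C" by (metis card_inj_on_le le_antisym)
      have "A = B \<union> C \<union> {x i, x j}" using xi by (auto simp: B_def C_def)
      moreover have "card (B \<union> C \<union> {x i, x j}) = card B + card C + 2"
      proof -
        have "card (B \<union> C) = card B + card C" using fin by (intro card_Un_disjoint) (auto simp: C_def)
        moreover have "card (B \<union> C \<union> {x i, x j}) = card (B \<union> C) + card {x i, x j}"
          using fin by (intro card_Un_disjoint) (auto simp: B_def C_def)
        ultimately show ?thesis using xi by simp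
      qed
      ultimately have "N = 2 * card B + 2" using BC by (simp add: N_def)
      moreover have "B = x ` {i<..<j}"
      proof (intro equalityI subsetI)
        fix f assume f: "f \<in> B"
        then obtain k where k: "k < N" "f = x k" using ex by (auto simp: B_def)
        have "\<not> k \<le> i" "\<not> j \<le> k" using f k mono[of k i] mono[of j k] ij by (auto simp: B_def le_less)
        then show "f \<in> x ` {i<..<j}" using k by auto
      qed (use mono ij xA in \<open>auto simp: B_def\<close>)
      moreover have "inj_on x {i<..<j}" by (rule inj_onI) (use x_inj ij in auto)
      ultimately show ?thesis using ij by (simp add: card_image)
    qed
    obtain i where i: "i < N" "e = x i" using ex \<open>e \<in> A\<close> by blast
    obtain j where j: "j < N" "opp e = x j" using ex opp[OF \<open>e \<in> A\<close>] by blast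
    have "i \<noteq> j" using opp[OF \<open>e \<in> A\<close>] i j by auto
    then have "(i + N div 2) mod N = j"
    proof (cases "i < j")
      case True
      then have "N = 2 * (j - i)" using half i j by auto
      then have "N div 2 = j - i" by linarith
      then show ?thesis using True j by simp
    next
      case False
      then have "j < i" using \<open>i \<noteq> j\<close> by simp
      moreover have "opp (x j) = x i" using opp[OF \<open>e \<in> A\<close>] i j by simp
      ultimately have "N = 2 * (i - j)" using half[of j i] i by auto
      then have "i + N div 2 = j + N" using \<open>j < i\<close> by linarith
      then show ?thesis using j by simp
    qed
    then show ?thesis using pow[OF i(1), of "N div 2"] i j by (simp add: N_def)
  qed
  ultimately show thesis by (rule that)
qed

section \<open>Curves in a disc of a chart\<close>

locale disc_chart =
  fixes J :: "complex \<Rightarrow> rp2" and \<rho> :: real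
  assumes cont: "continuous_on UNIV J" and inj: "inj J"
    and open_disc: "open (J ` ball 0 \<rho>)" and \<rho>: "0 < \<rho>"
begin

lemma inverse_chart:
  obtains K where "continuous_on (J ` cball 0 \<rho>) K" "\<And>z. z \<in> cball 0 \<rho> \<Longrightarrow> K (J z) = z"
proof -
  obtain K where "homeomorphism (cball 0 \<rho>) (J ` cball 0 \<rho>) J K"
    using homeomorphism_compact[of "cball 0 \<rho>" J] continuous_on_subset[OF cont] inj_on_subset[OF inj]
    by (metis compact_cball subset_UNIV)
  then show thesis using that by (auto simp: homeomorphism_def)
qed

lemma closed_disc: "closed (J ` cball 0 \<rho>)"
  by (intro compact_imp_closed compact_continuous_image continuous_on_subset[OF cont]) auto

text \<open>The initial piece of the arc, up to the first parameter \<open>t\<close> where it is not in the open disc, read in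
  the chart.\<close>

lemma arc_spoke:
  assumes q: "arc q" "pathstart q = J 0" "pathfinish q \<notin> J ` cball 0 \<rho>"
  obtains t \<theta> \<gamma> where "0 < t" "t < 1" "0 \<le> \<theta>" "\<theta> < 2 * pi" "spoke \<rho> \<theta> \<gamma>"
    "J ` path_image \<gamma> = q ` {0..t}" "q t = J (of_real \<rho> * cis \<theta>)" "\<And>s. s \<in> {0..<t} \<Longrightarrow> q s \<in> J ` ball 0 \<rho>"
proof -
  have q01: "q 0 = J 0" "q 1 \<notin> J ` cball 0 \<rho>" using q by (auto simp: pathstart_def pathfinish_def)
  have contq: "continuous_on {0..1} q" and injq: "inj_on q {0..1}" using q by (auto simp: arc_def path_def)
  define X where "X = {0..1} \<inter> q -` (- J ` ball 0 \<rho>)"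
  have "closed X" unfolding X_def
    using open_disc by (intro continuous_on_closed_vimage[THEN iffD1, rule_format, OF _ contq, simplified] continuous_closed_preimage[OF contq]) auto
  then have "compact X" using compact_Int_closed[of "{0..1}" X] by (simp add: X_def Int_absorb1 flip: Int_assoc)
  moreover have "1 \<in> X" using q01 by (auto simp: X_def)
  ultimately obtain t where t: "t \<in> X" "\<And>s. s \<in> X \<Longrightarrow> t \<le> s" using compact_attains_inf[of X] by auto
  have t01: "0 \<le> t" "t \<le> 1" using t by (auto simp: X_def)
  have inside: "q s \<in> J ` ball 0 \<rho>" if "s \<in> {0..<t}" for s
  proof (rule ccontr)
    assume "q s \<notin> J ` ball 0 \<rho>"
    then have "s \<in> X" using that t01 by (auto simp: X_def)
    then show False using t(2)[of s] that by auto
  qed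
  have "q t \<notin> J ` ball 0 \<rho>" using t by (auto simp: X_def)
  then have "t \<noteq> 0" using q01 \<rho> by (metis centre_in_ball imageI)
  then have "0 < t" using t01 by simp
  have "q t \<in> closure (q ` {0..<t})"
  proof -
    have "q ` closure {0..<t} \<subseteq> closure (q ` {0..<t})"
      using \<open>0 < t\<close> t01 continuous_on_subset[OF contq]
      by (intro image_closure_subset closed_closure closure_subset) auto
    then show ?thesis using \<open>0 < t\<close> by auto
  qed
  moreover have "q ` {0..<t} \<subseteq> J ` cball 0 \<rho>" using inside ball_subset_cball by blast
  ultimately have "q t \<in> J ` cball 0 \<rho>" using closure_minimal[OF _ closed_disc] by blast
  then obtain z where z: "z \<in> cball 0 \<rho>" "q t = J z" by blast
  then have "cmod z = \<rho>" using \<open>q t \<notin> J ` ball 0 \<rho>\<close> by force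
  have "t \<noteq> 1" using z q01 by auto
  then have "t < 1" using t01 by simp
  obtain \<theta> where \<theta>: "0 \<le> \<theta>" "\<theta> < 2 * pi" "z = of_real \<rho> * cis \<theta>"
    using polar_form[of z] \<open>cmod z = \<rho>\<close> by metis
  obtain K where K: "continuous_on (J ` cball 0 \<rho>) K" "\<And>z. z \<in> cball 0 \<rho> \<Longrightarrow> K (J z) = z"
    using inverse_chart by blast
  have in_cball: "q s \<in> J ` cball 0 \<rho>" if "s \<in> {0..t}" for s
    using inside[of s] that z ball_subset_cball by (cases "s = t") auto
  have JK: "J (K (q s)) = q s" if "s \<in> {0..t}" for s
    using in_cball[OF that] K(2) by auto
  define \<gamma> where "\<gamma> x = K (q (t * x))" for x
  have scale: "(\<lambda>x. t * x) ` {0..1} = {0..t}"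
    using \<open>0 < t\<close> image_mult_atLeastAtMost[of t 0 1] by simp
  have "continuous_on {0..1} \<gamma>"
    unfolding \<gamma>_def
  proof (rule continuous_on_compose2[OF K(1)])
    show "continuous_on {0..1} (\<lambda>x. q (t * x))"
      by (rule continuous_on_compose2[OF contq]) (use \<open>0 < t\<close> t01 mult_le_one in \<open>auto intro!: continuous_intros\<close>)
    show "(\<lambda>x. q (t * x)) ` {0..1} \<subseteq> J ` cball 0 \<rho>"
      using in_cball scale by blast
  qed
  moreover have "inj_on \<gamma> {0..1}"
  proof (rule inj_onI)
    fix x y assume xy: "x \<in> {0..1}" "y \<in> {0..1}" "\<gamma> x = \<gamma> y"
    then have tx: "t * x \<in> {0..t}" "t * y \<in> {0..t}" using scale by blast+
    then have "q (t * x) = q (t * y)" using xy(3) JK by (metis \<gamma>_def)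
    then have "t * x = t * y" using tx t01 by (intro inj_onD[OF injq]) auto
    then show "x = y" using \<open>0 < t\<close> by simp
  qed
  ultimately have "arc \<gamma>" by (simp add: arc_def path_def)
  moreover have "\<gamma> 0 = 0" "\<gamma> 1 = z" using K(2)[of 0] K(2)[OF z(1)] q01 z(2) \<rho> by (auto simp: \<gamma>_def)
  moreover have "\<gamma> ` {0..<1} \<subseteq> ball 0 \<rho>"
  proof
    fix w assume "w \<in> \<gamma> ` {0..<1}"
    then obtain x where x: "x \<in> {0..<1}" "w = K (q (t * x))" by (auto simp: \<gamma>_def)
    then have "q (t * x) \<in> J ` ball 0 \<rho>" using \<open>0 < t\<close> by (intro inside) auto
    then show "w \<in> ball 0 \<rho>" using x K(2) ball_subset_cball by auto
  qed
  ultimately have "spoke \<rho> \<theta> \<gamma>" using \<theta>(3) by (simp add: spoke_def pathstart_def pathfinish_def)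
  moreover have "J ` path_image \<gamma> = q ` {0..t}"
  proof -
    have "J ` path_image \<gamma> = (\<lambda>s. J (K (q s))) ` (\<lambda>x. t * x) ` {0..1}"
      by (simp only: path_image_def \<gamma>_def image_image)
    then show ?thesis unfolding scale using JK by simp
  qed
  ultimately show thesis using that \<open>0 < t\<close> \<open>t < 1\<close> \<theta> z(2) inside by blast
qed

text \<open>In a chart that straightens both curves, the two halves of a small ball off the first curve
  are convex, and each of them contains a piece of the second curve. The ball has to be so small that it
  avoids \<open>R\<close> and \<open>S\<close>, which contain the parts of the curves beyond their spokes.\<close>

lemma transversal_spokes_alternate:
  assumes tr: "cross_transversally_at (J 0) l m"
    and e: "spoke \<rho> \<alpha> e" "spoke \<rho> \<alpha>' e'" and f: "spoke \<rho> \<beta> f" "spoke \<rho> \<beta>' f'"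
    and ee: "path_image e \<inter> path_image e' = {0}"
    and ef: "(path_image e \<union> path_image e') \<inter> (path_image f \<union> path_image f') = {0}"
    and ang: "0 \<le> \<alpha>" "\<alpha> < \<alpha>'" "\<alpha>' < 2 * pi" "0 \<le> \<beta>" "\<beta> < 2 * pi" "0 \<le> \<beta>'" "\<beta>' < 2 * pi"
    and l: "J ` (path_image e \<union> path_image e') \<subseteq> l" "l \<subseteq> J ` (path_image e \<union> path_image e') \<union> R"
    and m: "m \<subseteq> J ` (path_image f \<union> path_image f') \<union> S"
    and RS: "closed R" "closed S" "J 0 \<notin> R" "J 0 \<notin> S"
  shows "(\<alpha> < \<beta> \<and> \<beta> < \<alpha>') \<noteq> (\<alpha> < \<beta>' \<and> \<beta>' < \<alpha>')"
proof -
  let ?E = "path_image e \<union> path_image e'" and ?F = "path_image f \<union> path_image f'"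
  obtain U h k where U: "open U" "J 0 \<in> U" and hk: "homeomorphism U (UNIV :: (real^2) set) h k"
    and h0: "h (J 0) = 0" and hl: "h ` (U \<inter> l) = {x. x $ 2 = 0}" and hm: "h ` (U \<inter> m) = {x. x $ 1 = 0}"
    using tr by (auto simp: cross_transversally_at_def)
  have kh: "k (h p) = p" if "p \<in> U" for p using hk that by (simp add: homeomorphism_def)
  have hk': "h (k x) = x" "k x \<in> U" for x using hk by (auto simp: homeomorphism_def)
  have conth: "continuous_on U h" and contk: "continuous_on UNIV k" using hk by (auto simp: homeomorphism_def)
  have on_l: "k x \<in> l \<longleftrightarrow> x $ 2 = 0" and on_m: "k x \<in> m \<longleftrightarrow> x $ 1 = 0" for x
  proof -
    show "k x \<in> l \<longleftrightarrow> x $ 2 = 0"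
    proof
      assume "k x \<in> l"
      then have "h (k x) \<in> h ` (U \<inter> l)" using hk' by blast
      then show "x $ 2 = 0" using hl hk' by simp
    next
      assume "x $ 2 = 0"
      then obtain p where "p \<in> U" "p \<in> l" "x = h p" using hl by blast
      then show "k x \<in> l" using kh by simp
    qed
    show "k x \<in> m \<longleftrightarrow> x $ 1 = 0"
    proof
      assume "k x \<in> m"
      then have "h (k x) \<in> h ` (U \<inter> m)" using hk' by blast
      then show "x $ 1 = 0" using hm hk' by simp
    next
      assume "x $ 1 = 0"
      then obtain p where "p \<in> U" "p \<in> m" "x = h p" using hm by blast
      then show "k x \<in> m" using kh by simp
    qed
  qed
  define W where "W = J ` ball 0 \<rho> \<inter> - R \<inter> - S"
  have "open W" unfolding W_def using open_disc RS by (intro open_Int) auto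
  then have "open (k -` W)" using contk by (rule open_vimage)
  moreover have "0 \<in> k -` W" using RS \<rho> kh[OF U(2)] h0 by (auto simp: W_def)
  ultimately obtain \<delta> where \<delta>: "0 < \<delta>" "ball 0 \<delta> \<subseteq> k -` W" using open_contains_ball by blast
  have kW: "k x \<in> W" if "norm x < \<delta>" for x using \<delta>(2) that by (auto simp: subset_iff)
  define V where "V = h -` ball 0 \<delta> \<inter> U"
  have "open V" unfolding V_def using conth U(1) continuous_on_open_vimage by blast
  have V: "V = k ` ball 0 \<delta>"
  proof (intro equalityI subsetI)
    fix p assume "p \<in> V"
    then show "p \<in> k ` ball 0 \<delta>" using kh by (intro image_eqI[of _ _ "h p"]) (auto simp: V_def)
  qed (use hk' in \<open>auto simp: V_def\<close>)
  define Hp Hm where "Hp = ball 0 \<delta> \<inter> {x :: real^2. 0 < x $ 2}" and "Hm = ball 0 \<delta> \<inter> {x :: real^2. x $ 2 < 0}"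
  obtain K where K: "continuous_on (J ` cball 0 \<rho>) K" "\<And>z. z \<in> cball 0 \<rho> \<Longrightarrow> K (J z) = z"
    using inverse_chart by blast
  have convex: "convex Hp" "convex Hm"
  proof -
    have "{x :: real^2. 0 < x $ 2} = {x. 0 < inner (axis 2 1) x}" "{x :: real^2. x $ 2 < 0} = {x. inner (axis 2 1) x < 0}"
      by (simp_all add: inner_axis inner_commute[of "axis 2 1"])
    then show "convex Hp" "convex Hm"
      unfolding Hp_def Hm_def by (auto intro!: convex_Int convex_halfspace_gt convex_halfspace_lt)
  qed
  have piece: "connected (J -` k ` H)" "J -` k ` H \<subseteq> ball 0 \<rho> - ?E" "J -` k ` H \<inter> ?F \<noteq> {}"
    if H: "convex H" "H \<subseteq> ball 0 \<delta>" "\<And>x. x \<in> H \<Longrightarrow> x $ 2 \<noteq> 0" "y \<in> H" "y $ 1 = 0" for H y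
  proof -
    have kH: "k ` H \<subseteq> J ` ball 0 \<rho>" using H(2) kW by (auto simp: W_def subset_iff)
    then have kH: "k ` H \<subseteq> J ` ball 0 \<rho>" "k ` H \<subseteq> J ` cball 0 \<rho>"
      using ball_subset_cball[of 0 \<rho>] by blast+
    have "connected (k ` H)"
      using H(1) contk by (intro connected_continuous_image convex_connected) (auto intro: continuous_on_subset)
    then have "connected (K ` k ` H)"
      using continuous_on_subset[OF K(1) kH(2)] by (rule connected_continuous_image[rotated])
    moreover have "K ` k ` H = J -` k ` H"
    proof (intro equalityI subsetI)
      fix z assume "z \<in> K ` k ` H"
      then obtain x where x: "x \<in> H" "z = K (k x)" by blast
      then obtain w where "w \<in> cball 0 \<rho>" "k x = J w" using kH(2) by blast
      then show "z \<in> J -` k ` H" using x K(2) by (metis imageI vimageI)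
    next
      fix z assume "z \<in> J -` k ` H"
      then obtain x where x: "x \<in> H" "J z = k x" by auto
      then obtain w where "w \<in> cball 0 \<rho>" "k x = J w" using kH(2) by blast
      then show "z \<in> K ` k ` H" using x K(2) injD[OF inj] by (metis imageI)
    qed
    ultimately show "connected (J -` k ` H)" by simp
    show "J -` k ` H \<subseteq> ball 0 \<rho> - ?E"
    proof
      fix z assume "z \<in> J -` k ` H"
      then obtain x where x: "x \<in> H" "J z = k x" by auto
      then have "J z \<in> J ` ball 0 \<rho>" using kH by auto
      then have "z \<in> ball 0 \<rho>" using injD[OF inj] by blast
      moreover have "J z \<notin> l" using x on_l H(3) by simp
      then have "z \<notin> ?E" using l(1) by blast
      ultimately show "z \<in> ball 0 \<rho> - ?E" by simp
    qed
    have "k y \<in> m" "k y \<in> W" using on_m H kW by auto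
    then have "k y \<in> J ` ?F" using m by (auto simp: W_def)
    then obtain z where "k y = J z" "z \<in> ?F" by (rule imageE)
    then show "J -` k ` H \<inter> ?F \<noteq> {}" using H(4) by (metis IntI empty_iff imageI vimageI)
  qed
  show ?thesis
  proof (rule spokes_alternate[OF \<rho> e f ee ef ang, of "J -` V" "J -` k ` Hp" "J -` k ` Hm"])
    show "open (J -` V)" using \<open>open V\<close> cont by (rule open_vimage)
    show "0 \<in> J -` V" using U(2) h0 \<delta>(1) by (simp add: V_def)
    show "J -` V \<subseteq> ball 0 \<rho>"
    proof
      fix z assume "z \<in> J -` V"
      then have "J z \<in> J ` ball 0 \<rho>" using kW unfolding V by (auto simp: W_def)
      then show "z \<in> ball 0 \<rho>" using injD[OF inj] by blast
    qed
    show "J -` V - ?E \<subseteq> J -` k ` Hp \<union> J -` k ` Hm"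
    proof
      fix z assume z: "z \<in> J -` V - ?E"
      then obtain x where x: "norm x < \<delta>" "J z = k x" unfolding V by auto
      have "J z \<notin> l"
      proof
        assume "J z \<in> l"
        then have "J z \<in> J ` ?E" using l(2) kW[OF x(1)] x(2) by (auto simp: W_def)
        then show False using z injD[OF inj] by blast
      qed
      then have "x $ 2 \<noteq> 0" using on_l x by simp
      then have "x \<in> Hp \<or> x \<in> Hm" using x by (auto simp: Hp_def Hm_def)
      then show "z \<in> J -` k ` Hp \<union> J -` k ` Hm" using x(2) by auto
    qed
    have "norm (axis 2 c :: real^2) = \<bar>c\<bar>" for c :: real
      by (simp add: norm_eq_sqrt_inner inner_axis_axis)
    then have "norm (axis 2 (\<delta> / 2) :: real^2) < \<delta>" "norm (axis 2 (- \<delta> / 2) :: real^2) < \<delta>"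
      using \<delta>(1) by simp_all
    moreover have "(axis 2 c :: real^2) $ 2 = c" "(axis 2 c :: real^2) $ 1 = 0" for c :: real
      by (simp_all add: axis_def)
    ultimately have ax: "axis 2 (\<delta> / 2) \<in> Hp" "axis 2 (- \<delta> / 2) \<in> Hm" "axis 2 (\<delta> / 2) $ (1 :: 2) = 0" "axis 2 (- \<delta> / 2) $ (1 :: 2) = 0"
      using \<delta>(1) by (simp_all add: Hp_def Hm_def)
    have H: "Hp \<subseteq> ball 0 \<delta>" "Hm \<subseteq> ball 0 \<delta>" "\<And>x. x \<in> Hp \<Longrightarrow> x $ 2 \<noteq> 0" "\<And>x. x \<in> Hm \<Longrightarrow> x $ 2 \<noteq> 0"
      by (auto simp: Hp_def Hm_def)
    show "connected (J -` k ` Hp)" "J -` k ` Hp \<subseteq> ball 0 \<rho> - ?E" "J -` k ` Hp \<inter> ?F \<noteq> {}"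
      by (rule piece[OF convex(1) H(1,3) ax(1,3)]; assumption)+
    show "connected (J -` k ` Hm)" "J -` k ` Hm \<subseteq> ball 0 \<rho> - ?E" "J -` k ` Hm \<inter> ?F \<noteq> {}"
      by (rule piece[OF convex(2) H(2,4) ax(2,4)]; assumption)+
  qed
qed

end

section \<open>The rotation at a point\<close>

locale incidence_structure =
  fixes P :: "rp2 set" and L :: "rp2 set set"
  assumes incidence: "quasi_topological_incidence_structure P L"
begin

lemma line_properties:
  shows "finite L" "finite P" "l \<in> L \<Longrightarrow> pseudoline l" "l \<in> L \<Longrightarrow> 2 \<le> card (P \<inter> l)"
    "\<lbrakk>l \<in> L; m \<in> L; l \<noteq> m\<rbrakk> \<Longrightarrow> finite (l \<inter> m)"
    "\<lbrakk>l \<in> L; m \<in> L; l \<noteq> m; p \<in> l; p \<in> m\<rbrakk> \<Longrightarrow> cross_transversally_at p l m"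
    "p \<in> P \<Longrightarrow> 2 \<le> card {l \<in> L. p \<in> l}"
  using incidence unfolding quasi_topological_incidence_structure_def quasiline_arrangement_def by auto

lemma line_cycle_at:
  assumes "l \<in> L" "v \<in> P" "v \<in> l"
  obtains k p a where "line_cycle P l k p a" "p 0 = v"
  using line_cycle_exists[of l P v] line_properties assms by blast

lemma line_has_point: assumes "l \<in> L" obtains v where "v \<in> P" "v \<in> l"
  using line_properties(4)[OF assms] by (metis IntE card.empty ex_in_conv not_numeral_le_zero)

lemma finite_line_arcs: assumes "l \<in> L" shows "finite (line_arcs P l)"
proof -
  obtain v where "v \<in> P" "v \<in> l" using line_has_point[OF assms] .
  then obtain k p a where "line_cycle P l k p a" "p 0 = v" using line_cycle_at[OF assms] by blast
  then have "line_arcs P l = a ` {..<k}" by (simp add: line_cycle_def)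
  then show ?thesis by simp
qed

lemma Union_line_arcs: assumes "l \<in> L" shows "\<Union> (line_arcs P l) = l"
proof -
  obtain v where "v \<in> P" "v \<in> l" using line_has_point[OF assms] .
  then obtain k p a where "line_cycle P l k p a" "p 0 = v" using line_cycle_at[OF assms] by blast
  then show ?thesis by (metis line_cycle_def)
qed

lemma line_arcs_meet_in_points:
  assumes "l \<in> L" "e \<in> line_arcs P l" "f \<in> line_arcs P l" "e \<noteq> f" shows "e \<inter> f \<subseteq> P"
proof -
  obtain v where "v \<in> P" "v \<in> l" using line_has_point[OF assms(1)] .
  then obtain k p a where c: "line_cycle P l k p a" "p 0 = v" using line_cycle_at[OF assms(1)] by blast
  have "a ` {..<k} = line_arcs P l" using c by (simp add: line_cycle_def)
  then obtain i j where "i < k" "j < k" "e = a i" "f = a j" using assms(2,3) by (metis imageE lessThan_iff)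
  then show ?thesis using c assms(4) unfolding line_cycle_def by metis
qed

lemma infinite_line_arc: assumes "e \<in> line_arcs P l" shows "infinite e"
proof
  assume "finite e"
  obtain g where "arc g" "e = path_image g" using assms by (auto simp: line_arcs_def)
  then have "finite {0..1::real}" using \<open>finite e\<close> by (auto simp: path_image_def arc_def intro: finite_imageD)
  then show False by (simp add: infinite_Icc)
qed

lemma line_arcs_disjoint:
  assumes "l \<in> L" "m \<in> L" "e \<in> line_arcs P l" "e \<in> line_arcs P m" shows "l = m"
proof (rule ccontr)
  assume "l \<noteq> m"
  have "e \<subseteq> l \<inter> m" using assms by (auto simp: line_arcs_def)
  then show False using line_properties(5)[OF assms(1,2) \<open>l \<noteq> m\<close>] infinite_line_arc[OF assms(3)] finite_subset by blast
qed

definition arcs_at :: "rp2 \<Rightarrow> rp2 set set" where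
  "arcs_at v = {e \<in> (\<Union>l\<in>L. line_arcs P l). v \<in> e}"

lemma finite_arcs_at: "finite (arcs_at v)"
  unfolding arcs_at_def using line_properties(1) finite_line_arcs by auto

lemma arcs_at_line:
  assumes "l \<in> L" "v \<in> P" "v \<in> l" "e \<in> line_arcs P l" "v \<in> e"
  obtains f where "f \<noteq> e" "{g \<in> line_arcs P l. v \<in> g} = {e, f}"
proof -
  have "card {g \<in> line_arcs P l. v \<in> g} = 2"
    using line_properties assms by (intro card_line_arcs_at) auto
  then obtain x y where xy: "{g \<in> line_arcs P l. v \<in> g} = {x, y}" "x \<noteq> y" by (auto simp: card_2_iff)
  have "e \<in> {g \<in> line_arcs P l. v \<in> g}" using assms by simp
  then consider "e = x" | "e = y" unfolding xy by blast
  then show thesis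
  proof cases
    case 1
    then show thesis using that[of y] xy by simp
  next
    case 2
    then show thesis using that[of x] xy by (simp add: insert_commute)
  qed
qed

lemma card_arcs_at:
  assumes "v \<in> P" shows "card (arcs_at v) = 2 * card {l \<in> L. v \<in> l}"
proof -
  have "arcs_at v = (\<Union>l\<in>{l \<in> L. v \<in> l}. {e \<in> line_arcs P l. v \<in> e})"
    by (auto simp: arcs_at_def line_arcs_def)
  also have "card \<dots> = (\<Sum>l\<in>{l \<in> L. v \<in> l}. card {e \<in> line_arcs P l. v \<in> e})"
    using line_properties(1) finite_line_arcs line_arcs_disjoint by (intro card_UN_disjoint) auto
  also have "\<dots> = (\<Sum>l\<in>{l \<in> L. v \<in> l}. 2)"
    using line_properties assms by (intro sum.cong card_line_arcs_at) auto
  finally show ?thesis by simp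
qed

lemma finite_arcs_meet:
  assumes "e \<in> arcs_at v" "f \<in> arcs_at v" "e \<noteq> f" shows "finite (e \<inter> f)"
proof -
  obtain l m where lm: "l \<in> L" "e \<in> line_arcs P l" "m \<in> L" "f \<in> line_arcs P m"
    using assms by (auto simp: arcs_at_def)
  show ?thesis
  proof (cases "l = m")
    case True
    then have "e \<inter> f \<subseteq> P" using line_arcs_meet_in_points[OF lm(1,2)] lm(4) assms(3) by simp
    then show ?thesis using line_properties(2) by (rule finite_subset)
  next
    case False
    have "e \<inter> f \<subseteq> l \<inter> m" using lm by (auto simp: line_arcs_def)
    then show ?thesis using line_properties(5)[OF lm(1,3) False] by (rule finite_subset)
  qed
qed

definition opposite_arc :: "rp2 \<Rightarrow> rp2 set \<Rightarrow> rp2 set" where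
  "opposite_arc v e = (THE f. f \<noteq> e \<and> (\<exists>l\<in>L. {g \<in> line_arcs P l. v \<in> g} = {e, f}))"

lemma opposite_arc_eq:
  assumes "l \<in> L" "{g \<in> line_arcs P l. v \<in> g} = {e, f}" "f \<noteq> e"
  shows "opposite_arc v e = f"
  unfolding opposite_arc_def
proof (rule the_equality)
  fix f' assume "f' \<noteq> e \<and> (\<exists>m\<in>L. {g \<in> line_arcs P m. v \<in> g} = {e, f'})"
  then obtain m where m: "m \<in> L" "{g \<in> line_arcs P m. v \<in> g} = {e, f'}" "f' \<noteq> e" by blast
  have "e \<in> line_arcs P l" "e \<in> line_arcs P m" using assms(2) m(2) by blast+
  then have "l = m" using line_arcs_disjoint assms(1) m(1) by blast
  then show "f' = f" using assms(2,3) m(2,3) by (auto simp: doubleton_eq_iff)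
qed (use assms in blast)

lemma opposite_arc:
  assumes "v \<in> P" "e \<in> arcs_at v"
  obtains l where "l \<in> L" "v \<in> l" "e \<in> line_arcs P l" "opposite_arc v e \<noteq> e"
    "{g \<in> line_arcs P l. v \<in> g} = {e, opposite_arc v e}"
    "opposite_arc v e \<in> arcs_at v" "opposite_arc v (opposite_arc v e) = e"
proof -
  obtain l where l: "l \<in> L" "e \<in> line_arcs P l" "v \<in> e" using assms by (auto simp: arcs_at_def)
  then have "v \<in> l" by (auto simp: line_arcs_def)
  then obtain f where f: "f \<noteq> e" "{g \<in> line_arcs P l. v \<in> g} = {e, f}"
    using arcs_at_line[OF l(1) assms(1)] l by blast
  have o: "opposite_arc v e = f" using opposite_arc_eq[OF l(1) f(2,1)] .
  have "opposite_arc v f = e" using opposite_arc_eq[OF l(1), of v f e] f by (simp add: insert_commute)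
  moreover have "f \<in> arcs_at v" using f(2) l(1) by (auto simp: arcs_at_def)
  ultimately show thesis using l \<open>v \<in> l\<close> f by (intro that[of l]) (simp_all add: o)
qed

text \<open>In a gnomonic chart at \<open>v\<close>, the initial pieces of the arcs are spokes of a disc which is so small that
  they meet only at the centre. The angles of their ends define the rotation; the ends of any two
  lines alternate, as the lines cross transversally at \<open>v\<close>.\<close>

lemma vertex_rotation_exists:
  assumes v: "v \<in> P" and n: "norm n = 1" "rp2_of n = v"
  obtains \<pi> where "cyclic_order_at P (arcs_at v) n \<pi>" "cyclic_on \<pi> (arcs_at v)"
    "\<And>e. e \<in> arcs_at v \<Longrightarrow> (\<pi> ^^ (card (arcs_at v) div 2)) e = opposite_arc v e"
proof -
  define A where "A = arcs_at v"
  have finA: "finite A" by (simp add: A_def finite_arcs_at)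
  have cardA: "2 \<le> card A" using card_arcs_at[OF v] line_properties(7)[OF v] by (simp add: A_def)
  have vA: "v \<in> e" if "e \<in> A" for e using that by (simp add: A_def arcs_at_def)
  obtain a b where fr: "positive_frame a b n" using positive_frame_exists[OF n(1)] .
  define s where "s = gnomonic_lift a b n"
  define J where "J = rp2_of \<circ> s"
  have J0: "J 0 = v" using lift_0[OF fr s_def] n by (simp add: J_def)
  have contJ: "continuous_on UNIV J" unfolding J_def by (rule continuous_on_chart[OF fr s_def])
  have injJ: "inj J" unfolding J_def by (rule inj_chart[OF fr s_def])

  \<comment> \<open>a disc whose closure contains no other point of \<open>P\<close> and no other common point of the arcs at \<open>v\<close>\<close>
  define Z where "Z = (P \<union> (\<Union>e\<in>A. \<Union>f\<in>A - {e}. e \<inter> f)) - {v}"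
  have "finite Z" unfolding Z_def
    using line_properties(2) finA finite_arcs_meet[of _ v] by (intro finite_Diff finite_UnI finite_UN_I) (auto simp: A_def)
  then have "open (J -` (- Z))" using contJ by (intro open_vimage) (simp_all add: finite_imp_closed open_Compl)
  moreover have "0 \<in> J -` (- Z)" using J0 by (simp add: Z_def)
  ultimately obtain \<epsilon> where \<epsilon>: "0 < \<epsilon>" "ball 0 \<epsilon> \<subseteq> J -` (- Z)" using open_contains_ball by blast
  define \<rho> where "\<rho> = min (\<epsilon> / 2) 1"
  have \<rho>: "0 < \<rho>" "\<rho> \<le> 1" "\<rho> < \<epsilon>" using \<epsilon>(1) by (auto simp: \<rho>_def)
  have cZ: "J ` cball 0 \<rho> \<inter> Z = {}" using \<epsilon>(2) \<rho>(3) by (auto simp: subset_iff)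
  define r where "r = chart_radius \<rho>"
  have r: "0 < r" "r < 1" using chart_radius_bounds[OF \<rho>(1,2)] by (simp_all add: r_def)
  have discs: "disc_at n r = J ` ball 0 \<rho>" "closed_disc_at n r = J ` cball 0 \<rho>"
    unfolding r_def J_def using discs_chart[OF fr s_def \<rho>(1)] by auto
  interpret disc_chart J \<rho>
    using contJ injJ open_disc_at[OF n(1), of r] \<rho>(1) unfolding discs by unfold_locales
  have v_disc: "v \<in> J ` cball 0 \<rho>" using J0 \<rho>(1) by (metis centre_in_cball imageI less_imp_le)
  have K_P: "closed_disc_at n r \<inter> P = {v}" unfolding discs using cZ v_disc v by (auto simp: Z_def)
  have K_meet: "e \<inter> f \<inter> J ` cball 0 \<rho> = {v}" if "e \<in> A" "f \<in> A" "e \<noteq> f" for e f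
    using cZ v_disc vA that by (auto simp: Z_def)

  define R where "R e q t \<theta> \<gamma> \<longleftrightarrow> arc q \<and> path_image q = e \<and> pathstart q = v \<and> 0 < t \<and> t < 1 \<and> 0 \<le> \<theta> \<and> \<theta> < 2 * pi \<and> spoke \<rho> \<theta> \<gamma> \<and>
      J ` path_image \<gamma> = q ` {0..t} \<and> q t = J (of_real \<rho> * cis \<theta>) \<and> (\<forall>s\<in>{0..<t}. q s \<in> J ` ball 0 \<rho>)"
    for e q t \<theta> \<gamma>
  have "\<exists>q t \<theta> \<gamma>. R e q t \<theta> \<gamma>" if e: "e \<in> A" for e
  proof -
    obtain l where "e \<in> line_arcs P l" "v \<in> e" using e by (auto simp: A_def arcs_at_def)
    then obtain q where q: "arc q" "path_image q = e" "pathstart q = v" "pathfinish q \<noteq> v" "e \<inter> P = {v, pathfinish q}"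
      using line_arc_from v by metis
    then have out: "pathfinish q \<notin> J ` cball 0 \<rho>" using K_P unfolding discs by blast
    have "pathstart q = J 0" using q(3) J0 by simp
    then obtain t \<theta> \<gamma> where "0 < t" "t < 1" "0 \<le> \<theta>" "\<theta> < 2 * pi" "spoke \<rho> \<theta> \<gamma>"
      "J ` path_image \<gamma> = q ` {0..t}" "q t = J (of_real \<rho> * cis \<theta>)" "\<And>s. s \<in> {0..<t} \<Longrightarrow> q s \<in> J ` ball 0 \<rho>"
      using arc_spoke[OF q(1) _ out] by blast
    then have "R e q t \<theta> \<gamma>" using q unfolding R_def by blast
    then show ?thesis by blast
  qed
  then obtain q t \<theta> \<gamma> where R: "\<And>e. e \<in> A \<Longrightarrow> R e (q e) (t e) (\<theta> e) (\<gamma> e)" by metis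
  have q: "arc (q e) \<and> path_image (q e) = e \<and> pathstart (q e) = v"
    and t: "0 < t e \<and> t e < 1"
    and \<theta>: "0 \<le> \<theta> e \<and> \<theta> e < 2 * pi"
    and \<gamma>: "spoke \<rho> (\<theta> e) (\<gamma> e)"
    and J\<gamma>: "J ` path_image (\<gamma> e) = q e ` {0..t e}"
    and qt: "q e (t e) = J (of_real \<rho> * cis (\<theta> e))"
    and q_in: "s \<in> {0..<t e} \<Longrightarrow> q e s \<in> J ` ball 0 \<rho>"
    if "e \<in> A" for e s
    using R[OF that] unfolding R_def by blast+
  have \<gamma>_sub: "J ` path_image (\<gamma> e) \<subseteq> e" "path_image (\<gamma> e) \<subseteq> cball 0 \<rho>" "0 \<in> path_image (\<gamma> e)"
    "of_real \<rho> * cis (\<theta> e) \<in> path_image (\<gamma> e)" if e: "e \<in> A" for e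
  proof -
    have "{0..t e} \<subseteq> {0..1}" using t[OF e] by auto
    then have "q e ` {0..t e} \<subseteq> path_image (q e)" unfolding path_image_def by (rule image_mono)
    then show "J ` path_image (\<gamma> e) \<subseteq> e" using J\<gamma>[OF e] q[OF e] by simp
    show "path_image (\<gamma> e) \<subseteq> cball 0 \<rho>"
      using \<gamma>[OF e] \<rho>(1) ball_subset_cball[of "0::complex" \<rho>] unfolding spoke_sphere[OF \<gamma>[OF e]]
      by (auto simp: spoke_def norm_mult)
    show "0 \<in> path_image (\<gamma> e)" "of_real \<rho> * cis (\<theta> e) \<in> path_image (\<gamma> e)"
      using \<gamma>[OF e] pathstart_in_path_image[of "\<gamma> e"] pathfinish_in_path_image[of "\<gamma> e"] by (auto simp: spoke_def)
  qed
  have \<gamma>_meet: "path_image (\<gamma> e) \<inter> path_image (\<gamma> f) = {0}" if ef: "e \<in> A" "f \<in> A" "e \<noteq> f" for e f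
  proof -
    have "z = 0" if "z \<in> path_image (\<gamma> e)" "z \<in> path_image (\<gamma> f)" for z
    proof -
      have "J z \<in> e \<inter> f \<inter> J ` cball 0 \<rho>" using that \<gamma>_sub ef by blast
      then have "J z = J 0" using K_meet[OF ef] J0 by blast
      then show ?thesis by (rule injD[OF injJ])
    qed
    then show ?thesis using \<gamma>_sub(3) ef by blast
  qed
  have \<theta>_inj: "inj_on \<theta> A"
  proof (rule inj_onI, rule ccontr)
    fix e f assume ef: "e \<in> A" "f \<in> A" "\<theta> e = \<theta> f" "e \<noteq> f"
    then have "of_real \<rho> * cis (\<theta> e) \<in> path_image (\<gamma> e) \<inter> path_image (\<gamma> f)"
      using \<gamma>_sub(4)[OF ef(1)] \<gamma>_sub(4)[OF ef(2)] by simp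
    then show False using \<gamma>_meet[OF ef(1,2,4)] \<rho>(1) by auto
  qed

  have opp: "opposite_arc v e \<in> A \<and> opposite_arc v e \<noteq> e \<and> opposite_arc v (opposite_arc v e) = e" if "e \<in> A" for e
    using opposite_arc[OF v] that unfolding A_def by metis
  define rest where "rest e = q e ` {t e..1}" for e
  have rest: "closed (rest e)" "v \<notin> rest e" "e = J ` path_image (\<gamma> e) \<union> rest e" if e: "e \<in> A" for e
  proof -
    have cq: "continuous_on {0..1} (q e)" and iq: "inj_on (q e) {0..1}" using q[OF e] by (auto simp: arc_def path_def)
    have sub: "{t e..1} \<subseteq> {0..1}" using t[OF e] by auto
    show "closed (rest e)" unfolding rest_def
      using continuous_on_subset[OF cq sub] by (intro compact_imp_closed compact_continuous_image) auto
    show "v \<notin> rest e"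
    proof
      assume "v \<in> rest e"
      then obtain u where u: "u \<in> {t e..1}" "q e u = v" by (auto simp: rest_def)
      moreover have "q e 0 = v" using q[OF e] by (simp add: pathstart_def)
      ultimately have "u = 0" using sub by (intro inj_onD[OF iq]) auto
      then show False using u(1) t[OF e] by auto
    qed
    have "{0..1} = {0..t e} \<union> {t e..1}" using t[OF e] by auto
    then show "e = J ` path_image (\<gamma> e) \<union> rest e"
      using q[OF e] J\<gamma>[OF e] unfolding path_image_def rest_def by (metis image_Un)
  qed
  \<comment> \<open>the part of a line beyond the first exits of its two arcs at \<open>v\<close>\<close>
  define far where "far l = (\<Union>g\<in>line_arcs P l. if v \<in> g then rest g else g)" for l
  have far: "closed (far l)" "v \<notin> far l" "l \<subseteq> J ` (path_image (\<gamma> e) \<union> path_image (\<gamma> f)) \<union> far l"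
    "J ` (path_image (\<gamma> e) \<union> path_image (\<gamma> f)) \<subseteq> l"
    if l: "l \<in> L" "{g \<in> line_arcs P l. v \<in> g} = {e, f}" for l e f
  proof -
    have gA: "g \<in> A" if "g \<in> line_arcs P l" "v \<in> g" for g using that l(1) by (auto simp: A_def arcs_at_def)
    have "closed g" if "g \<in> line_arcs P l" for g
      using that by (auto simp: line_arcs_def intro: compact_imp_closed compact_arc_image)
    then show "closed (far l)" unfolding far_def
      using finite_line_arcs[OF l(1)] rest(1) gA by (intro closed_UN) auto
    have "v \<notin> (if v \<in> g then rest g else g)" if "g \<in> line_arcs P l" for g
      using rest(2) gA[OF that] by simp
    then show "v \<notin> far l" unfolding far_def by blast
    have "e \<in> {g \<in> line_arcs P l. v \<in> g}" "f \<in> {g \<in> line_arcs P l. v \<in> g}" unfolding l(2) by simp_all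
    then have ef: "e \<in> A" "f \<in> A" "e \<subseteq> l" "f \<subseteq> l" using gA by (simp_all add: line_arcs_def) blast+
    show "l \<subseteq> J ` (path_image (\<gamma> e) \<union> path_image (\<gamma> f)) \<union> far l"
    proof
      fix x assume "x \<in> l"
      then obtain g where g: "g \<in> line_arcs P l" "x \<in> g" using Union_line_arcs[OF l(1)] by blast
      show "x \<in> J ` (path_image (\<gamma> e) \<union> path_image (\<gamma> f)) \<union> far l"
      proof (cases "v \<in> g")
        case True
        then have "g = e \<or> g = f" using g l(2) by blast
        moreover have "x \<in> J ` path_image (\<gamma> g) \<or> x \<in> rest g" using rest(3)[OF gA[OF g(1) True]] g(2) by blast
        moreover have "rest g \<subseteq> far l" unfolding far_def using g(1) True by auto
        ultimately show ?thesis by blast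
      next
        case False
        then have "x \<in> far l" unfolding far_def using g by auto
        then show ?thesis by simp
      qed
    qed
    show "J ` (path_image (\<gamma> e) \<union> path_image (\<gamma> f)) \<subseteq> l" using \<gamma>_sub(1) ef by blast
  qed
  have sep: "(\<theta> e < \<theta> f \<and> \<theta> f < \<theta> (opposite_arc v e)) \<noteq>
      (\<theta> e < \<theta> (opposite_arc v f) \<and> \<theta> (opposite_arc v f) < \<theta> (opposite_arc v e))"
    if ef: "e \<in> A" "f \<in> A" "f \<noteq> e" "f \<noteq> opposite_arc v e" "\<theta> e < \<theta> (opposite_arc v e)" for e f
  proof -
    obtain l where l: "l \<in> L" "v \<in> l" "e \<in> line_arcs P l" "{g \<in> line_arcs P l. v \<in> g} = {e, opposite_arc v e}"
      using opposite_arc[OF v] ef(1) unfolding A_def by metis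
    obtain m where m: "m \<in> L" "v \<in> m" "f \<in> line_arcs P m" "{g \<in> line_arcs P m. v \<in> g} = {f, opposite_arc v f}"
      using opposite_arc[OF v] ef(2) unfolding A_def by metis
    let ?e = "opposite_arc v e" and ?f = "opposite_arc v f"
    have "l \<noteq> m" using l(4) m(3,4) ef(3,4) by blast
    then have tr: "cross_transversally_at (J 0) l m" using line_properties(6) l m J0 by simp
    have oA: "?e \<in> A" "?f \<in> A" "?e \<noteq> e" "?f \<noteq> f" using opp ef by auto
    have "?f \<noteq> e" "?f \<noteq> ?e"
      using opp[OF ef(1)] opp[OF ef(2)] ef(3,4) by metis+
    show ?thesis
    proof (rule transversal_spokes_alternate[OF tr \<gamma>[OF ef(1)] \<gamma>[OF oA(1)] \<gamma>[OF ef(2)] \<gamma>[OF oA(2)]])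
      show "path_image (\<gamma> e) \<inter> path_image (\<gamma> ?e) = {0}" using \<gamma>_meet ef(1) oA by metis
      show "(path_image (\<gamma> e) \<union> path_image (\<gamma> ?e)) \<inter> (path_image (\<gamma> f) \<union> path_image (\<gamma> ?f)) = {0}"
        using \<gamma>_meet[OF ef(1,2)] \<gamma>_meet[OF ef(1) oA(2)] \<gamma>_meet[OF oA(1) ef(2)] \<gamma>_meet[OF oA(1,2)]
          ef(3,4) \<open>?f \<noteq> e\<close> \<open>?f \<noteq> ?e\<close> by blast
      show "closed (far l)" "J 0 \<notin> far l" "l \<subseteq> J ` (path_image (\<gamma> e) \<union> path_image (\<gamma> ?e)) \<union> far l"
        "J ` (path_image (\<gamma> e) \<union> path_image (\<gamma> ?e)) \<subseteq> l"
        using far[OF l(1,4)] J0 by auto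
      show "closed (far m)" "J 0 \<notin> far m" "m \<subseteq> J ` (path_image (\<gamma> f) \<union> path_image (\<gamma> ?f)) \<union> far m"
        using far[OF m(1,4)] J0 by auto
    qed (use \<theta> ef oA in auto)
  qed

  obtain \<pi> where \<pi>: "cyclic_on \<pi> A" "\<And>e. e \<in> A \<Longrightarrow> \<pi> e \<in> A - {e}"
    "\<And>e f. \<lbrakk>e \<in> A; f \<in> A - {e, \<pi> e}\<rbrakk> \<Longrightarrow> \<exists>\<beta> \<gamma>. cis \<beta> = cis (\<theta> (\<pi> e)) \<and> cis \<gamma> = cis (\<theta> f) \<and>
      \<theta> e < \<beta> \<and> \<beta> < \<gamma> \<and> \<gamma> < \<theta> e + 2 * pi"
    "\<And>e. e \<in> A \<Longrightarrow> (\<pi> ^^ (card A div 2)) e = opposite_arc v e"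
    using angular_rotation_exists[OF finA cardA \<theta>_inj \<theta> opp sep] by blast
  define x where "x e = s (of_real \<rho> * cis (\<theta> e))" for e
  have on_circle: "cmod (of_real \<rho> * cis u) = \<rho>" for u using \<rho>(1) by (simp add: norm_mult)
  have exit: "first_exit n r e (x e)" if e: "e \<in> A" for e
    unfolding first_exit_def
  proof (intro conjI exI[of _ "q e"] exI[of _ "t e"] ballI)
    show "norm (x e) = 1" by (simp add: x_def norm_lift[OF fr s_def])
    show "dist n (x e) = r" by (simp add: x_def dist_lift[OF fr s_def] on_circle r_def)
    show "arc (q e)" "path_image (q e) = e" "pathstart (q e) = rp2_of n" using q[OF e] n by auto
    show "t e \<in> {0..1}" using t[OF e] by auto
    show "q e (t e) = rp2_of (x e)" using qt[OF e] by (simp add: J_def x_def)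
    show "q e u \<in> disc_at n r" if "u \<in> {0..<t e}" for u using q_in[OF e that] discs by simp
  qed
  have ccw: "counterclockwise n (x e) (x (\<pi> e)) (x f)" if ef: "e \<in> A" "f \<in> A - {e, \<pi> e}" for e f
  proof -
    obtain \<beta> \<gamma>' where bg: "cis \<beta> = cis (\<theta> (\<pi> e))" "cis \<gamma>' = cis (\<theta> f)" "\<theta> e < \<beta>" "\<beta> < \<gamma>'" "\<gamma>' < \<theta> e + 2 * pi"
      using \<pi>(3)[OF ef] by blast
    show ?thesis
      unfolding x_def bg(1)[symmetric] bg(2)[symmetric]
        counterclockwise_lift[OF fr s_def on_circle on_circle on_circle]
      using bg(3-5) \<rho>(1) by (rule counterclockwise_on_circle)
  qed
  have "cyclic_order_at P A n \<pi>"
    unfolding cyclic_order_at_def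
  proof (intro exI[of _ r] exI[of _ x] conjI ballI impI)
    show "closed_disc_at n r \<inter> P = {rp2_of n}" using K_P n by simp
    show "e \<inter> f \<inter> closed_disc_at n r = {rp2_of n}" if "e \<in> A" "f \<in> A" "e \<noteq> f" for e f
      using K_meet[OF that] n discs by simp
  qed (use r exit ccw \<pi>(2) in auto)
  then show thesis using that \<pi>(1,4) unfolding A_def by blast
qed

end

section \<open>The map and its straight-ahead walks\<close>

lemma orientations_agree_sym: "orientations_agree n e u v \<Longrightarrow> orientations_agree n e v u"
proof -
  assume "orientations_agree n e u v"
  then obtain h where h: "path h" "path_image h \<subseteq> sphere 0 1" "arc (rp2_of \<circ> h)"
    "path_image (rp2_of \<circ> h) = e" "pathstart h = n u" "pathfinish h = n v"
    by (auto simp: orientations_agree_def)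
  have "rp2_of \<circ> reversepath h = reversepath (rp2_of \<circ> h)" by (simp add: reversepath_def comp_def)
  then show ?thesis
    unfolding orientations_agree_def using h arc_reversepath[OF h(3)]
    by (intro exI[of _ "reversepath h"]) simp
qed

lemma (in incidence_structure) line_cycle_step:
  assumes l: "l \<in> L" and c: "line_cycle P l k p a" and i: "i < k"
  shows "a i \<inter> P = {p i, p (Suc i mod k)}" "p (Suc i mod k) \<noteq> p i"
    "opposite_arc (p (Suc i mod k)) (a i) = a (Suc i mod k)"
proof -
  let ?j = "Suc i mod k"
  have k: "2 \<le> k" "?j < k" using c i by (auto simp: line_cycle_def)
  have ij: "?j \<noteq> i" using i k by (cases "Suc i = k") auto
  have aP: "a j \<inter> P = {p j, p (Suc j mod k)}" if "j < k" for j using c that by (simp add: line_cycle_def)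
  show "a i \<inter> P = {p i, p ?j}" by (rule aP[OF i])
  have "inj_on p {..<k}" "inj_on a {..<k}" using c by (simp_all add: line_cycle_def)
  then have neq: "p ?j \<noteq> p i" "a ?j \<noteq> a i" using ij i k by (auto dest: inj_onD)
  then show "p ?j \<noteq> p i" by simp
  have arcs: "a ` {..<k} = line_arcs P l" using c by (simp add: line_cycle_def)
  have "{g \<in> line_arcs P l. p ?j \<in> g} = {a i, a ?j}"
  proof (intro equalityI subsetI)
    fix g assume g: "g \<in> {g \<in> line_arcs P l. p ?j \<in> g}"
    then obtain j where "j < k" "g = a j" using arcs by auto
    then show "g \<in> {a i, a ?j}" using line_cycle_arcs_at[OF c i] g by auto
  next
    fix g assume "g \<in> {a i, a ?j}"
    moreover have "p ?j \<in> a i" "p ?j \<in> a ?j" using aP[OF i] aP[OF k(2)] by auto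
    moreover have "a i \<in> line_arcs P l" "a ?j \<in> line_arcs P l" using arcs i k(2) by auto
    ultimately show "g \<in> {g \<in> line_arcs P l. p ?j \<in> g}" by auto
  qed
  then show "opposite_arc (p ?j) (a i) = a ?j" by (rule opposite_arc_eq[OF l _ neq(2)])
qed

lemma line_arc_ends:
  assumes "e \<in> line_arcs P l" shows "card (e \<inter> P) = 2"
proof -
  obtain g where "arc g" "e = path_image g" "path_image g \<inter> P = {pathstart g, pathfinish g}"
    using assms by (auto simp: line_arcs_def)
  then show ?thesis using arc_distinct_ends[of g] by simp
qed

text \<open>What is needed of the map, apart from the geometric meaning of its rotations and its signature.\<close>

locale incidence_map = incidence_structure +
  fixes M :: "(rp2, rp2 set) scheme"
  assumes verts: "verts M = P" and edges: "edges M = (\<Union>l\<in>L. line_arcs P l)"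
    and ends: "ends M e = e \<inter> P" and sign: "signature M e \<in> {1, - 1}"
    and rotation_cyclic_on: "v \<in> P \<Longrightarrow> cyclic_on (rotation M v) (arcs_at v)"
    and rotation_opposite: "\<lbrakk>v \<in> P; e \<in> arcs_at v\<rbrakk> \<Longrightarrow>
      (rotation M v ^^ (card (arcs_at v) div 2)) e = opposite_arc v e"
begin

lemma edges_at: "v \<in> P \<Longrightarrow> edges_at M v = arcs_at v"
  by (auto simp: edges_at_def edges ends arcs_at_def)

lemma embedding_scheme_map: "embedding_scheme M"
  unfolding embedding_scheme_def
  using line_properties(1,2) finite_line_arcs line_arc_ends rotation_cyclic_on sign
  by (auto simp: verts edges ends edges_at)

lemma degree_map: "v \<in> P \<Longrightarrow> card (edges_at M v) = 2 * card {l \<in> L. v \<in> l}"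
  by (simp add: edges_at card_arcs_at)

lemma eulerian_map: "eulerian M"
  by (simp add: eulerian_def verts degree_map)

sublocale thick_scheme M
proof
  show "2 \<le> card (edges_at M v)" if "v \<in> verts M" for v
    using that line_properties(7)[of v] degree_map[of v] by (simp add: verts)
qed (rule embedding_scheme_map)

text \<open>At every point, the walk leaves along the other arc of the line by which it arrives, and hence it
  follows the cycle of points and arcs of this line. The darts of the walk being distinct, it stops
  after one turn.\<close>

lemma straight_ahead_walk_line:
  assumes W: "straight_ahead_walk M W"
  shows "simple_closed_curve (surface M) (walk_curve M W) \<and> (\<exists>l\<in>L. snd ` set W = line_arcs P l)"
proof -
  define n where "n = length W"
  have ne: "W \<noteq> []" and dist: "distinct W" and darts: "\<And>d. d \<in> set W \<Longrightarrow> fst d \<in> verts M \<and> snd d \<in> edges_at M (fst d)"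
    and nxt: "\<And>i. i < n \<Longrightarrow> W ! (Suc i mod n) = straight_ahead_step M (W ! i)"
    using W by (auto simp: straight_ahead_walk_def n_def)
  have n: "0 < n" using ne by (simp add: n_def)
  obtain v e where ve: "W ! 0 = (v, e)" by (cases "W ! 0")
  have "(v, e) \<in> set W" using n nth_mem[of 0 W] by (simp add: ve n_def)
  then have "v \<in> P" "e \<in> arcs_at v" using darts[of "(v, e)"] edges_at by (auto simp: verts)
  then obtain l where l: "l \<in> L" "e \<in> line_arcs P l" "v \<in> e" by (auto simp: arcs_at_def)
  obtain k p a where c: "line_cycle P l k p a" and p0: "p 0 = v" and a0: "a 0 = e"
    using line_cycle_exists_from[OF line_properties(3)[OF l(1)] line_properties(2) line_properties(4)[OF l(1)] l(2,3) \<open>v \<in> P\<close>] by blast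
  have k: "2 \<le> k" and p_inj: "inj_on p {..<k}" and p_im: "p ` {..<k} = P \<inter> l"
    and a_inj: "inj_on a {..<k}" and a_im: "a ` {..<k} = line_arcs P l"
    using c by (auto simp: line_cycle_def)
  have other: "other_end M (a i) (p i) = p (Suc i mod k)" if "i < k" for i
    unfolding other_end_def ends using line_cycle_step(1,2)[OF l(1) c that]
    by (intro the_equality) (auto simp: doubleton_eq_iff)
  have step: "straight_ahead_step M (p i, a i) = (p (Suc i mod k), a (Suc i mod k))" if i: "i < k" for i
  proof -
    let ?j = "Suc i mod k"
    have "p ?j \<in> P" using p_im k by auto
    moreover have "a i \<in> arcs_at (p ?j)"
      using line_cycle_step(1)[OF l(1) c i] a_im i l(1) by (auto simp: arcs_at_def)
    ultimately have "opposite_edge M (p ?j) (a i) = a ?j"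
      using rotation_opposite line_cycle_step(3)[OF l(1) c i] by (simp add: opposite_edge_def edges_at)
    then show ?thesis using other[OF i] by (simp add: straight_ahead_step_def)
  qed
  have W_nth: "W ! i = (p (i mod k), a (i mod k))" if "i < n" for i
    using that
  proof (induction i)
    case (Suc i)
    have "W ! Suc i = straight_ahead_step M (W ! i)" using nxt[of i] Suc.prems by simp
    also have "\<dots> = (p (Suc (i mod k) mod k), a (Suc (i mod k) mod k))"
      using Suc k by (simp add: step)
    finally show ?case by (simp add: mod_Suc_eq)
  qed (simp add: ve p0 a0)
  have "n = k"
  proof -
    have "W ! 0 = straight_ahead_step M (W ! (n - 1))" using nxt[of "n - 1"] n by simp
    also have "\<dots> = (p (Suc ((n - 1) mod k) mod k), a (Suc ((n - 1) mod k) mod k))"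
      using W_nth[of "n - 1"] n k by (simp add: step)
    also have "Suc ((n - 1) mod k) mod k = n mod k" using n by (simp add: mod_Suc_eq)
    finally have "p (n mod k) = p 0" using ve p0 by simp
    then have "n mod k = 0" using k by (intro inj_onD[OF p_inj]) auto
    then have "k \<le> n" using n by (metis mod_less not_le less_irrefl)
    moreover have "\<not> k < n"
    proof
      assume "k < n"
      then have "W ! k = W ! 0" using W_nth[of k] W_nth[of 0] n by simp
      then show False using dist \<open>k < n\<close> k n by (simp add: nth_eq_iff_index_eq n_def)
    qed
    ultimately show ?thesis by simp
  qed
  then have W_eq: "W = map (\<lambda>i. (p i, a i)) [0..<k]"
    using W_nth by (intro nth_equalityI) (simp_all add: n_def)
  have "simple_closed_curve (surface M) (walk_curve M W)"
  proof (rule simple_closed_walk_curve[OF ne darts])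
    show "fst (W ! (Suc i mod length W)) = other_end M (snd (W ! i)) (fst (W ! i))" if "i < length W" for i
      using that other[of i] k by (simp add: W_eq)
    show "distinct (map fst W)" "distinct (map snd W)"
      using p_inj a_inj by (simp_all add: W_eq comp_def distinct_map atLeast0LessThan)
  qed
  moreover have "snd ` set W = line_arcs P l"
    by (simp add: W_eq image_image atLeast0LessThan a_im)
  ultimately show ?thesis using l(1) by blast
qed

end

lemma (in incidence_structure) map_exists:
  obtains M where "map_of_incidence_structure P L M" "incidence_map P L M"
proof -
  define n where "n p = (SOME x. norm x = 1 \<and> rp2_of x = p)" for p
  have n: "norm (n p) = 1" "rp2_of (n p) = p" for p
  proof -
    have "\<exists>x. norm x = 1 \<and> rp2_of x = p" by (metis rp2_exhaust)
    from someI_ex[OF this] show "norm (n p) = 1" "rp2_of (n p) = p" by (simp_all add: n_def)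
  qed
  have "\<exists>\<pi>. cyclic_order_at P (arcs_at v) (n v) \<pi> \<and> cyclic_on \<pi> (arcs_at v) \<and>
      (\<forall>e\<in>arcs_at v. (\<pi> ^^ (card (arcs_at v) div 2)) e = opposite_arc v e)" if "v \<in> P" for v
    using vertex_rotation_exists[OF that n] by metis
  then obtain rot where rot: "\<And>v. v \<in> P \<Longrightarrow> cyclic_order_at P (arcs_at v) (n v) (rot v) \<and> cyclic_on (rot v) (arcs_at v) \<and>
      (\<forall>e\<in>arcs_at v. (rot v ^^ (card (arcs_at v) div 2)) e = opposite_arc v e)"
    by metis
  define M :: "(rp2, rp2 set) scheme" where
    "M = \<lparr>verts = P, edges = (\<Union>l\<in>L. line_arcs P l), ends = (\<lambda>e. e \<inter> P), rotation = rot,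
      signature = (\<lambda>e. if \<exists>u v. e \<inter> P = {u, v} \<and> orientations_agree n e u v then 1 else - 1)\<rparr>"
  interpret incidence_map P L M
    by unfold_locales (use rot in \<open>auto simp: M_def\<close>)
  have "signature M e = (if orientations_agree n e u v then 1 else - 1)" if "ends M e = {u, v}" for e u v
  proof -
    have "orientations_agree n e u v" if "e \<inter> P = {u', v'}" "orientations_agree n e u' v'" for u' v'
      using that \<open>ends M e = {u, v}\<close> orientations_agree_sym by (auto simp: M_def doubleton_eq_iff)
    then show ?thesis using that by (auto simp: M_def)
  qed
  then have "map_of_incidence_structure P L M"
    unfolding map_of_incidence_structure_def
    using n rot edges_at by (auto simp: verts edges ends local_orientations_def M_def intro!: exI[of _ n])
  then show thesis using that incidence_map_axioms by blast
qed

theorem theorem9p1: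
  fixes P :: "rp2 set" and L :: "rp2 set set"
  assumes "quasi_topological_incidence_structure P L"
  shows "\<exists>M. map_of_incidence_structure P L M \<and> embedding_scheme M \<and>
           closed_surface (surface M) \<and> eulerian M \<and> verts M = P \<and>
           (\<forall>W. straight_ahead_walk M W \<longrightarrow>
              simple_closed_curve (surface M) (walk_curve M W) \<and>
              (\<exists>l\<in>L. snd ` set W = line_arcs P l))"
proof -
  interpret incidence_structure P L by unfold_locales (rule assms)
  obtain M where M: "map_of_incidence_structure P L M" "incidence_map P L M" by (rule map_exists)
  interpret incidence_map P L M by (rule M(2))
  show ?thesis
    using M(1) embedding_scheme_map closed_surface_surface eulerian_map verts straight_ahead_walk_line by blast
qed

end
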